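(* Let $C$ be a symmetric positive-definite $d\times d$ matrix and let the target density $\bar p_0\in C^2(\mathbb{R}^d)$ have bounded third moment, $\mathbb{E}_{\bar p_0}|x|^3<\infty$, and satisfy the Gaussian tail assumption (see context). Let $p_t$, $S$ be as in the context and $V(t,x)=\frac1t[x+S(t,x)]$ for $t\in(0,1]$. Then the Föllmer velocity field is well defined at $t=0$, in the sense that $$V(0,x):=\lim_{t\to0}V(t,x)=\lim_{t\to0}\frac{x+S(t,x)}{t}=\sqrt C\,\mathbb{E}_{\bar p_0}[X].$$ Consequently, the Föllmer flow $(\overset{\leftarrow}{X}_t)_{t\in[0,1]}$ is a unique solution to the initial value problem $$\frac{d\overset{\leftarrow}{X}_t}{dt}=V(t,\overset{\leftarrow}{X}_t),\quad t\in[0,1],\qquad\overset{\leftarrow}{X}_0\sim\gamma_C.$$ Moreover, the push-forward measure satisfies $\gamma_C\circ(\overset{\leftarrow}{X}_1)^{-1}=\bar p_0$, where $\overset{\leftarrow}{X}_1$ is the time-one flow map.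
   Context: $\gamma_C$ denotes the Gaussian distribution $\mathcal N(0,C)$. $|\cdot|$ is the Euclidean norm, $\|\cdot\|$ the operator norm, $|f|_\infty=\sup_x|f(x)|$, $\|F\|_\infty=\sup_x\|F(x)\|$, $|x|_A^2=(A^{-1/2}x,A^{-1/2}x)$. Gaussian tail assumption: $\bar p_0(x)=\exp(-|x|_A^2/2)\exp(h(x))$, where, with constants independent of the dimension, (i) $A$ is symmetric positive definite, can be simultaneously diagonalized with $C$, and $\|A\|,\|C\|,\|AC^{-1}\|,\|CA^{-1}\|<\infty$; (ii) $|\sqrt C\nabla h|_\infty<\infty$ and $\|C\nabla^2h\|_\infty<\infty$. $p_t$ is the density of $tX_0+\sqrt{1-t^2}\,\sqrt CZ$ with $X_0\sim\bar p_0$ and $Z\sim\mathcal N(0,I_d)$ independent (equivalently the time-$(1-t)$ marginal density of the forward diffusion $dX_s=-\frac1{1-s}X_sds+\sqrt{\frac{2C}{1-s}}dW_s$ started from $\bar p_0$), and $S(t,x)=C\nabla\log p_t(x)$.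
   Formalization: The limit V(0,x) is stated and proved as E[X], with X distributed as the target, instead of √C E[X]; the printed factor √C is wrong for the given definitions (d=1, C=A=4, target N(4,4) gives V=4, not 8). *)

theory Defs
  imports "HOL-Probability.Probability"
begin

definition sym_pos_def :: "real^'n^'n \<Rightarrow> bool" where
  "sym_pos_def C \<longleftrightarrow> transpose C = C \<and> (\<forall>x. x \<noteq> 0 \<longrightarrow> 0 < x \<bullet> (C *v x))"

definition mat_sqrt :: "real^'n^'n \<Rightarrow> real^'n^'n" where
  "mat_sqrt C = (THE B. sym_pos_def B \<and> B ** B = C)"

definition mat_norm :: "real^'n^'m \<Rightarrow> real" where
  "mat_norm A = onorm (\<lambda>x. A *v x)"

definition weighted_norm :: "real^'n^'n \<Rightarrow> real^'n \<Rightarrow> real" where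
  "weighted_norm A x = norm (matrix_inv (mat_sqrt A) *v x)"

definition diagonal_mat :: "real^'n^'n \<Rightarrow> bool" where
  "diagonal_mat D \<longleftrightarrow> (\<forall>i j. i \<noteq> j \<longrightarrow> D $ i $ j = 0)"

definition simultaneously_diagonalizable :: "real^'n^'n \<Rightarrow> real^'n^'n \<Rightarrow> bool" where
  "simultaneously_diagonalizable A C \<longleftrightarrow>
     (\<exists>Q. orthogonal_matrix Q \<and> diagonal_mat (transpose Q ** A ** Q)
        \<and> diagonal_mat (transpose Q ** C ** Q))"

definition gradient :: "(real^'n \<Rightarrow> real) \<Rightarrow> real^'n \<Rightarrow> real^'n" where
  "gradient f x = (THE D. GDERIV f x :> D)"

definition hessian :: "(real^'n \<Rightarrow> real) \<Rightarrow> real^'n \<Rightarrow> real^'n^'n" where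
  "hessian f x = jacobian (gradient f) (at x)"

definition C2_function :: "(real^'n \<Rightarrow> real) \<Rightarrow> bool" where
  "C2_function f \<longleftrightarrow>
     (\<forall>x. f differentiable at x) \<and> (\<forall>x. gradient f differentiable at x)
     \<and> continuous_on UNIV (hessian f)"

text \<open>
  The bound \<open>K\<close> is a parameter, so that it can be chosen before the dimension. The normalising
  constant of the density is absorbed into \<open>h\<close>.
\<close>
definition gaussian_tail ::
    "real \<Rightarrow> real^'n^'n \<Rightarrow> real^'n^'n \<Rightarrow> (real^'n \<Rightarrow> real) \<Rightarrow> (real^'n \<Rightarrow> real) \<Rightarrow> bool" where
  "gaussian_tail K C A h p0 \<longleftrightarrow>
     (\<forall>x. p0 x = exp (- ((weighted_norm A x)\<^sup>2 / 2)) * exp (h x))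
     \<and> sym_pos_def A \<and> simultaneously_diagonalizable A C
     \<and> mat_norm A \<le> K \<and> mat_norm C \<le> K
     \<and> mat_norm (A ** matrix_inv C) \<le> K \<and> mat_norm (C ** matrix_inv A) \<le> K
     \<and> (\<forall>x. norm (mat_sqrt C *v gradient h x) \<le> K)
     \<and> (\<forall>x. mat_norm (C ** hessian h x) \<le> K)"

definition gaussian :: "real^'n^'n \<Rightarrow> (real^'n) measure" where
  "gaussian C = density lborel
     (\<lambda>x. ennreal (exp (- (x \<bullet> (matrix_inv C *v x)) / 2) / sqrt ((2 * pi) ^ CARD('n) * det C)))"

definition target :: "(real^'n \<Rightarrow> real) \<Rightarrow> (real^'n) measure" where
  "target p0 = density lborel (\<lambda>x. ennreal (p0 x))"

text \<open>The law of \<open>t X\<^sub>0 + sqrt (1 - t\<^sup>2) sqrt C Z\<close> for independent \<open>X\<^sub>0\<close> and standard normal \<open>Z\<close>.\<close>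
definition interpolant_law ::
    "real^'n^'n \<Rightarrow> (real^'n \<Rightarrow> real) \<Rightarrow> real \<Rightarrow> (real^'n) measure" where
  "interpolant_law C p0 t =
     distr (target p0 \<Otimes>\<^sub>M gaussian (mat 1)) borel
       (\<lambda>(x, z). t *\<^sub>R x + sqrt (1 - t\<^sup>2) *\<^sub>R (mat_sqrt C *v z))"

text \<open>
  Lebesgue densities are only unique almost everywhere; requiring continuity singles out the
  version whose pointwise gradient is meant in the score.
\<close>
definition interpolant_density ::
    "real^'n^'n \<Rightarrow> (real^'n \<Rightarrow> real) \<Rightarrow> real \<Rightarrow> real^'n \<Rightarrow> real" where
  "interpolant_density C p0 t =
     (THE p. continuous_on UNIV p \<and> (\<forall>x. 0 \<le> p x)
        \<and> interpolant_law C p0 t = density lborel (\<lambda>x. ennreal (p x)))"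

definition score :: "real^'n^'n \<Rightarrow> (real^'n \<Rightarrow> real) \<Rightarrow> real \<Rightarrow> real^'n \<Rightarrow> real^'n" where
  "score C p0 t x = C *v gradient (\<lambda>y. ln (interpolant_density C p0 t y)) x"

definition velocity :: "real^'n^'n \<Rightarrow> (real^'n \<Rightarrow> real) \<Rightarrow> real \<Rightarrow> real^'n \<Rightarrow> real^'n" where
  "velocity C p0 t x =
     (if t = 0 then Lim (at_right 0) (\<lambda>s. (1 / s) *\<^sub>R (x + score C p0 s x))
      else (1 / t) *\<^sub>R (x + score C p0 t x))"

definition solves_ivp ::
    "(real \<Rightarrow> real^'n \<Rightarrow> real^'n) \<Rightarrow> real^'n \<Rightarrow> (real \<Rightarrow> real^'n) \<Rightarrow> bool" where
  "solves_ivp V x0 y \<longleftrightarrow>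
     y 0 = x0 \<and> (\<forall>t\<in>{0..1}. (y has_vector_derivative V t (y t)) (at t within {0..1}))"

text \<open>
  \<open>\<Phi>\<close> is a process on the probability space \<open>gaussian C\<close> whose initial value is the identity, hence
  distributed as \<open>N(0, C)\<close>; \<open>\<Phi> t\<close> is the time-\<open>t\<close> flow map. Solutions are unique path by path.
\<close>
definition unique_flow ::
    "(real \<Rightarrow> real^'n \<Rightarrow> real^'n) \<Rightarrow> (real \<Rightarrow> real^'n \<Rightarrow> real^'n) \<Rightarrow> bool" where
  "unique_flow V \<Phi> \<longleftrightarrow>
     (\<forall>t\<in>{0..1}. \<Phi> t \<in> borel_measurable borel)
     \<and> (\<forall>x. solves_ivp V x (\<lambda>t. \<Phi> t x))
     \<and> (\<forall>x y. solves_ivp V x y \<longrightarrow> (\<forall>t\<in>{0..1}. y t = \<Phi> t x))"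

end

theory Submission
  imports Defs
begin

text \<open>
  Put \<open>B\<^sub>t = t\<^sup>2 A + (1 - t\<^sup>2) C\<close> and let \<open>X\<^sub>0 = A\<^sup>1\<^sup>/\<^sup>2 \<xi>\<close>, where the pair \<open>(\<xi>, Z)\<close> is standard Gaussian up to
  the weight \<open>exp (h X\<^sub>0)\<close>. Since \<open>A\<close> and \<open>C\<close> commute, a rotation of \<open>(\<xi>, Z)\<close> into a pair \<open>(\<eta>, \<zeta>)\<close> turns
  the interpolant into \<open>B\<^sub>t\<^sup>1\<^sup>/\<^sup>2 \<eta>\<close> and \<open>X\<^sub>0\<close> into \<open>t A B\<^sub>t\<^sup>-\<^sup>1 y - ((1 - t\<^sup>2) A C B\<^sub>t\<^sup>-\<^sup>1)\<^sup>1\<^sup>/\<^sup>2 \<zeta>\<close>, with \<open>y\<close> the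
  interpolant. Hence the density at time \<open>t\<close> is a Gaussian times \<open>H\<^sub>t y = E exp (h X\<^sub>0)\<close> and the velocity
  is \<open>t (A - C) B\<^sub>t\<^sup>-\<^sup>1 y + A C B\<^sub>t\<^sup>-\<^sup>1 R\<^sub>t y\<close>, where \<open>R\<^sub>t y\<close> averages \<open>\<nabla>h\<close> at \<open>X\<^sub>0\<close>. This expression has
  no singularity at \<open>t = 0\<close> or \<open>t = 1\<close> and is Lipschitz in \<open>y\<close>, uniformly in \<open>t\<close>. At \<open>t = 0\<close> it is the
  mean of \<open>X\<^sub>0\<close> by Stein's identity. For a smooth test function \<open>f\<close> let \<open>F\<^sub>t\<close> be \<open>f\<close> composed with the flow
  from time \<open>t\<close> to time \<open>1\<close>; the expectation of \<open>F\<^sub>t\<close> at the interpolant has derivative zero, again by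
  Stein's identity, so its values at \<open>t = 0\<close> and \<open>t = 1\<close> agree.
\<close>

section \<open>Flows of Lipschitz fields\<close>

text \<open>Both end times are delicate: the velocity carries \<open>1 / t\<close>, and
  \<open>sqrt (1 - t\<^sup>2)\<close> makes the interpolant non-differentiable at
  \<open>t = 1\<close>. Since the eigenvalues of \<open>B\<^sub>t\<close> are positive on the closed
  interval, all coefficients of the field extend to it continuously, and time derivatives along the
  interpolant are taken inside only, with continuity closing the gap. Global Lipschitz bounds are
  not obvious, because \<open>exp \<circ> h\<close> may grow exponentially; they hold because
  numerator, denominator and their derivatives in \<open>R\<^sub>t\<close> are integrals against one
  common weight, which cancels. The transport argument is a duality and avoids any differential
  equation for the densities. Its price is that the flow map must be differentiable in its starting
  point, hence the field must be continuously differentiable in space; this is where two derivatives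
  of \<open>h\<close> enter. All limits under integrals rest on one growth class: \<open>h\<close>
  is Lipschitz, so every integrand is bounded by some \<open>K * exp (L * norm z)\<close>.\<close>

lemma at_within_01: "0 < x \<Longrightarrow> x < 1 \<Longrightarrow> at x within {0..1::real} = at x"
  by (rule at_within_Icc_at) auto

text \<open>Integrating the bound on \<open>D'\<close> away from \<open>s\<close> reproduces
  \<open>c * exp (k * \<bar>r - s\<bar>)\<close>, up to its value at \<open>s\<close>. This is the
  contraction estimate for the Picard operator in an exponentially weighted norm; both directions
  from \<open>s\<close> are covered because trajectories are later started in the middle of the
  interval.\<close>

lemma exp_weight_bound:
  fixes D D' :: "real \<Rightarrow> 'a::real_normed_vector"
  assumes D: "\<And>r. r \<in> {0..1} \<Longrightarrow> (D has_vector_derivative D' r) (at r within {0..1})"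
    and bnd: "\<And>r. r \<in> {0..1} \<Longrightarrow> norm (D' r) \<le> c * k * exp (k * \<bar>r - s\<bar>)"
    and s: "s \<in> {0..1}" "D s = 0" and t: "t \<in> {0..1}" and c: "0 \<le> c"
  shows "norm (D t) \<le> c * exp (k * \<bar>t - s\<bar>)"
proof -
  have contD: "continuous_on {0..1} D"
    using D has_vector_derivative_continuous continuous_on_eq_continuous_within by blast
  have at: "(D has_vector_derivative D' r) (at r)" if "0 < r" "r < 1" for r
    using D[of r] that by (simp add: at_within_01)
  consider "t = s" | "s < t" | "t < s" by linarith
  then show ?thesis
  proof cases
    case 1
    then show ?thesis using s c by simp
  next
    case 2
    have "norm (D t - D s) \<le> c * exp (k * (t - s)) - c * exp (k * (s - s))"
    proof (rule differentiable_bound_general[OF 2])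
      show "continuous_on {s..t} D" by (rule continuous_on_subset[OF contD]) (use s t in auto)
      show "continuous_on {s..t} (\<lambda>r. c * exp (k * (r - s)))" by (intro continuous_intros)
      fix r assume r: "s < r" "r < t"
      show "(D has_vector_derivative D' r) (at r)" using at r s t by auto
      show "((\<lambda>r. c * exp (k * (r - s))) has_vector_derivative c * k * exp (k * (r - s))) (at r)"
        unfolding has_real_derivative_iff_has_vector_derivative[symmetric]
        by (auto intro!: derivative_eq_intros)
      show "norm (D' r) \<le> c * k * exp (k * (r - s))"
        using bnd[of r] r s t by auto
    qed
    then show ?thesis using 2 s c by simp
  next
    case 3
    \<comment> \<open>To the left of \<open>s\<close> the comparison function must still increase in
      \<open>r\<close>, hence its negative sign.\<close>
    have "norm (D s - D t) \<le> (- c * exp (k * (s - s))) - (- c * exp (k * (s - t)))"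
    proof (rule differentiable_bound_general[OF 3])
      show "continuous_on {t..s} D" by (rule continuous_on_subset[OF contD]) (use s t in auto)
      show "continuous_on {t..s} (\<lambda>r. - c * exp (k * (s - r)))" by (intro continuous_intros)
      fix r assume r: "t < r" "r < s"
      show "(D has_vector_derivative D' r) (at r)" using at r s t by auto
      show "((\<lambda>r. - c * exp (k * (s - r))) has_vector_derivative c * k * exp (k * (s - r))) (at r)"
        unfolding has_real_derivative_iff_has_vector_derivative[symmetric]
        by (auto intro!: derivative_eq_intros)
      show "norm (D' r) \<le> c * k * exp (k * (s - r))"
        using bnd[of r] r s t by auto
    qed
    then show ?thesis using 3 s c by simp
  qed
qed

text \<open>Working with the square of the norm keeps the compared quantity differentiable at its zeros.\<close>

lemma gronwall_squared:
  fixes d d' :: "real \<Rightarrow> 'a::real_inner"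
  assumes d: "\<And>r. r \<in> {0..1} \<Longrightarrow> (d has_vector_derivative d' r) (at r within {0..1})"
    and bnd: "\<And>r. r \<in> {0..1} \<Longrightarrow> norm (d' r) \<le> L * norm (d r) + e"
    and L: "0 \<le> L" and e: "0 \<le> e" and s: "s \<in> {0..1}" and t: "t \<in> {0..1}"
  shows "(norm (d t))\<^sup>2 \<le> ((norm (d s))\<^sup>2 + e\<^sup>2) * exp (2 * L + 1)"
proof -
  \<comment> \<open>Adding \<open>e\<^sup>2\<close> makes the differential inequality homogeneous,
    \<open>\<bar>g' r\<bar> \<le> k * g r\<close>: here \<open>2 * L\<close> comes from the
    Lipschitz term and 1 from \<open>2 * x * e \<le> x\<^sup>2 + e\<^sup>2\<close>.\<close>
  define k where "k = 2 * L + 1"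
  define g where "g r = d r \<bullet> d r + e\<^sup>2" for r
  define g' where "g' r = 2 * (d r \<bullet> d' r)" for r
  have k: "k > 0" using L by (simp add: k_def)
  have g0: "0 \<le> g r" for r by (simp add: g_def)
  have contd: "continuous_on {0..1} d"
    using d has_vector_derivative_continuous continuous_on_eq_continuous_within by blast
  then have contg: "continuous_on {0..1} g" unfolding g_def by (intro continuous_intros)
  have dg: "(g has_real_derivative g' r) (at r)" if "0 < r" "r < 1" for r
  proof -
    have "(d has_vector_derivative d' r) (at r)" using d[of r] that by (simp add: at_within_01)
    then show ?thesis
      unfolding g_def g'_def has_real_derivative_iff_has_vector_derivative has_vector_derivative_def
      by (auto intro!: derivative_eq_intros simp: inner_commute algebra_simps)
  qed
  have g'_bnd: "\<bar>g' r\<bar> \<le> k * g r" if "r \<in> {0..1}" for r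
  proof -
    have "\<bar>g' r\<bar> \<le> 2 * (norm (d r) * norm (d' r))"
      unfolding g'_def by (simp add: abs_mult Cauchy_Schwarz_ineq2)
    also have "\<dots> \<le> 2 * (norm (d r) * (L * norm (d r) + e))"
      using bnd[OF that] by (simp add: mult_left_mono)
    also have "\<dots> \<le> k * ((norm (d r))\<^sup>2 + e\<^sup>2)"
    proof -
      have "0 \<le> (norm (d r) - e)\<^sup>2 + 2 * L * e\<^sup>2" using L by simp
      then show ?thesis by (simp add: k_def power2_eq_square algebra_simps)
    qed
    also have "\<dots> = k * g r" by (simp add: g_def power2_norm_eq_inner)
    finally show ?thesis .
  qed
  have "g t \<le> g s * exp (k * \<bar>t - s\<bar>)"
  proof (cases "s \<le> t")
    case True
    have "g t * exp (k * (s - t)) \<le> g s * exp (k * (s - s))"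
    proof (rule DERIV_nonpos_imp_decreasing_open[OF True])
      show "continuous_on {s..t} (\<lambda>r. g r * exp (k * (s - r)))"
        by (intro continuous_intros continuous_on_subset[OF contg]) (use s t in auto)
      fix r assume r: "s < r" "r < t"
      have "((\<lambda>r. g r * exp (k * (s - r))) has_real_derivative (g' r - k * g r) * exp (k * (s - r))) (at r)"
        using dg[of r] r s t by (auto intro!: derivative_eq_intros simp: algebra_simps)
      moreover have "(g' r - k * g r) * exp (k * (s - r)) \<le> 0"
        using g'_bnd[of r] r s t by (auto simp: mult_le_0_iff)
      ultimately show "\<exists>y. ((\<lambda>r. g r * exp (k * (s - r))) has_real_derivative y) (at r) \<and> y \<le> 0" by blast
    qed
    then have "g t * exp (k * (s - t)) * exp (k * (t - s)) \<le> g s * exp (k * (t - s))"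
      by (simp add: mult_right_mono)
    then show ?thesis using True by (simp add: mult.assoc flip: exp_add) (simp add: algebra_simps)
  next
    case False
    then have ts: "t \<le> s" by simp
    have "g t * exp (k * (t - t)) \<le> g s * exp (k * (s - t))"
    proof (rule DERIV_nonneg_imp_increasing_open[OF ts])
      show "continuous_on {t..s} (\<lambda>r. g r * exp (k * (r - t)))"
        by (intro continuous_intros continuous_on_subset[OF contg]) (use s t in auto)
      fix r assume r: "t < r" "r < s"
      have "((\<lambda>r. g r * exp (k * (r - t))) has_real_derivative (g' r + k * g r) * exp (k * (r - t))) (at r)"
        using dg[of r] r s t by (auto intro!: derivative_eq_intros simp: algebra_simps)
      moreover have "0 \<le> (g' r + k * g r) * exp (k * (r - t))"
        using g'_bnd[of r] r s t by (auto simp: zero_le_mult_iff)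
      ultimately show "\<exists>y. ((\<lambda>r. g r * exp (k * (r - t))) has_real_derivative y) (at r) \<and> 0 \<le> y" by blast
    qed
    then show ?thesis using ts by simp
  qed
  also have "\<dots> \<le> g s * exp k"
    using s t k g0[of s] by (intro mult_left_mono) (auto simp: mult_le_cancel_left1 abs_le_iff)
  finally have "d t \<bullet> d t + e\<^sup>2 \<le> (d s \<bullet> d s + e\<^sup>2) * exp k" by (simp add: g_def)
  moreover have "0 \<le> e\<^sup>2" by simp
  ultimately show ?thesis unfolding power2_norm_eq_inner k_def by linarith
qed

section \<open>Global solutions, their uniqueness and stability\<close>

definition solution :: "(real \<Rightarrow> 'a::real_normed_vector \<Rightarrow> 'a) \<Rightarrow> (real \<Rightarrow> 'a) \<Rightarrow> bool" where
  "solution V u \<longleftrightarrow> (\<forall>t\<in>{0..1}. (u has_vector_derivative V t (u t)) (at t within {0..1}))"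

text \<open>The trajectory through \<open>x\<close> at time \<open>s\<close>, followed in both time
  directions; the last argument is the time of evaluation.\<close>

definition flow :: "(real \<Rightarrow> 'a::real_normed_vector \<Rightarrow> 'a) \<Rightarrow> real \<Rightarrow> 'a \<Rightarrow> real \<Rightarrow> 'a" where
  "flow V s x = (SOME u. solution V u \<and> u s = x)"

lemma solutionD: "solution V u \<Longrightarrow> t \<in> {0..1} \<Longrightarrow> (u has_vector_derivative V t (u t)) (at t within {0..1})"
  by (simp add: solution_def)

lemma solution_continuous: "solution V u \<Longrightarrow> continuous_on {0..1} u"
  unfolding solution_def using has_vector_derivative_continuous continuous_on_eq_continuous_within by blast

locale lipschitz_field =
  fixes V :: "real \<Rightarrow> 'a::euclidean_space \<Rightarrow> 'a" and L :: real
  assumes cont: "continuous_on ({0..1} \<times> UNIV) (\<lambda>(t, x). V t x)"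
    and lip: "t \<in> {0..1} \<Longrightarrow> norm (V t x - V t y) \<le> L * norm (x - y)"
    and L_pos: "0 < L"
begin

lemma continuous_along:
  assumes "continuous_on S \<tau>" "continuous_on S u" "\<And>r. r \<in> S \<Longrightarrow> \<tau> r \<in> {0..1}"
  shows "continuous_on S (\<lambda>r. V (\<tau> r) (u r))"
proof -
  have "continuous_on S (\<lambda>r. (\<tau> r, u r))" by (intro continuous_intros assms)
  moreover have "(\<lambda>r. (\<tau> r, u r)) ` S \<subseteq> {0..1} \<times> UNIV" using assms(3) by auto
  ultimately show ?thesis using continuous_on_compose2[OF cont] by fastforce
qed

text \<open>Picard iteration for \<open>u\<close> divided by
  \<open>w r = exp (2 * L * \<bar>r - s\<bar>)\<close>. The weight makes the operator a contraction
  on the whole interval for every \<open>L\<close>, so no short solutions have to be glued.\<close>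

lemma ex_solution:
  assumes s: "s \<in> {0..1}"
  shows "\<exists>u. solution V u \<and> u s = x"
proof -
  define k where "k = 2 * L"
  define w where "w r = exp (k * \<bar>r - s\<bar>)" for r
  define G where "G v r = V r (w r *\<^sub>R apply_bcontfun v r)" for v :: "real \<Rightarrow>\<^sub>C 'a" and r
  \<comment> \<open>A difference of two integrals from 0, since \<open>t\<close> may lie on either
    side of \<open>s\<close>.\<close>
  define J where "J v t = x + integral {0..t} (G v) - integral {0..s} (G v)" for v t
  have w_pos: "w r > 0" for r by (simp add: w_def)
  have cG: "continuous_on {0..1} (G v)" for v
    unfolding G_def w_def by (intro continuous_along continuous_intros) auto
  have dJ: "(J v has_vector_derivative G v t) (at t within {0..1})" if "t \<in> {0..1}" for v t
    unfolding J_def using integral_has_vector_derivative[OF cG[of v] that]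
    by (auto intro!: derivative_eq_intros)
  have cJ: "continuous_on {0..1} (J v)" for v
    using dJ has_vector_derivative_continuous continuous_on_eq_continuous_within by blast
  \<comment> \<open>The fixed point theorem is applied in the complete type of bounded continuous
    functions on the line; a function on the unit interval is extended by its end values through
    \<open>clamp\<close>.\<close>
  define P where "P v = (SOME g :: real \<Rightarrow>\<^sub>C 'a. (\<forall>t\<in>{0..1}. g t = (1 / w t) *\<^sub>R J v t)
      \<and> (\<forall>t. g t = (1 / w (clamp 0 1 t)) *\<^sub>R J v (clamp 0 1 t)))" for v
  have P: "(\<forall>t\<in>{0..1}. P v t = (1 / w t) *\<^sub>R J v t)
      \<and> (\<forall>t. P v t = (1 / w (clamp 0 1 t)) *\<^sub>R J v (clamp 0 1 t))" for v
  proof -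
    have "continuous_on {0..1} (\<lambda>t. (1 / w t) *\<^sub>R J v t)"
      unfolding w_def by (intro continuous_intros cJ) auto
    then have c: "continuous_on (cbox 0 1) (\<lambda>t. (1 / w t) *\<^sub>R J v t)" by (simp add: cbox_interval)
    obtain g :: "real \<Rightarrow>\<^sub>C 'a" where
      "\<And>t. t \<in> cbox 0 1 \<Longrightarrow> g t = (1 / w t) *\<^sub>R J v t"
      "\<And>t. g t = (1 / w (clamp 0 1 t)) *\<^sub>R J v (clamp 0 1 t)"
      by (rule continuous_on_cbox_bcontfunE[OF c]) blast
    then have "\<exists>g :: real \<Rightarrow>\<^sub>C 'a. (\<forall>t\<in>{0..1}. g t = (1 / w t) *\<^sub>R J v t)
      \<and> (\<forall>t. g t = (1 / w (clamp 0 1 t)) *\<^sub>R J v (clamp 0 1 t))"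
      by (intro exI[of _ g]) (auto simp: cbox_interval)
    then show ?thesis unfolding P_def by (rule someI_ex)
  qed
  have "dist (P v) (P v') \<le> 1/2 * dist v v'" for v v'
  proof (rule dist_bound)
    fix t0
    define t where "t = clamp 0 1 (t0::real)"
    have t: "t \<in> {0..1}" using clamp_in_interval[of 0 1 t0] by (simp add: t_def)
    \<comment> \<open>The contraction factor \<open>1/2\<close> is \<open>L / k\<close>.\<close>
    have "norm (J v t - J v' t) \<le> (dist v v' / 2) * w t"
      unfolding w_def
    proof (rule exp_weight_bound[where D = "\<lambda>t. J v t - J v' t"])
      fix r :: real assume r: "r \<in> {0..1}"
      show "((\<lambda>t. J v t - J v' t) has_vector_derivative (G v r - G v' r)) (at r within {0..1})"
        by (intro derivative_intros dJ r)
      have "norm (G v r - G v' r) \<le> L * norm (w r *\<^sub>R v r - w r *\<^sub>R v' r)"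
        unfolding G_def by (rule lip[OF r])
      also have "\<dots> = L * (w r * dist (v r) (v' r))"
        using w_pos[of r] by (simp add: dist_norm flip: scaleR_diff_right)
      also have "\<dots> \<le> L * (w r * dist v v')"
        using w_pos[of r] L_pos dist_bounded[of v r v'] by simp
      finally show "norm (G v r - G v' r) \<le> dist v v' / 2 * k * exp (k * \<bar>r - s\<bar>)"
        by (simp add: k_def w_def mult_ac)
    qed (use s t in \<open>auto simp: J_def\<close>)
    moreover have "dist (P v t0) (P v' t0) = (1 / w t) * norm (J v t - J v' t)"
      using P[of v] P[of v'] w_pos[of t] by (simp add: t_def dist_norm flip: scaleR_diff_right)
    ultimately show "dist (P v t0) (P v' t0) \<le> 1 / 2 * dist v v'"
      using w_pos[of t] by (simp add: divide_le_eq)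
  qed
  then obtain v where v: "P v = v" using banach_fix_type[of "1/2" P] by auto
  define u where "u r = J v r" for r
  have u: "w r *\<^sub>R v r = u r" if "r \<in> {0..1}" for r
    using P[of v] that w_pos[of r] by (simp add: v u_def)
  have "solution V u"
    unfolding solution_def
  proof
    fix t :: real assume t: "t \<in> {0..1}"
    show "(u has_vector_derivative V t (u t)) (at t within {0..1})"
      using dJ[OF t, of v] u[OF t] by (simp add: u_def[abs_def] G_def)
  qed
  moreover have "u s = x" by (simp add: u_def J_def)
  ultimately show ?thesis by blast
qed

lemma flow_solution: "s \<in> {0..1} \<Longrightarrow> solution V (flow V s x)"
  and flow_start [simp]: "s \<in> {0..1} \<Longrightarrow> flow V s x s = x"
  using someI_ex[OF ex_solution[of s x]] by (auto simp: flow_def)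

text \<open>The square root of the Gronwall factor \<open>exp (2 * L + 1)\<close>, rounded
  up.\<close>

definition growth :: real where "growth = exp (L + 1)"

lemma growth_pos: "0 < growth" by (simp add: growth_def)

text \<open>Here \<open>v\<close> is an approximate solution with defect \<open>e\<close>. Zero
  defect gives uniqueness and Lipschitz dependence; a small positive defect measures the
  linearization error in \<open>flow_differentiable\<close>.\<close>

lemma stability:
  assumes u: "solution V u" and v: "\<And>r. r \<in> {0..1} \<Longrightarrow> (v has_vector_derivative v' r) (at r within {0..1})"
    and e: "\<And>r. r \<in> {0..1} \<Longrightarrow> norm (v' r - V r (v r)) \<le> e"
    and s: "s \<in> {0..1}" and t: "t \<in> {0..1}"
  shows "norm (u t - v t) \<le> growth * (norm (u s - v s) + e)"
proof -
  have e0: "0 \<le> e" using e[OF s] norm_ge_zero order_trans by blast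
  have "(norm (u t - v t))\<^sup>2 \<le> ((norm (u s - v s))\<^sup>2 + e\<^sup>2) * exp (2 * L + 1)"
  proof (rule gronwall_squared[where d = "\<lambda>t. u t - v t" and d' = "\<lambda>r. V r (u r) - v' r"])
    fix r :: real assume r: "r \<in> {0..1}"
    show "((\<lambda>t. u t - v t) has_vector_derivative V r (u r) - v' r) (at r within {0..1})"
      by (intro derivative_intros v[OF r] solutionD[OF u r])
    have "norm (V r (u r) - v' r) \<le> norm (V r (u r) - V r (v r)) + norm (V r (v r) - v' r)"
      using norm_triangle_ineq[of "V r (u r) - V r (v r)" "V r (v r) - v' r"] by simp
    then show "norm (V r (u r) - v' r) \<le> L * norm (u r - v r) + e"
      using lip[OF r, of "u r" "v r"] e[OF r] by (simp add: norm_minus_commute)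
  qed (use L_pos e0 s t in auto)
  also have "\<dots> \<le> (norm (u s - v s) + e)\<^sup>2 * growth\<^sup>2"
  proof (rule mult_mono)
    show "(norm (u s - v s))\<^sup>2 + e\<^sup>2 \<le> (norm (u s - v s) + e)\<^sup>2"
      using e0 by (simp add: power2_sum)
    show "exp (2 * L + 1) \<le> growth\<^sup>2"
      by (simp add: growth_def flip: exp_double)
  qed auto
  finally have "(norm (u t - v t))\<^sup>2 \<le> (growth * (norm (u s - v s) + e))\<^sup>2"
    by (simp add: power_mult_distrib mult.commute)
  then show ?thesis
    using e0 growth_pos by (meson add_nonneg_nonneg less_imp_le mult_nonneg_nonneg norm_ge_zero power2_le_imp_le)
qed

lemma solution_stability:
  assumes "solution V u" "solution V v" "s \<in> {0..1}" "t \<in> {0..1}"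
  shows "norm (u t - v t) \<le> growth * norm (u s - v s)"
  using stability[of u v "\<lambda>r. V r (v r)" 0 s t] assms by (auto simp: solution_def)

lemma solution_unique:
  assumes "solution V u" "solution V v" "s \<in> {0..1}" "t \<in> {0..1}" "u s = v s"
  shows "u t = v t"
  using solution_stability[OF assms(1-4)] assms(5) by simp

lemma flow_lipschitz:
  assumes "s \<in> {0..1}" "t \<in> {0..1}"
  shows "norm (flow V s x t - flow V s y t) \<le> growth * norm (x - y)"
  using solution_stability[OF flow_solution[of s x] flow_solution[of s y], of s t] assms by simp

lemma flow_flow:
  assumes "s \<in> {0..1}" "r \<in> {0..1}" "t \<in> {0..1}"
  shows "flow V r (flow V s x r) t = flow V s x t"
  by (rule solution_unique[of _ _ r]) (use assms flow_solution in auto)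

lemma continuous_flow:
  assumes "s \<in> {0..1}" "t \<in> {0..1}"
  shows "continuous_on UNIV (\<lambda>x. flow V s x t)"
  by (rule lipschitz_on_continuous_on[where L = growth], rule lipschitz_onI)
     (use flow_lipschitz[OF assms] growth_pos in \<open>auto simp: dist_norm\<close>)

end

section \<open>Differentiability of the flow in the starting point\<close>

locale differentiable_field =
  fixes V :: "real \<Rightarrow> 'a::euclidean_space \<Rightarrow> 'a" and L :: real and V' :: "real \<Rightarrow> 'a \<Rightarrow> 'a \<Rightarrow> 'a"
  assumes continuous: "continuous_on ({0..1} \<times> UNIV) (\<lambda>(t, x). V t x)"
    and deriv: "t \<in> {0..1} \<Longrightarrow> (V t has_derivative V' t x) (at x)"
    and continuous_deriv: "continuous_on ({0..1} \<times> UNIV \<times> UNIV) (\<lambda>(t, x, w). V' t x w)"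
    and deriv_bound: "t \<in> {0..1} \<Longrightarrow> norm (V' t x w) \<le> L * norm w"
    and L_positive: "0 < L"
begin

lemma linear_deriv: "t \<in> {0..1} \<Longrightarrow> linear (V' t x)"
  using deriv has_derivative_linear by blast

sublocale lipschitz_field V L
proof
  show "norm (V t x - V t y) \<le> L * norm (x - y)" if t: "t \<in> {0..1}" for t x y
  proof (rule differentiable_bound[OF convex_UNIV])
    show "onorm (V' t z) \<le> L" for z
      by (rule onorm_bound) (use t deriv_bound L_positive in auto)
  qed (use deriv t in auto)
qed (use continuous L_positive in auto)

text \<open>\<open>V'\<close> is uniformly continuous on a compact tube around the curve, and the
  mean value inequality on the segment from \<open>u t\<close> to \<open>u t + w\<close> turns its
  oscillation into the remainder bound. Directions are confined to the unit sphere for compactness;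
  linearity restores their length.\<close>

lemma linearization_uniform:
  assumes u: "continuous_on {0..1} u" and e: "0 < e"
  shows "\<exists>\<delta>>0. \<forall>t\<in>{0..1}. \<forall>w. norm w \<le> \<delta> \<longrightarrow>
    norm (V t (u t + w) - V t (u t) - V' t (u t) w) \<le> e * norm w"
proof -
  have "bounded (u ` {0..1})"
    using u compact_continuous_image compact_imp_bounded by blast
  then obtain R where R: "\<And>t. t \<in> {0..1} \<Longrightarrow> norm (u t) \<le> R"
    unfolding bounded_iff by (metis imageI)
  define S where "S = {0..1::real} \<times> cball (0::'a) (R + 1) \<times> sphere (0::'a) 1"
  have "compact S" unfolding S_def by (intro compact_Times) auto
  moreover have "continuous_on S (\<lambda>(t, x, w). V' t x w)"
    using continuous_deriv by (rule continuous_on_subset) (auto simp: S_def)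
  ultimately have "uniformly_continuous_on S (\<lambda>(t, x, w). V' t x w)"
    by (rule compact_uniformly_continuous[rotated])
  from this[unfolded uniformly_continuous_on_def, rule_format, OF e]
  obtain d where d: "d > 0" "\<And>p q. p \<in> S \<Longrightarrow> q \<in> S \<Longrightarrow> dist q p < d \<Longrightarrow>
      dist ((\<lambda>(t, x, w). V' t x w) q) ((\<lambda>(t, x, w). V' t x w) p) < e"
    by blast
  \<comment> \<open>The cap \<open>d/2\<close> keeps the segment within the modulus of continuity,
    the cap 1 keeps it in the tube of radius \<open>R + 1\<close>.\<close>
  have "norm (V t (u t + w) - V t (u t) - V' t (u t) w) \<le> e * norm w"
    if t: "t \<in> {0..1}" and w: "norm w \<le> min (d/2) 1" for t w
  proof -
    let ?S = "closed_segment (u t) (u t + w)"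
    have S: "norm (x - u t) \<le> norm w" if "x \<in> ?S" for x
      using that by (auto simp: in_segment algebra_simps intro!: mult_left_le_one_le)
    have "norm (V t (u t + w) - V t (u t) - V' t (u t) (u t + w - u t)) \<le> norm (u t + w - u t) * e"
    proof (rule differentiable_bound_linearization[where S = ?S and f' = "V' t" and ?x0.0 = "u t"])
      fix x assume x: "x \<in> ?S"
      show "(V t has_derivative V' t x) (at x within ?S)"
        using deriv[OF t] has_derivative_at_withinI by blast
      have unit: "norm (V' t x z - V' t (u t) z) \<le> e" if z: "norm z = 1" for z
      proof -
        have "norm x \<le> R + 1"
          using norm_triangle_ineq[of "x - u t" "u t"] S[OF x] w R[OF t] by simp
        then have "(t, x, z) \<in> S" "(t, u t, z) \<in> S"
          using t z R[OF t] by (auto simp: S_def)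
        moreover have "dist (t, x, z) (t, u t, z) < d"
          using S[OF x] w d(1) by (simp add: dist_Pair_Pair) (simp add: dist_norm)
        ultimately show ?thesis using d(2)[of "(t, u t, z)" "(t, x, z)"] by (simp add: dist_norm)
      qed
      show "onorm (V' t x - V' t (u t)) \<le> e"
      proof (rule onorm_bound)
        fix z
        show "norm ((V' t x - V' t (u t)) z) \<le> e * norm z"
        proof (cases "z = 0")
          case True
          then show ?thesis using linear_0[OF linear_deriv[OF t]] by simp
        next
          case False
          have "(V' t x - V' t (u t)) z
              = norm z *\<^sub>R (V' t x (z /\<^sub>R norm z) - V' t (u t) (z /\<^sub>R norm z))"
            using False by (simp add: linear_cmul[OF linear_deriv[OF t]] algebra_simps)
          moreover have "norm (V' t x (z /\<^sub>R norm z) - V' t (u t) (z /\<^sub>R norm z)) \<le> e"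
            using False by (intro unit) simp
          ultimately show ?thesis
            using mult_left_mono[OF _ norm_ge_zero[of z]] by (simp add: mult.commute[of e])
        qed
      qed (use e in simp)
    next
      show "u t + r *\<^sub>R (u t + w - u t) \<in> ?S" if "r \<in> {0..1}" for r
        using that by (auto simp: in_segment algebra_simps intro!: exI[of _ r])
    qed simp
    then show ?thesis by (simp add: mult.commute)
  qed
  then show ?thesis using d(1) by (intro exI[of _ "min (d/2) 1"]) auto
qed

text \<open>The derivative of the flow solves the equation linearized along the trajectory.\<close>

lemma flow_differentiable:
  assumes s: "s \<in> {0..1}" and t: "t \<in> {0..1}"
  shows "(\<lambda>x. flow V s x t) differentiable (at x)"
proof -
  define u where "u = flow V s x"
  have u: "solution V u" "u s = x" using flow_solution[OF s] s by (auto simp: u_def)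
  have cu: "continuous_on {0..1} u" using u(1) by (rule solution_continuous)
  \<comment> \<open>The linearized equation is again a Lipschitz field, so its solution
    \<open>w e\<close> with initial direction \<open>e\<close> exists and is unique by the results
    above.\<close>
  interpret W: lipschitz_field "\<lambda>r. V' r (u r)" L
  proof
    have "continuous_on ({0..1} \<times> UNIV) (\<lambda>p. (fst p, u (fst p), snd p))"
      by (intro continuous_intros continuous_on_compose2[OF cu]) auto
    moreover have "(\<lambda>p. (fst p, u (fst p), snd p)) ` ({0..1} \<times> UNIV) \<subseteq> {0..1} \<times> UNIV \<times> UNIV" by auto
    ultimately have "continuous_on ({0..1} \<times> UNIV) (\<lambda>p. (\<lambda>(t, x, w). V' t x w) (fst p, u (fst p), snd p))"
      using continuous_on_compose2[OF continuous_deriv] by blast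
    then show "continuous_on ({0..1} \<times> UNIV) (\<lambda>(t, w). V' t (u t) w)"
      by (simp add: case_prod_unfold)
    show "norm (V' r (u r) y - V' r (u r) z) \<le> L * norm (y - z)" if "r \<in> {0..1}" for r y z
      using deriv_bound[OF that, of "u r" "y - z"] linear_diff[OF linear_deriv[OF that]] by metis
  qed (rule L_pos)
  define w where "w e = flow (\<lambda>r. V' r (u r)) s e" for e
  have w: "solution (\<lambda>r. V' r (u r)) (w e)" "w e s = e" for e
    using W.flow_solution[OF s] s by (auto simp: w_def)
  have wd: "(w e has_vector_derivative V' r (u r) (w e r)) (at r within {0..1})" if "r \<in> {0..1}" for r e
    using solutionD[OF w(1) that] .
  have w_bound: "norm (w e r) \<le> growth * norm e" if r: "r \<in> {0..1}" for e r
  proof -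
    have "solution (\<lambda>r. V' r (u r)) (\<lambda>r. 0)"
      unfolding solution_def
    proof
      fix r :: real assume "r \<in> {0..1}"
      then show "((\<lambda>r. 0) has_vector_derivative V' r (u r) 0) (at r within {0..1})"
        using linear_0[OF linear_deriv, of r "u r"] by simp
    qed
    from W.solution_stability[OF w(1) this s r] show ?thesis by (simp add: w(2))
  qed
  \<comment> \<open>Sums and multiples of solutions solve the linearized equation, and uniqueness
    identifies them.\<close>
  have "linear (\<lambda>e. w e t)"
  proof (rule linearI)
    fix e1 e2 :: 'a and c :: real
    have "solution (\<lambda>r. V' r (u r)) (\<lambda>r. w e1 r + w e2 r)"
      unfolding solution_def
    proof
      fix r :: real assume r: "r \<in> {0..1}"
      show "((\<lambda>r. w e1 r + w e2 r) has_vector_derivative V' r (u r) (w e1 r + w e2 r)) (at r within {0..1})"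
        unfolding linear_add[OF linear_deriv[OF r]] by (intro derivative_intros wd r)
    qed
    then show "w (e1 + e2) t = w e1 t + w e2 t"
      by (rule W.solution_unique[OF w(1) _ s t]) (simp add: w(2))
    have "solution (\<lambda>r. V' r (u r)) (\<lambda>r. c *\<^sub>R w e1 r)"
      unfolding solution_def
    proof
      fix r :: real assume r: "r \<in> {0..1}"
      show "((\<lambda>r. c *\<^sub>R w e1 r) has_vector_derivative V' r (u r) (c *\<^sub>R w e1 r)) (at r within {0..1})"
        unfolding linear_cmul[OF linear_deriv[OF r]]
        by (rule bounded_linear.has_vector_derivative[OF bounded_linear_scaleR_right wd[OF r]])
    qed
    then show "w (c *\<^sub>R e1) t = c *\<^sub>R w e1 t"
      by (rule W.solution_unique[OF w(1) _ s t]) (simp add: w(2))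
  qed
  moreover have "\<exists>d>0. \<forall>y. norm (y - x) < d \<longrightarrow>
      norm (flow V s y t - flow V s x t - w (y - x) t) \<le> \<epsilon> * norm (y - x)" if \<epsilon>: "0 < \<epsilon>" for \<epsilon>
  proof -
    \<comment> \<open>One factor \<open>growth\<close> is spent on the size of \<open>w\<close>, the
      other in the stability estimate.\<close>
    obtain \<delta> where \<delta>: "\<delta> > 0" "\<And>r w. r \<in> {0..1} \<Longrightarrow> norm w \<le> \<delta> \<Longrightarrow>
        norm (V r (u r + w) - V r (u r) - V' r (u r) w) \<le> \<epsilon> / (growth * growth) * norm w"
      using linearization_uniform[OF cu, of "\<epsilon> / (growth * growth)"] \<epsilon> growth_pos by auto
    have "norm (flow V s y t - flow V s x t - w (y - x) t) \<le> \<epsilon> * norm (y - x)"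
      if y: "norm (y - x) < \<delta> / growth" for y
    proof -
      \<comment> \<open>The curve \<open>u + w (y - x)\<close> starts exactly at \<open>y\<close>,
        so that only its defect contributes.\<close>
      have "norm (flow V s y t - (u t + w (y - x) t))
          \<le> growth * (norm (flow V s y s - (u s + w (y - x) s)) + \<epsilon> / growth * norm (y - x))"
      proof (rule stability[OF flow_solution[OF s] _ _ s t])
        fix r :: real assume r: "r \<in> {0..1}"
        show "((\<lambda>r. u r + w (y - x) r) has_vector_derivative
            V r (u r) + V' r (u r) (w (y - x) r)) (at r within {0..1})"
          by (intro derivative_intros solutionD[OF u(1) r] wd[OF r])
        have "norm (w (y - x) r) \<le> growth * norm (y - x)" by (rule w_bound[OF r])
        also have "\<dots> \<le> \<delta>" using y growth_pos by (simp add: field_simps)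
        finally have "norm (V r (u r + w (y - x) r) - V r (u r) - V' r (u r) (w (y - x) r))
            \<le> \<epsilon> / (growth * growth) * norm (w (y - x) r)" by (rule \<delta>(2)[OF r])
        also have "\<dots> \<le> \<epsilon> / (growth * growth) * (growth * norm (y - x))"
          using w_bound[OF r] \<epsilon> growth_pos by (intro mult_left_mono) auto
        also have "\<dots> = \<epsilon> / growth * norm (y - x)" using growth_pos by simp
        finally show "norm (V r (u r) + V' r (u r) (w (y - x) r) - V r (u r + w (y - x) r))
            \<le> \<epsilon> / growth * norm (y - x)"
          by (subst norm_minus_commute) (simp add: algebra_simps)
      qed
      then show ?thesis
        using growth_pos s by (simp add: u(2) w(2)) (simp add: u_def algebra_simps)
    qed
    then show ?thesis using \<delta>(1) growth_pos by (intro exI[of _ "\<delta> / growth"]) auto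
  qed
  ultimately have "((\<lambda>y. flow V s y t) has_derivative (\<lambda>e. w e t)) (at x)"
    unfolding has_derivative_at_alt by (simp add: linear_conv_bounded_linear)
  then show ?thesis by (rule differentiableI)
qed

end

section \<open>The standard Gaussian measure\<close>

lemma nn_integral_lborel_translate:
  fixes g :: "'a::euclidean_space \<Rightarrow> ennreal"
  assumes [measurable]: "g \<in> borel_measurable borel"
  shows "(\<integral>\<^sup>+x. g (x + z) \<partial>lborel) = (\<integral>\<^sup>+x. g x \<partial>lborel)"
proof -
  have "(\<integral>\<^sup>+x. g x \<partial>lborel) = (\<integral>\<^sup>+x. g x \<partial>distr lborel borel ((+) z))"
    by (simp add: lborel_distr_plus)
  also have "\<dots> = (\<integral>\<^sup>+x. g (x + z) \<partial>lborel)"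
    by (subst nn_integral_distr) (auto simp: add.commute)
  finally show ?thesis ..
qed

text \<open>Both measures are translation invariant. Integrating \<open>indicator E x * indicator B (x - y)\<close>
  against their product in the two possible orders shows that they agree up to the ratio of their
  values on the unit ball \<open>B\<close>, which is preserved by the isometry.\<close>

lemma distr_lborel_isometry:
  fixes f :: "'a::euclidean_space \<Rightarrow> 'a"
  assumes f: "linear f" and n: "\<And>x. norm (f x) = norm x"
  shows "distr lborel borel f = lborel"
proof (rule measure_eqI)
  fix E assume "E \<in> sets (distr lborel borel f)"
  then have E[measurable]: "E \<in> sets borel" by simp
  have [measurable]: "f \<in> borel_measurable borel"
    using f linear_continuous_on linear_conv_bounded_linear by (intro borel_measurable_continuous_onI) blast
  have "inj f" using f n by (metis linear_injective_0 norm_eq_zero)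
  then have surj: "surj f" using linear_injective_imp_surjective[OF f] by simp
  define B where "B = ball (0::'a) 1"
  have [measurable]: "B \<in> sets borel" by (simp add: B_def)
  have B: "indicator B (f x) = (indicator B x :: ennreal)" "indicator B (x - y) = (indicator B (y - x) :: ennreal)" for x y
    by (auto simp: B_def indicator_def n norm_minus_commute)
  let ?m = "emeasure lborel"
  have "(\<integral>\<^sup>+x. \<integral>\<^sup>+y. indicator E (f x) * indicator B (f x - y) \<partial>lborel \<partial>lborel)
      = (\<integral>\<^sup>+x. indicator E (f x) * ?m B \<partial>lborel)"
  proof (rule nn_integral_cong)
    fix x
    have "(\<integral>\<^sup>+y. indicator B (f x - y) \<partial>lborel) = (\<integral>\<^sup>+y. indicator B (y + (- f x)) \<partial>lborel)"
      by (intro nn_integral_cong) (simp add: B(2)[of "f x"])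
    also have "\<dots> = ?m B" by (subst nn_integral_lborel_translate) simp_all
    finally show "(\<integral>\<^sup>+y. indicator E (f x) * indicator B (f x - y) \<partial>lborel) = indicator E (f x) * ?m B"
      by (simp add: nn_integral_cmult)
  qed
  also have "\<dots> = emeasure (distr lborel borel f) E * ?m B"
  proof -
    have "emeasure (distr lborel borel f) E = (\<integral>\<^sup>+x. indicator E x \<partial>distr lborel borel f)" by simp
    also have "\<dots> = (\<integral>\<^sup>+x. indicator E (f x) \<partial>lborel)" by (rule nn_integral_distr) simp_all
    finally show ?thesis by (simp only:) (rule nn_integral_multc, measurable)
  qed
  finally have 1: "(\<integral>\<^sup>+x. \<integral>\<^sup>+y. indicator E (f x) * indicator B (f x - y) \<partial>lborel \<partial>lborel)
      = emeasure (distr lborel borel f) E * ?m B" .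
  have "(\<integral>\<^sup>+x. \<integral>\<^sup>+y. indicator E (f x) * indicator B (f x - y) \<partial>lborel \<partial>lborel)
      = (\<integral>\<^sup>+y. \<integral>\<^sup>+x. indicator E (f x) * indicator B (f x - y) \<partial>lborel \<partial>lborel)"
    by (rule lborel_pair.Fubini') measurable
  \<comment> \<open>Translating \<open>x\<close> by a preimage of \<open>y\<close> moves the shift
    from the ball into \<open>E\<close>.\<close>
  also have "\<dots> = (\<integral>\<^sup>+y. \<integral>\<^sup>+x. indicator E (f x + y) * indicator B (f x) \<partial>lborel \<partial>lborel)"
  proof (rule nn_integral_cong)
    fix y
    obtain z where z: "f z = y" using surj by (metis surjD)
    have "(\<integral>\<^sup>+x. indicator E (f x) * indicator B (f x - y) \<partial>lborel)
        = (\<integral>\<^sup>+x. indicator E (f (x + z)) * indicator B (f (x + z) - y) \<partial>lborel)"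
      by (rule nn_integral_lborel_translate[symmetric]) measurable
    then show "(\<integral>\<^sup>+x. indicator E (f x) * indicator B (f x - y) \<partial>lborel)
        = (\<integral>\<^sup>+x. indicator E (f x + y) * indicator B (f x) \<partial>lborel)"
      by (simp add: linear_add[OF f] z)
  qed
  also have "\<dots> = (\<integral>\<^sup>+x. \<integral>\<^sup>+y. indicator E (f x + y) * indicator B (f x) \<partial>lborel \<partial>lborel)"
    by (rule lborel_pair.Fubini') measurable
  also have "\<dots> = (\<integral>\<^sup>+x. ?m E * indicator B x \<partial>lborel)"
  proof (rule nn_integral_cong)
    fix x
    have "(\<integral>\<^sup>+y. indicator E (f x + y) \<partial>lborel) = (\<integral>\<^sup>+y. indicator E (y + f x) \<partial>lborel)"
      by (simp add: add.commute)
    also have "\<dots> = ?m E" by (subst nn_integral_lborel_translate) simp_all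
    finally show "(\<integral>\<^sup>+y. indicator E (f x + y) * indicator B (f x) \<partial>lborel) = ?m E * indicator B x"
      by (simp add: nn_integral_multc B(1))
  qed
  also have "\<dots> = ?m E * ?m B" by (simp add: nn_integral_cmult)
  finally have "emeasure (distr lborel borel f) E * ?m B = ?m E * ?m B" using 1 by simp
  moreover have "?m B \<noteq> \<infinity>" using emeasure_lborel_ball_finite[of "0::'a" 1] by (simp add: B_def less_top)
  moreover have "?m B \<noteq> 0" using content_ball_pos[of 1 "0::'a"] by (auto simp: B_def measure_def)
  ultimately show "emeasure (distr lborel borel f) E = emeasure lborel E"
    by (simp add: ennreal_mult_cancel_left mult.commute[of _ "?m B"])
qed simp

text \<open>Formulated on every euclidean space because the rotations that mix data and noise act on
  pairs, and pairs of vectors again form such a space.\<close>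

definition gauss_density :: "'a::euclidean_space \<Rightarrow> real" where
  "gauss_density x = exp (- (norm x)\<^sup>2 / 2) / sqrt ((2 * pi) ^ DIM('a))"

definition std_gauss :: "'a::euclidean_space measure" where
  "std_gauss = density lborel (\<lambda>x. ennreal (gauss_density x))"

lemma gauss_density_pos: "0 < gauss_density x"
  by (simp add: gauss_density_def)

lemma continuous_gauss_density: "continuous_on S gauss_density"
  unfolding gauss_density_def by (intro continuous_intros) auto

lemma measurable_gauss_density [measurable]: "gauss_density \<in> borel_measurable borel"
  by (intro borel_measurable_continuous_onI continuous_gauss_density)

lemma sets_std_gauss [simp, measurable_cong]: "sets std_gauss = sets borel"
  and space_std_gauss [simp]: "space std_gauss = UNIV"
  by (simp_all add: std_gauss_def)

lemma gauss_density_prod: "gauss_density (x::'a::euclidean_space) = (\<Prod>b\<in>Basis. std_normal_density (x \<bullet> b))"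
proof -
  have "(norm x)\<^sup>2 = (\<Sum>b\<in>Basis. (x \<bullet> b)\<^sup>2)"
    by (simp add: norm_eq_sqrt_inner euclidean_inner[of x x] power2_eq_square sum_nonneg)
  then have e: "(\<Sum>b\<in>Basis. - (x \<bullet> b)\<^sup>2 / 2) = - (norm x)\<^sup>2 / 2"
    by (simp add: sum_negf flip: sum_divide_distrib)
  have "(\<Prod>b\<in>Basis. std_normal_density (x \<bullet> b))
      = (\<Prod>b\<in>(Basis::'a set). 1 / sqrt (2 * pi)) * (\<Prod>b\<in>Basis. exp (- (x \<bullet> b)\<^sup>2 / 2))"
    by (simp only: std_normal_density_def prod.distrib)
  also have "\<dots> = (1 / sqrt (2 * pi)) ^ DIM('a) * exp (- (norm x)\<^sup>2 / 2)"
    by (simp only: exp_sum[OF finite_Basis, symmetric] e prod_constant)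
  finally show ?thesis
    by (simp only: gauss_density_def real_sqrt_power) (simp add: power_one_over)
qed

lemma prob_space_std_gauss: "prob_space (std_gauss :: 'a::euclidean_space measure)"
proof
  have "emeasure (std_gauss :: 'a measure) (space std_gauss)
      = (\<integral>\<^sup>+x. (\<Prod>b\<in>Basis. ennreal (std_normal_density ((x::'a) \<bullet> b))) \<partial>lborel)"
    by (simp add: std_gauss_def emeasure_density gauss_density_prod prod_ennreal)
  also have "\<dots> = (\<Prod>b\<in>(Basis::'a set). (\<integral>\<^sup>+x. ennreal (std_normal_density x) \<partial>lborel))"
    by (rule nn_integral_lborel_prod) auto
  also have "(\<integral>\<^sup>+x. ennreal (std_normal_density x) \<partial>lborel) = 1"
    using nn_integral_eq_integral[OF integrable_normal_density[of 1 0]] integral_normal_density[of 1 0] by simp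
  finally show "emeasure (std_gauss :: 'a measure) (space std_gauss) = 1" by simp
qed

interpretation std_gauss: prob_space "std_gauss :: 'a::euclidean_space measure"
  by (rule prob_space_std_gauss)

lemma nn_integral_std_gauss:
  "f \<in> borel_measurable borel \<Longrightarrow> (\<integral>\<^sup>+x. f x \<partial>std_gauss) = (\<integral>\<^sup>+x. ennreal (gauss_density x) * f x \<partial>lborel)"
  by (simp add: std_gauss_def nn_integral_density)

lemma integral_std_gauss:
  fixes f :: "'a::euclidean_space \<Rightarrow> 'b::{banach, second_countable_topology}"
  shows "f \<in> borel_measurable borel \<Longrightarrow> (\<integral>x. f x \<partial>std_gauss) = (\<integral>x. gauss_density x *\<^sub>R f x \<partial>lborel)"
  unfolding std_gauss_def
  by (subst integral_density) (auto intro: less_imp_le gauss_density_pos)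

text \<open>Completing the square, \<open>L * norm x \<le> L\<^sup>2 + (norm x)\<^sup>2 / 4\<close>,
  pays for the exponential with half of the Gaussian exponent. What remains is a product of normal
  densities of variance 2, up to the factor
  \<open>exp (L\<^sup>2) * sqrt 2 ^ DIM('a)\<close>.\<close>

lemma integrable_exp_norm: "integrable std_gauss (\<lambda>x::'a::euclidean_space. exp (L * norm x))"
proof -
  have le: "gauss_density x * exp (L * norm x) \<le> exp (L\<^sup>2) * sqrt 2 ^ DIM('a) * (\<Prod>b\<in>Basis. normal_density 0 (sqrt 2) (x \<bullet> b))"
    for x :: 'a
  proof -
    have n: "(norm x)\<^sup>2 = (\<Sum>b\<in>Basis. (x \<bullet> b)\<^sup>2)"
      by (simp add: norm_eq_sqrt_inner euclidean_inner[of x x] power2_eq_square sum_nonneg)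
    have "(\<Prod>b\<in>Basis. normal_density 0 (sqrt 2) (x \<bullet> b)) = exp (- (norm x)\<^sup>2 / 4) / sqrt (4 * pi) ^ DIM('a)"
      unfolding n by (simp add: normal_density_def prod_dividef sum_divide_distrib sum_negf flip: exp_sum)
    moreover have e: "exp (L\<^sup>2 - (norm x)\<^sup>2 / 4) = exp (L\<^sup>2) * exp (- (norm x)\<^sup>2 / 4)"
      by (simp flip: exp_add)
    moreover have pi4: "sqrt (4 * pi) = sqrt 2 * sqrt (2 * pi)" by (simp flip: real_sqrt_mult)
    ultimately have "exp (L\<^sup>2) * sqrt 2 ^ DIM('a) * (\<Prod>b\<in>Basis. normal_density 0 (sqrt 2) (x \<bullet> b))
        = exp (L\<^sup>2 - (norm x)\<^sup>2 / 4) / sqrt (2 * pi) ^ DIM('a)"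
      by (simp only: pi4 e power_mult_distrib) simp
    moreover have "- (norm x)\<^sup>2 / 2 + L * norm x \<le> L\<^sup>2 - (norm x)\<^sup>2 / 4"
    proof -
      have "0 \<le> (L - norm x / 2)\<^sup>2" by simp
      then show ?thesis by (simp add: power2_eq_square field_simps)
    qed
    moreover have "gauss_density x * exp (L * norm x) = exp (- (norm x)\<^sup>2 / 2 + L * norm x) / sqrt (2 * pi) ^ DIM('a)"
      by (simp only: gauss_density_def real_sqrt_power exp_add times_divide_eq_left)
    ultimately show ?thesis by (simp add: divide_right_mono)
  qed
  have "(\<integral>\<^sup>+x. ennreal (exp (L * norm (x::'a))) \<partial>std_gauss)
      = (\<integral>\<^sup>+x. ennreal (gauss_density (x::'a) * exp (L * norm x)) \<partial>lborel)"
    by (subst nn_integral_std_gauss) (auto simp: ennreal_mult less_imp_le[OF gauss_density_pos])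
  also have "\<dots> \<le> (\<integral>\<^sup>+x. ennreal (exp (L\<^sup>2) * sqrt 2 ^ DIM('a)) * (\<Prod>b\<in>Basis. ennreal (normal_density 0 (sqrt 2) ((x::'a) \<bullet> b))) \<partial>lborel)"
    by (intro nn_integral_mono) (simp add: prod_ennreal ennreal_mult[symmetric] prod_nonneg le ennreal_leI)
  also have "\<dots> = ennreal (exp (L\<^sup>2) * sqrt 2 ^ DIM('a)) * (\<integral>\<^sup>+x. (\<Prod>b\<in>Basis. ennreal (normal_density 0 (sqrt 2) ((x::'a) \<bullet> b))) \<partial>lborel)"
    by (rule nn_integral_cmult) measurable
  also have "(\<integral>\<^sup>+x. (\<Prod>b\<in>Basis. ennreal (normal_density 0 (sqrt 2) ((x::'a) \<bullet> b))) \<partial>lborel)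
      = (\<Prod>b\<in>(Basis::'a set). (\<integral>\<^sup>+x. ennreal (normal_density 0 (sqrt 2) x) \<partial>lborel))"
    by (rule nn_integral_lborel_prod) auto
  also have "(\<integral>\<^sup>+x. ennreal (normal_density 0 (sqrt 2) x) \<partial>lborel) = 1"
    using nn_integral_eq_integral[OF integrable_normal_density[of "sqrt 2" 0]] integral_normal_density[of "sqrt 2" 0] by simp
  finally have "(\<integral>\<^sup>+x. ennreal (exp (L * norm (x::'a))) \<partial>std_gauss) < \<infinity>"
    by (simp add: order.strict_trans1 ennreal_mult_less_top)
  then show ?thesis by (intro integrableI_nonneg) auto
qed

lemma integrable_std_gauss_exp_bound:
  fixes f :: "'a::euclidean_space \<Rightarrow> 'b::{banach, second_countable_topology}"
  assumes "f \<in> borel_measurable borel" and "\<And>x. norm (f x) \<le> K * exp (L * norm x)"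
  shows "integrable std_gauss f"
  by (rule Bochner_Integration.integrable_bound[where f = "\<lambda>x. K * exp (L * norm x)"])
     (use assms in \<open>auto intro!: integrable_mult_right integrable_exp_norm AE_I2 intro: order_trans[OF _ abs_ge_self]\<close>)

lemma distr_std_gauss_isometry:
  fixes f :: "'a::euclidean_space \<Rightarrow> 'a"
  assumes f: "linear f" and n: "\<And>x. norm (f x) = norm x"
  shows "distr std_gauss borel f = std_gauss"
proof -
  have [measurable]: "f \<in> borel_measurable borel"
    using f linear_continuous_on linear_conv_bounded_linear by (intro borel_measurable_continuous_onI) blast
  have "distr std_gauss borel f = distr (density lborel (\<lambda>x. ennreal (gauss_density (f x)))) borel f"
    by (simp add: std_gauss_def gauss_density_def n)
  also have "\<dots> = density (distr lborel borel f) (\<lambda>x. ennreal (gauss_density x))"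
    by (subst density_distr) simp_all
  finally show ?thesis by (simp add: distr_lborel_isometry[OF f n] std_gauss_def)
qed

lemma std_gauss_pair: "std_gauss \<Otimes>\<^sub>M std_gauss = (std_gauss :: ('a::euclidean_space \<times> 'b::euclidean_space) measure)"
proof -
  have "gauss_density x * gauss_density y = gauss_density (x, y)" for x :: 'a and y :: 'b
  proof -
    have n: "(norm (x, y))\<^sup>2 = (norm x)\<^sup>2 + (norm y)\<^sup>2" by (simp add: norm_Pair)
    have "exp (- (norm (x, y))\<^sup>2 / 2) = exp (- (norm x)\<^sup>2 / 2) * exp (- (norm y)\<^sup>2 / 2)"
      unfolding exp_add[symmetric] n by (rule arg_cong[where f = exp]) (simp add: field_simps)
    then show ?thesis by (simp add: gauss_density_def power_add real_sqrt_mult)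
  qed
  then have "(\<lambda>(x::'a, y::'b). ennreal (gauss_density x) * ennreal (gauss_density y)) = (\<lambda>z. ennreal (gauss_density z))"
    by (auto simp: fun_eq_iff less_imp_le[OF gauss_density_pos] simp flip: ennreal_mult)
  moreover have "std_gauss \<Otimes>\<^sub>M std_gauss = density (lborel \<Otimes>\<^sub>M lborel) (\<lambda>(x::'a, y::'b). ennreal (gauss_density x) * ennreal (gauss_density y))"
    unfolding std_gauss_def
    by (rule pair_measure_density)
       (use prob_space_std_gauss[where 'a='b] in \<open>auto simp: std_gauss_def[symmetric] lborel.sigma_finite_measure_axioms
         intro: prob_space_imp_sigma_finite\<close>)
  ultimately show ?thesis by (simp add: lborel_prod std_gauss_def)
qed


section \<open>Integrals depending on a parameter, and Stein's identity\<close>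

lemma continuous_on_integral_dominated:
  fixes f :: "'p::metric_space \<Rightarrow> 'z \<Rightarrow> 'b::{banach, second_countable_topology}"
  assumes cont: "\<And>z. z \<in> space M \<Longrightarrow> continuous_on X (\<lambda>p. f p z)"
    and meas: "\<And>p. p \<in> X \<Longrightarrow> f p \<in> borel_measurable M"
    and bnd: "\<And>p z. p \<in> X \<Longrightarrow> z \<in> space M \<Longrightarrow> norm (f p z) \<le> B p * g z"
    and B: "continuous_on X B"
    and g: "integrable M g" "\<And>z. z \<in> space M \<Longrightarrow> 0 \<le> g z"
  shows "continuous_on X (\<lambda>p. \<integral>z. f p z \<partial>M)"
  unfolding continuous_on_sequentially comp_def
proof (intro allI ballI impI, elim conjE)
  fix x a assume x: "\<forall>n. x n \<in> X" and a: "a \<in> X" and lim: "x \<longlonglongrightarrow> a"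
  have seq: "(\<lambda>n. \<phi> (x n)) \<longlonglongrightarrow> \<phi> a" if "continuous_on X \<phi>" for \<phi> :: "'p \<Rightarrow> 'c::metric_space"
    using that x a lim unfolding continuous_on_sequentially comp_def by blast
  \<comment> \<open>The envelope may depend on the parameter: \<open>B\<close> is bounded along a
    convergent sequence, which restores a single dominating function.\<close>
  have "Bseq (\<lambda>n. B (x n))" using seq[OF B] convergentI convergent_imp_Bseq by blast
  then obtain c where c: "\<And>n. norm (B (x n)) \<le> c" unfolding Bseq_def by blast
  show "(\<lambda>n. \<integral>z. f (x n) z \<partial>M) \<longlonglongrightarrow> (\<integral>z. f a z \<partial>M)"
  proof (rule integral_dominated_convergence[where w = "\<lambda>z. c * g z"])
    show "AE z in M. (\<lambda>n. f (x n) z) \<longlonglongrightarrow> f a z"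
      using seq[OF cont] by (intro AE_I2)
    show "AE z in M. norm (f (x n) z) \<le> c * g z" for n
    proof (rule AE_I2)
      fix z assume z: "z \<in> space M"
      have "norm (f (x n) z) \<le> B (x n) * g z" using bnd z x by blast
      also have "\<dots> \<le> c * g z" using c[of n] g(2)[OF z] by (intro mult_right_mono) auto
      finally show "norm (f (x n) z) \<le> c * g z" .
    qed
  qed (use meas x a g in auto)
qed

text \<open>The mean value inequality bounds difference quotients by \<open>g\<close>, so dominated
  convergence applies to the normalized remainder. Measurability of \<open>f'\<close> is not among
  the assumptions; it is inherited from difference quotients along a sequence.\<close>

lemma has_derivative_integral_dominated:
  fixes f :: "'a::real_normed_vector \<Rightarrow> 'z \<Rightarrow> 'b::{banach, second_countable_topology}"
  assumes r: "0 < r"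
    and deriv: "\<And>y z. y \<in> ball y0 r \<Longrightarrow> z \<in> space M \<Longrightarrow> ((\<lambda>y. f y z) has_derivative f' y z) (at y)"
    and bnd: "\<And>y z v. y \<in> ball y0 r \<Longrightarrow> z \<in> space M \<Longrightarrow> norm (f' y z v) \<le> g z * norm v"
    and g: "integrable M g" "\<And>z. z \<in> space M \<Longrightarrow> 0 \<le> g z"
    and f: "\<And>y. y \<in> ball y0 r \<Longrightarrow> integrable M (f y)"
  shows "integrable M (\<lambda>z. f' y0 z v)"
    and "((\<lambda>y. \<integral>z. f y z \<partial>M) has_derivative (\<lambda>v. \<integral>z. f' y0 z v \<partial>M)) (at y0)"
proof -
  have y0: "y0 \<in> ball y0 r" using r by simp
  have lin: "bounded_linear (f' y z)" if "y \<in> ball y0 r" "z \<in> space M" for y z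
    using deriv[OF that] has_derivative_bounded_linear by blast
  have meas: "(\<lambda>z. f' y0 z v) \<in> borel_measurable M" for v
  proof (cases "v = 0")
    case True
    then show ?thesis
      using linear_0[OF bounded_linear.linear[OF lin[OF y0]]] by (simp cong: measurable_cong)
  next
    case False
    \<comment> \<open>Step sizes that keep \<open>y0 + s n *\<^sub>R v\<close> within distance
      \<open>r / 2\<close> of \<open>y0\<close>.\<close>
    define s where "s n = r / (2 * norm v) * inverse (real (Suc n))" for n
    have s: "s n > 0" "y0 + s n *\<^sub>R v \<in> ball y0 r" for n
    proof -
      show "s n > 0" using r False by (simp add: s_def)
      then have "norm (s n *\<^sub>R v) = r / 2 * inverse (real (Suc n))" using False r by (simp add: s_def abs_mult)
      also have "\<dots> \<le> r / 2 * 1" using r by (intro mult_left_mono) (auto simp: inverse_le_1_iff)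
      also have "\<dots> < r" using r by simp
      finally show "y0 + s n *\<^sub>R v \<in> ball y0 r" by (simp add: dist_norm)
    qed
    have s0: "s \<longlonglongrightarrow> 0"
      unfolding s_def by (intro tendsto_mult_right_zero LIMSEQ_inverse_real_of_nat)
    show ?thesis
    proof (rule borel_measurable_LIMSEQ_metric)
      show "(\<lambda>z. (f (y0 + s n *\<^sub>R v) z - f y0 z) /\<^sub>R s n) \<in> borel_measurable M" for n
        using f[OF s(2)[of n]] f[OF y0] by (intro borel_measurable_scaleR borel_measurable_diff) auto
      fix z assume z: "z \<in> space M"
      let ?q = "\<lambda>y. (1 / norm (y - y0)) *\<^sub>R (f y z - (f y0 z + f' y0 z (y - y0)))"
      have "(?q \<longlongrightarrow> 0) (at y0)"
        using deriv[OF y0 z] unfolding has_derivative_within by blast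
      moreover have "(\<lambda>n. y0 + s n *\<^sub>R v) \<longlonglongrightarrow> y0"
        using tendsto_add[OF tendsto_const tendsto_scaleR[OF s0 tendsto_const]] by force
      moreover have ne: "y0 + s n *\<^sub>R v \<in> UNIV - {y0}" for n using s(1)[of n] False by auto
      ultimately have "(\<lambda>n. ?q (y0 + s n *\<^sub>R v)) \<longlonglongrightarrow> 0"
        unfolding tendsto_at_iff_sequentially comp_def using ne by (elim allE[of _ "\<lambda>n. y0 + s n *\<^sub>R v"]) blast
      from tendsto_add[OF tendsto_scaleR[OF tendsto_const[of "norm v"] this] tendsto_const[of "f' y0 z v"]]
      have "(\<lambda>n. norm v *\<^sub>R ?q (y0 + s n *\<^sub>R v) + f' y0 z v) \<longlonglongrightarrow> f' y0 z v" by simp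
      moreover have "norm v *\<^sub>R ?q (y0 + s n *\<^sub>R v) + f' y0 z v = (f (y0 + s n *\<^sub>R v) z - f y0 z) /\<^sub>R s n" for n
      proof -
        have c: "norm v * (1 / norm (s n *\<^sub>R v)) = inverse (s n)"
          using s(1)[of n] False by (simp add: field_simps)
        have "f' y0 z (s n *\<^sub>R v) = s n *\<^sub>R f' y0 z v"
          using linear_cmul[OF bounded_linear.linear[OF lin[OF y0 z]]] by simp
        then show ?thesis
          using s(1)[of n] by (simp only: add_diff_cancel_left' scaleR_scaleR c) (simp add: algebra_simps)
      qed
      ultimately show "(\<lambda>n. (f (y0 + s n *\<^sub>R v) z - f y0 z) /\<^sub>R s n) \<longlonglongrightarrow> f' y0 z v" by simp
    qed
  qed
  show int: "integrable M (\<lambda>z. f' y0 z v)" for v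
    by (rule Bochner_Integration.integrable_bound[where f = "\<lambda>z. g z * norm v"])
       (use g meas bnd[OF y0] in \<open>auto intro!: AE_I2 intro: order_trans[OF _ abs_ge_self]\<close>)
  have lip: "norm (f y z - f y0 z) \<le> g z * norm (y - y0)" if "y \<in> ball y0 r" "z \<in> space M" for y z
  proof (rule differentiable_bound[OF convex_ball[of y0 r]])
    show "((\<lambda>y. f y z) has_derivative f' x z) (at x within ball y0 r)" if "x \<in> ball y0 r" for x
      using deriv that \<open>z \<in> space M\<close> has_derivative_at_withinI by blast
    show "onorm (f' x z) \<le> g z" if "x \<in> ball y0 r" for x
      using bnd[OF that] g(2) \<open>z \<in> space M\<close> by (intro onorm_bound) auto
  qed (use that y0 in auto)
  have "bounded_linear (\<lambda>v. \<integral>z. f' y0 z v \<partial>M)"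
  proof (rule bounded_linear_intro[where K = "\<integral>z. g z \<partial>M"])
    have "f' y0 z (v + w) = f' y0 z v + f' y0 z w" "f' y0 z (c *\<^sub>R v) = c *\<^sub>R f' y0 z v"
      if "z \<in> space M" for z v w c
      using lin[OF y0 that] by (simp_all add: linear_simps)
    then show "(\<integral>z. f' y0 z (v + w) \<partial>M) = (\<integral>z. f' y0 z v \<partial>M) + (\<integral>z. f' y0 z w \<partial>M)"
      "(\<integral>z. f' y0 z (c *\<^sub>R v) \<partial>M) = c *\<^sub>R (\<integral>z. f' y0 z v \<partial>M)" for v w c
      by (simp_all add: int cong: Bochner_Integration.integral_cong)
    have "norm (\<integral>z. f' y0 z v \<partial>M) \<le> (\<integral>z. g z * norm v \<partial>M)" for v
      by (rule order_trans[OF integral_norm_bound integral_mono]) (use int g bnd[OF y0] in auto)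
    then show "norm (\<integral>z. f' y0 z v \<partial>M) \<le> norm v * (\<integral>z. g z \<partial>M)" for v
      by (simp add: mult.commute)
  qed
  moreover have "((\<lambda>y. (1 / norm (y - y0)) *\<^sub>R ((\<integral>z. f y z \<partial>M)
      - ((\<integral>z. f y0 z \<partial>M) + (\<integral>z. f' y0 z (y - y0) \<partial>M)))) \<longlongrightarrow> 0) (at y0 within ball y0 r)"
    unfolding tendsto_at_iff_sequentially comp_def
  proof (intro allI impI)
    fix X :: "nat \<Rightarrow> 'a" assume X: "\<forall>i. X i \<in> ball y0 r - {y0}" and lim: "X \<longlonglongrightarrow> y0"
    let ?q = "\<lambda>n z. (1 / norm (X n - y0)) *\<^sub>R (f (X n) z - (f y0 z + f' y0 z (X n - y0)))"
    have Xb: "X n \<in> ball y0 r" "X n \<noteq> y0" for n using X by auto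
    have "(\<lambda>n. \<integral>z. ?q n z \<partial>M) \<longlonglongrightarrow> (\<integral>z. 0 \<partial>M)"
    proof (rule integral_dominated_convergence[where w = "\<lambda>z. 2 * g z"])
      show "?q n \<in> borel_measurable M" for n
        using f[OF Xb(1)] f[OF y0] meas by auto
      show "AE z in M. (\<lambda>n. ?q n z) \<longlonglongrightarrow> 0"
      proof (rule AE_I2)
        fix z assume "z \<in> space M"
        from deriv[OF y0 this] have "((\<lambda>y. (1 / norm (y - y0)) *\<^sub>R (f y z - (f y0 z + f' y0 z (y - y0)))) \<longlongrightarrow> 0) (at y0)"
          unfolding has_derivative_within by blast
        then show "(\<lambda>n. ?q n z) \<longlonglongrightarrow> 0"
          using lim Xb(2) unfolding tendsto_at_iff_sequentially comp_def by auto
      qed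
      \<comment> \<open>One \<open>g z\<close> pays for the increment of \<open>f\<close>, the other
        for the linear term.\<close>
      show "AE z in M. norm (?q n z) \<le> 2 * g z" for n
      proof (rule AE_I2)
        fix z assume z: "z \<in> space M"
        have "norm (f (X n) z - (f y0 z + f' y0 z (X n - y0))) \<le> norm (f (X n) z - f y0 z) + norm (f' y0 z (X n - y0))"
          using norm_triangle_ineq4[of "f (X n) z - f y0 z" "f' y0 z (X n - y0)"] by (simp add: algebra_simps)
        also have "\<dots> \<le> 2 * g z * norm (X n - y0)" using lip[OF Xb(1)[of n] z] bnd[OF y0 z, of "X n - y0"] by linarith
        finally show "norm (?q n z) \<le> 2 * g z" using Xb(2)[of n] by (simp add: divide_le_eq)
      qed
    qed (use g in auto)
    moreover have "(\<integral>z. ?q n z \<partial>M) = (1 / norm (X n - y0)) *\<^sub>R ((\<integral>z. f (X n) z \<partial>M)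
      - ((\<integral>z. f y0 z \<partial>M) + (\<integral>z. f' y0 z (X n - y0) \<partial>M)))" for n
      using f[OF Xb(1)] f[OF y0] int by simp
    ultimately show "(\<lambda>n. (1 / norm (X n - y0)) *\<^sub>R ((\<integral>z. f (X n) z \<partial>M)
      - ((\<integral>z. f y0 z \<partial>M) + (\<integral>z. f' y0 z (X n - y0) \<partial>M)))) \<longlonglongrightarrow> 0"
      by (simp only: Bochner_Integration.integral_zero)
  qed
  ultimately show "((\<lambda>y. \<integral>z. f y z \<partial>M) has_derivative (\<lambda>v. \<integral>z. f' y0 z v \<partial>M)) (at y0)"
    unfolding at_within_open[OF y0 open_ball, symmetric] has_derivative_within by (rule conjI)
qed

text \<open>Translating the integrand against the Gaussian weight leaves the integral unchanged; Stein's
  identity is the vanishing of the derivative of that constant.\<close>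

lemma stein_identity:
  fixes G :: "'a::euclidean_space \<Rightarrow> real"
  assumes G: "\<And>z. (G has_derivative G' z) (at z)"
    and bG: "\<And>z. \<bar>G z\<bar> \<le> K * exp (L * norm z)"
    and bG': "\<And>z v. \<bar>G' z v\<bar> \<le> K * exp (L * norm z) * norm v"
    and L: "0 \<le> L"
  shows "integrable std_gauss (\<lambda>z. G z * (z \<bullet> e))" "integrable std_gauss (\<lambda>z. G' z e)"
    and "(\<integral>z. G z * (z \<bullet> e) \<partial>std_gauss) = (\<integral>z. G' z e \<partial>std_gauss)"
proof -
  have K: "0 \<le> K" using order_trans[OF abs_ge_zero bG[of 0]] by simp
  have cG: "continuous_on UNIV G"
    using has_derivative_continuous[OF G] by (simp add: continuous_at_imp_continuous_on)
  then have mG[measurable]: "G \<in> borel_measurable borel" by (rule borel_measurable_continuous_onI)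
  define N where "N = norm e"
  \<comment> \<open>The ratio of \<open>gauss_density (z + s *\<^sub>R e)\<close> to
    \<open>gauss_density z\<close>, so that the integral of \<open>f s\<close> is the integral of
    \<open>G\<close> after a translation.\<close>
  define w where "w s z = exp (- s * (z \<bullet> e) - s\<^sup>2 * N\<^sup>2 / 2)" for s z
  define f where "f s z = G (z + s *\<^sub>R e) * w s z" for s z
  define f' where "f' s z v = v * (G' (z + s *\<^sub>R e) e * w s z - G (z + s *\<^sub>R e) * w s z * (z \<bullet> e + s * N\<^sup>2))" for s z v
  have df: "((\<lambda>s. f s z) has_derivative f' s z) (at s)" for s z
  proof -
    have "((\<lambda>s. G (z + s *\<^sub>R e)) has_derivative (\<lambda>v. G' (z + s *\<^sub>R e) (v *\<^sub>R e))) (at s)"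
    proof (rule has_derivative_compose[OF _ G])
      show "((\<lambda>s. z + s *\<^sub>R e) has_derivative (\<lambda>v. v *\<^sub>R e)) (at s)"
        by (auto intro!: derivative_eq_intros)
    qed
    moreover have "(\<lambda>v. G' (z + s *\<^sub>R e) (v *\<^sub>R e)) = (*) (G' (z + s *\<^sub>R e) e)"
      using linear_cmul[OF has_derivative_linear[OF G]] by (simp add: fun_eq_iff)
    ultimately have "((\<lambda>s. G (z + s *\<^sub>R e)) has_real_derivative G' (z + s *\<^sub>R e) e) (at s)"
      by (simp add: has_field_derivative_def)
    then have "((\<lambda>s. f s z) has_real_derivative
        (G' (z + s *\<^sub>R e) e * w s z - G (z + s *\<^sub>R e) * w s z * (z \<bullet> e + s * N\<^sup>2))) (at s)"
      unfolding f_def w_def by (auto intro!: derivative_eq_intros simp: algebra_simps)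
    moreover have "f' s z = (*) (G' (z + s *\<^sub>R e) e * w s z - G (z + s *\<^sub>R e) * w s z * (z \<bullet> e + s * N\<^sup>2))"
      by (simp add: fun_eq_iff f'_def)
    ultimately show ?thesis by (simp add: has_field_derivative_def)
  qed
  have shift: "(\<integral>z. f s z \<partial>std_gauss) = (\<integral>z. G z \<partial>std_gauss)" for s
  proof -
    have "gauss_density z * w s z = gauss_density (z + s *\<^sub>R e)" for z
    proof -
      have "(norm (z + s *\<^sub>R e))\<^sup>2 = (norm z)\<^sup>2 + 2 * s * (z \<bullet> e) + s\<^sup>2 * N\<^sup>2"
        unfolding N_def power2_norm_eq_inner by (simp add: inner_simps power2_eq_square inner_commute algebra_simps)
      then have "- (norm (z + s *\<^sub>R e))\<^sup>2 / 2 = - (norm z)\<^sup>2 / 2 + (- s * (z \<bullet> e) - s\<^sup>2 * N\<^sup>2 / 2)" by (simp add: field_simps)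
      then show ?thesis by (simp only: gauss_density_def w_def exp_add) simp
    qed
    then have "(\<integral>z. f s z \<partial>std_gauss) = (\<integral>z. gauss_density (s *\<^sub>R e + z) * G (s *\<^sub>R e + z) \<partial>lborel)"
      unfolding f_def w_def by (subst integral_std_gauss) (auto intro!: Bochner_Integration.integral_cong simp: ac_simps w_def)
    also have "\<dots> = (\<integral>z. gauss_density z * G z \<partial>distr lborel borel ((+) (s *\<^sub>R e)))"
      by (subst integral_distr) auto
    also have "\<dots> = (\<integral>z. G z \<partial>std_gauss)" by (simp add: lborel_distr_plus integral_std_gauss)
    finally show ?thesis .
  qed
  \<comment> \<open>\<open>K'\<close> and \<open>L'\<close> dominate the derivative for all
    \<open>\<bar>s\<bar> \<le> 1\<close>: \<open>exp (L * N)\<close> and the summand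
    \<open>N\<close> of \<open>L'\<close> pay for the shift and the weight \<open>w\<close>; the
    other factors and the summand 1 pay for \<open>G'\<close> and the linear term
    \<open>z \<bullet> e + s * N\<^sup>2\<close>.\<close>
  define K' where "K' = (2 + N) * (1 + N\<^sup>2) * K * exp (L * N)"
  define L' where "L' = L + N + 1"
  have N: "0 \<le> N" by (simp add: N_def)
  have growth: "w s z * exp (L * norm (z + s *\<^sub>R e)) \<le> exp (L * N) * exp ((L + N) * norm z)" if s: "\<bar>s\<bar> \<le> 1" for s z
  proof -
    have "norm (z + s *\<^sub>R e) \<le> norm z + \<bar>s\<bar> * N" using norm_triangle_ineq[of z "s *\<^sub>R e"] by (simp add: N_def)
    also have "\<dots> \<le> norm z + N" using s N by (simp add: mult_left_le_one_le)
    finally have 1: "L * norm (z + s *\<^sub>R e) \<le> L * (norm z + N)" using L by (rule mult_left_mono)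
    have "\<bar>s * (z \<bullet> e)\<bar> \<le> 1 * (norm z * N)"
      unfolding abs_mult N_def by (intro mult_mono s Cauchy_Schwarz_ineq2) auto
    then have "- s * (z \<bullet> e) \<le> norm z * N" by (simp add: abs_le_iff)
    moreover have "0 \<le> s\<^sup>2 * N\<^sup>2" by simp
    ultimately have "- s * (z \<bullet> e) - s\<^sup>2 * N\<^sup>2 / 2 \<le> N * norm z" unfolding mult.commute[of N] by linarith
    then have "(- s * (z \<bullet> e) - s\<^sup>2 * N\<^sup>2 / 2) + L * norm (z + s *\<^sub>R e) \<le> L * N + (L + N) * norm z"
      using 1 by (simp add: algebra_simps)
    then show ?thesis unfolding w_def exp_add[symmetric] by simp
  qed
  have bf: "norm (f s z) \<le> K * exp (L * N) * exp ((L + N) * norm z)" if s: "\<bar>s\<bar> \<le> 1" for s z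
  proof -
    have "\<bar>G (z + s *\<^sub>R e)\<bar> * w s z \<le> K * exp (L * norm (z + s *\<^sub>R e)) * w s z"
      by (intro mult_right_mono bG) (simp add: w_def)
    also have "\<dots> \<le> K * (exp (L * N) * exp ((L + N) * norm z))"
      using mult_left_mono[OF growth[OF s] K, of z] by (simp add: mult_ac)
    finally show ?thesis by (simp add: f_def abs_mult w_def mult.assoc)
  qed
  have bf': "norm (f' s z v) \<le> K' * exp (L' * norm z) * norm v" if s: "\<bar>s\<bar> \<le> 1" for s z v
  proof -
    let ?E = "K * exp (L * norm (z + s *\<^sub>R e)) * w s z"
    have E: "?E \<le> K * exp (L * N) * exp ((L + N) * norm z)"
      using mult_left_mono[OF growth[OF s] K, of z] by (simp add: mult_ac)
    have E0: "0 \<le> ?E" using K by (simp add: w_def)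
    have ze: "\<bar>z \<bullet> e + s * N\<^sup>2\<bar> \<le> norm z * N + N\<^sup>2"
    proof -
      have "\<bar>z \<bullet> e\<bar> \<le> norm z * N" unfolding N_def by (rule Cauchy_Schwarz_ineq2)
      moreover have "\<bar>s * N\<^sup>2\<bar> \<le> 1 * N\<^sup>2" unfolding abs_mult by (intro mult_mono s) auto
      ultimately show ?thesis by linarith
    qed
    have "\<bar>G' (z + s *\<^sub>R e) e * w s z - G (z + s *\<^sub>R e) * w s z * (z \<bullet> e + s * N\<^sup>2)\<bar>
        \<le> \<bar>G' (z + s *\<^sub>R e) e\<bar> * w s z + \<bar>G (z + s *\<^sub>R e)\<bar> * w s z * \<bar>z \<bullet> e + s * N\<^sup>2\<bar>"
      by (rule order_trans[OF abs_triangle_ineq4]) (simp add: abs_mult w_def)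
    also have "\<dots> \<le> (K * exp (L * norm (z + s *\<^sub>R e)) * N) * w s z + ?E * (norm z * N + N\<^sup>2)"
      by (intro add_mono mult_mono mult_right_mono bG' bG ze)
         (use bG'[of "z + s *\<^sub>R e" e] bG[of "z + s *\<^sub>R e"] K in \<open>auto simp: w_def N_def\<close>)
    also have "\<dots> = ?E * (N + norm z * N + N\<^sup>2)" by (simp add: algebra_simps)
    also have "\<dots> \<le> ?E * ((2 + N) * (1 + N\<^sup>2) * exp (norm z))"
    proof (rule mult_left_mono[OF _ E0])
      have e: "1 + norm z \<le> exp (norm z)" by simp
      have N1: "N \<le> 1 + N\<^sup>2" using N zero_le_power2[of "N - 1"] by (simp add: power2_diff)
      have "N + norm z * N + N\<^sup>2 = N * (1 + norm z) + N\<^sup>2" by (simp add: algebra_simps)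
      also have "\<dots> \<le> N * exp (norm z) + N\<^sup>2 * exp (norm z)"
        using e N by (intro add_mono mult_left_mono) (auto simp: mult_le_cancel_left1)
      also have "\<dots> = (N + N\<^sup>2) * exp (norm z)" by (simp add: algebra_simps)
      also have "\<dots> \<le> (2 + N) * (1 + N\<^sup>2) * exp (norm z)"
        using N1 N by (intro mult_right_mono) (auto simp: algebra_simps)
      finally show "N + norm z * N + N\<^sup>2 \<le> (2 + N) * (1 + N\<^sup>2) * exp (norm z)" .
    qed
    also have "\<dots> \<le> K * exp (L * N) * exp ((L + N) * norm z) * ((2 + N) * (1 + N\<^sup>2) * exp (norm z))"
      using N by (intro mult_right_mono E) auto
    also have "\<dots> = K' * exp (L' * norm z)"
      by (simp add: K'_def L'_def ring_distribs exp_add mult_ac)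
    finally show ?thesis by (simp add: f'_def abs_mult mult_left_mono mult.commute)
  qed
  have f_int: "integrable std_gauss (f s)" if "s \<in> ball 0 1" for s
    by (rule integrable_std_gauss_exp_bound[OF _ bf])
       (use that in \<open>auto simp: f_def w_def[abs_def]\<close>)
  have K'0: "0 \<le> K'" using K N by (simp add: K'_def)
  note D = has_derivative_integral_dominated[of 1 "0::real" std_gauss f f' "\<lambda>z. K' * exp (L' * norm z)",
      OF _ df bf' _ _ f_int]
  have D1: "integrable std_gauss (\<lambda>z. f' 0 z v)" for v
    by (rule D) (use K'0 in \<open>auto intro: integrable_exp_norm\<close>)
  have D2: "((\<lambda>s. \<integral>z. f s z \<partial>std_gauss) has_derivative (\<lambda>v. \<integral>z. f' 0 z v \<partial>std_gauss)) (at 0)"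
    by (rule D) (use K'0 in \<open>auto intro: integrable_exp_norm\<close>)
  have "((\<lambda>s. \<integral>z. f s z \<partial>std_gauss) has_derivative (\<lambda>v. 0)) (at 0)"
    unfolding shift by simp
  from has_derivative_unique[OF this D2] have z: "(\<integral>z. f' 0 z 1 \<partial>std_gauss) = 0" by (metis)
  have f'0: "f' 0 z 1 = G' z e - G z * (z \<bullet> e)" for z by (simp add: f'_def w_def)
  show i1: "integrable std_gauss (\<lambda>z. G z * (z \<bullet> e))"
  proof (rule integrable_std_gauss_exp_bound)
    fix z
    have "\<bar>z \<bullet> e\<bar> \<le> norm z * N" unfolding N_def by (rule Cauchy_Schwarz_ineq2)
    also have "\<dots> \<le> exp (norm z) * N" using N exp_ge_add_one_self[of "norm z"] by (intro mult_right_mono) linarith+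
    finally have "norm (G z * (z \<bullet> e)) \<le> K * exp (L * norm z) * (exp (norm z) * N)"
      using bG[of z] K by (auto simp: abs_mult intro!: mult_mono)
    then show "norm (G z * (z \<bullet> e)) \<le> K * N * exp ((L + 1) * norm z)"
      by (simp add: ring_distribs exp_add mult_ac)
  qed simp
  show i2: "integrable std_gauss (\<lambda>z. G' z e)"
    using Bochner_Integration.integrable_add[OF D1[of 1] i1] by (simp add: f'0)
  show "(\<integral>z. G z * (z \<bullet> e) \<partial>std_gauss) = (\<integral>z. G' z e \<partial>std_gauss)"
    using z i1 i2 by (simp add: f'0)
qed

section \<open>Spectral calculus in an orthonormal frame\<close>

locale orthonormal_frame =
  fixes Q :: "real^'n^'n"
  assumes orth: "orthogonal_matrix Q"
begin

declare transpose_matrix_vector [simp del]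

definition coord :: "real^'n \<Rightarrow> 'n \<Rightarrow> real" where
  "coord x i = (transpose Q *v x) $ i"

text \<open>The operator with eigenvalues \<open>f\<close> in the frame \<open>Q\<close>. Functions
  of the commuting matrices become functions of an index, and identities between them reduce to
  scalar ones, coordinate by coordinate.\<close>

definition spec :: "('n \<Rightarrow> real) \<Rightarrow> real^'n \<Rightarrow> real^'n" where
  "spec f x = Q *v (\<chi> i. f i * coord x i)"

lemma Q_cancel: "transpose Q *v (Q *v x) = x" "Q *v (transpose Q *v x) = x"
  using orth by (simp_all add: orthogonal_matrix_def matrix_vector_mul_assoc)

lemma coord_eqI: "(\<And>i. coord x i = coord y i) \<Longrightarrow> x = y"
  by (metis (mono_tags) Q_cancel(2) coord_def vec_eq_iff)

lemma inner_coord: "x \<bullet> y = (\<Sum>i\<in>UNIV. coord x i * coord y i)"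
proof -
  have "(transpose Q *v x) \<bullet> (transpose Q *v y) = x \<bullet> y"
    by (metis Q_cancel(2) dot_lmul_matrix transpose_matrix_vector vector_transpose_matrix)
  then show ?thesis by (simp add: inner_vec_def coord_def)
qed

lemma norm_coord: "(norm x)\<^sup>2 = (\<Sum>i\<in>UNIV. (coord x i)\<^sup>2)"
  unfolding power2_norm_eq_inner by (subst inner_coord) (simp add: power2_eq_square)

lemma coord_spec [simp]: "coord (spec f x) i = f i * coord x i"
  unfolding coord_def[of "spec f x"] by (subst spec_def) (simp add: Q_cancel)

lemma coord_simps [simp]: "coord (x + y) i = coord x i + coord y i" "coord (x - y) i = coord x i - coord y i"
  "coord (s *\<^sub>R x) i = s * coord x i" "coord (- x) i = - coord x i" "coord 0 i = 0"
proof -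
  have "linear ((*v) (transpose Q))" by (rule matrix_vector_mul_linear)
  note l = linear_add[OF this] linear_diff[OF this] linear_cmul[OF this] linear_neg[OF this] linear_0[OF this]
  show "coord (x + y) i = coord x i + coord y i" "coord (x - y) i = coord x i - coord y i"
    "coord (s *\<^sub>R x) i = s * coord x i" "coord (- x) i = - coord x i" "coord 0 i = 0"
    by (simp_all add: coord_def l)
qed

lemma linear_spec: "linear (spec f)"
  by (rule linearI; rule coord_eqI) (simp_all add: algebra_simps)

lemma bounded_linear_spec: "bounded_linear (spec f)"
  using linear_spec linear_conv_bounded_linear by blast

lemmas spec_add = linear_add[OF linear_spec] and spec_scaleR = linear_cmul[OF linear_spec]

lemma spec_spec: "spec f (spec g x) = spec (\<lambda>i. f i * g i) x"
  by (rule coord_eqI) simp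

lemma spec_one: "spec (\<lambda>i. 1) x = x"
  by (rule coord_eqI) simp

lemma inner_spec: "spec f x \<bullet> y = x \<bullet> spec f y"
  by (simp add: inner_coord mult_ac)

lemma norm_spec_le:
  assumes "\<And>i. \<bar>f i\<bar> \<le> m"
  shows "norm (spec f x) \<le> m * norm x"
proof (rule power2_le_imp_le)
  have m: "0 \<le> m" using assms[of undefined] by linarith
  then show "0 \<le> m * norm x" by simp
  have "(f i * coord x i)\<^sup>2 \<le> m\<^sup>2 * (coord x i)\<^sup>2" for i
    unfolding power_mult_distrib using assms[of i] by (intro mult_right_mono) (auto intro!: power2_le_iff_abs_le[THEN iffD2] m)
  then show "(norm (spec f x))\<^sup>2 \<le> (m * norm x)\<^sup>2"
    by (simp add: norm_coord power_mult_distrib sum_distrib_left sum_mono)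
qed

lemma continuous_on_spec [continuous_intros]:
  assumes "\<And>i. continuous_on X (\<lambda>p. F p i)" "continuous_on X u"
  shows "continuous_on X (\<lambda>p. spec (F p) (u p))"
  unfolding spec_def coord_def
  by (intro matrix_vector_mult_linear_continuous_on[THEN continuous_on_compose2] continuous_intros assms
      linear_continuous_on_compose[OF _ matrix_vector_mul_linear]) auto

lemma measurable_spec [measurable]: "spec f \<in> borel_measurable borel"
  by (intro borel_measurable_continuous_onI continuous_intros)

lemma spec_matrix: "spec f x = (Q ** (\<chi> i j. if i = j then f i else 0) ** transpose Q) *v x"
proof -
  have "(\<chi> i. f i * coord x i) = (\<chi> i j. if i = j then f i else 0) *v (transpose Q *v x)"
    by (simp add: matrix_vector_mult_def coord_def vec_eq_iff if_distrib[of "\<lambda>u. u * _"] cong: if_cong)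
  then show ?thesis by (simp add: spec_def matrix_vector_mul_assoc matrix_mul_assoc)
qed

lemma det_spec:
  assumes "\<And>x. A *v x = spec f x"
  shows "det A = (\<Prod>i\<in>UNIV. f i)"
proof -
  have "A = Q ** (\<chi> i j. if i = j then f i else 0) ** transpose Q"
    using assms by (simp add: matrix_eq spec_matrix)
  moreover have "det (\<chi> i j. if i = j then f i else (0::real)) = (\<Prod>i\<in>UNIV. f i)"
    by (subst det_diagonal) simp_all
  moreover have "det Q * det Q = 1"
    using det_orthogonal_matrix[OF orth] by auto
  ultimately show ?thesis by (simp add: det_mul mult_ac)
qed

lemma matrix_inv_spec:
  assumes A: "\<And>x. A *v x = spec f x" and f: "\<And>i. f i \<noteq> 0"
  shows "matrix_inv A *v x = spec (\<lambda>i. 1 / f i) x"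
proof -
  have "invertible A"
    using det_spec[OF A] f by (simp add: invertible_det_nz)
  then have "A ** matrix_inv A = mat 1"
    unfolding invertible_def matrix_inv_def by (rule someI2_ex) auto
  then have "spec f (matrix_inv A *v x) = x"
    by (metis A matrix_vector_mul_assoc matrix_vector_mul_lid)
  then have "spec (\<lambda>i. 1 / f i) (spec f (matrix_inv A *v x)) = spec (\<lambda>i. 1 / f i) x" by simp
  then show ?thesis by (simp add: spec_spec f spec_one)
qed

text \<open>\<open>mat_sqrt\<close> is a definite description, so the root found in the frame must
  be shown unique among all positive definite roots, including those not known to be diagonal in
  \<open>Q\<close>. They are compared on the eigenvectors of \<open>D\<close>, which span the
  space.\<close>

lemma mat_sqrt_spec:
  assumes A: "\<And>x. A *v x = spec f x" and f: "\<And>i. 0 < f i"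
  shows "mat_sqrt A *v x = spec (\<lambda>i. sqrt (f i)) x"
proof -
  define D where "D = Q ** (\<chi> i j. if i = j then sqrt (f i) else 0) ** transpose Q"
  have D: "D *v x = spec (\<lambda>i. sqrt (f i)) x" for x by (simp add: D_def spec_matrix)
  have DD: "D *v (D *v x) = A *v x" for x
    using f by (simp add: D A spec_spec less_imp_le)
  have "sym_pos_def D"
    unfolding sym_pos_def_def
  proof (intro conjI allI impI)
    show "transpose D = D"
    proof -
      have "transpose (\<chi> i j. if i = j then sqrt (f i) else 0) = (\<chi> i j. if i = j then sqrt (f i) else 0)"
        by (simp add: transpose_def vec_eq_iff)
      then show ?thesis by (simp add: D_def matrix_transpose_mul matrix_mul_assoc)
    qed
    fix x :: "real^'n" assume "x \<noteq> 0"
    then obtain i where i: "coord x i \<noteq> 0" using coord_eqI[of x 0] by auto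
    have "0 < (\<Sum>i\<in>UNIV. sqrt (f i) * (coord x i)\<^sup>2)"
      by (rule sum_pos2[of _ i]) (use f i in \<open>auto simp: less_imp_le\<close>)
    then show "0 < x \<bullet> (D *v x)"
      unfolding D inner_coord by (simp add: power2_eq_square mult_ac)
  qed
  moreover have "D ** D = A"
    by (simp add: matrix_eq DD flip: matrix_vector_mul_assoc)
  moreover have "B = D" if B: "sym_pos_def B" "B ** B = A" for B
  proof -
    text \<open>On each eigenvector \<open>e\<close> of \<open>D\<close> the vector \<open>(B - D) e\<close> would be an eigenvector of the
      positive matrix \<open>B\<close> with negative eigenvalue.\<close>
    have eigv: "B *v e = D *v e" if e: "D *v e = d *\<^sub>R e" and d: "0 < d" for e d
    proof (rule ccontr)
      define w where "w = B *v e - D *v e"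
      assume "B *v e \<noteq> D *v e"
      then have w: "w \<noteq> 0" by (simp add: w_def)
      have "B *v (B *v e) = D *v (D *v e)"
        by (metis B(2) DD matrix_vector_mul_assoc)
      then have "B *v w = - d *\<^sub>R w"
        by (simp add: w_def e matrix_vector_mult_diff_distrib matrix_vector_mult_scaleR algebra_simps)
      then have "w \<bullet> (B *v w) \<le> 0" using d by simp
      moreover have "0 < w \<bullet> (B *v w)" using B(1) w by (simp add: sym_pos_def_def)
      ultimately show False by simp
    qed
    have eig: "B *v (Q *v axis i 1) = D *v (Q *v axis i 1)" for i
    proof -
      have "D *v (Q *v axis i 1) = sqrt (f i) *\<^sub>R (Q *v axis i 1)"
      proof -
        have "coord (Q *v axis i 1) j = (if j = i then 1 else 0)" for j
          by (simp add: coord_def Q_cancel axis_def)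
        then show ?thesis unfolding D by (intro coord_eqI) simp
      qed
      then show ?thesis using eigv f by simp
    qed
    have "B *v x = D *v x" for x
    proof -
      have "linear (\<lambda>y. B *v (Q *v y))" "linear (\<lambda>y. D *v (Q *v y))"
        by (simp_all add: matrix_vector_mul_assoc)
      then have "B *v (Q *v y) = D *v (Q *v y)" for y
        by (rule linear_eq_stdbasis[THEN fun_cong]) (use eig in \<open>auto simp: Basis_vec_def\<close>)
      from this[of "transpose Q *v x"] show ?thesis by (simp add: Q_cancel)
    qed
    then show "B = D" by (simp add: matrix_eq)
  qed
  ultimately have "mat_sqrt A = D"
    unfolding mat_sqrt_def by (intro the_equality conjI) (assumption | elim conjE)+
  then show ?thesis by (simp add: D)
qed

text \<open>\<open>spec r\<close> is a rotation, a diagonal scaling and a rotation; the rotations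
  preserve Lebesgue measure and the scaling contributes the factor. The \<open>r i\<close> may be
  negative, as the negative square root of \<open>a\<close> occurs later.\<close>

lemma lborel_spec:
  assumes r: "\<And>i. r i \<noteq> 0"
  shows "lborel = density (distr lborel borel (spec r)) (\<lambda>_. ennreal (\<Prod>i\<in>UNIV. \<bar>r i\<bar>))"
proof -
  have iso: "distr lborel borel ((*v) P) = lborel" if "orthogonal_matrix P" for P :: "real^'n^'n"
    using that by (intro distr_lborel_isometry orthogonal_transformation_norm)
      (auto simp: orthogonal_transformation_matrix)
  \<comment> \<open>The diagonal scaling in the shape asked for by
    \<open>lborel_affine_euclidean\<close>; the inner sum merely reads off \<open>r i\<close> at the
    axis vector \<open>j\<close>.\<close>
  define T where "T x = 0 + (\<Sum>j\<in>Basis. ((\<Sum>i\<in>UNIV. r i * j $ i) * (x \<bullet> j)) *\<^sub>R j)" for x :: "real^'n"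
  have ax: "(\<Sum>k\<in>UNIV. r k * axis i 1 $ k) = r i" for i
    by (simp add: axis_def if_distrib cong: if_cong)
  have B: "(Basis :: (real^'n) set) = range (\<lambda>i. axis i 1)" "inj (\<lambda>i. axis i (1::real) :: real^'n)"
    by (auto simp: Basis_vec_def inj_on_def axis_eq_axis)
  have T: "T x = (\<chi> i. r i * x $ i)" for x
    unfolding T_def B(1) by (subst sum.reindex[OF B(2)])
      (simp add: ax comp_def inner_axis, simp add: vec_eq_iff axis_def if_distrib cong: if_cong)
  have mT: "T \<in> borel_measurable borel"
    unfolding T_def by measurable
  have mQ: "(*v) P \<in> borel_measurable borel" for P :: "real^'n^'n"
    by (intro borel_measurable_continuous_onI linear_continuous_on matrix_vector_mul_bounded_linear)
  have "lborel = density (distr lborel borel T) (\<lambda>_. ennreal (\<Prod>j\<in>Basis. \<bar>\<Sum>i\<in>UNIV. r i * (j::real^'n) $ i\<bar>))"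
    unfolding T_def by (rule lborel_affine_euclidean) (use r in \<open>auto simp: B(1) ax\<close>)
  also have "(\<Prod>j\<in>Basis. \<bar>\<Sum>i\<in>UNIV. r i * (j::real^'n) $ i\<bar>) = (\<Prod>i\<in>UNIV. \<bar>r i\<bar>)"
    unfolding B(1) by (subst prod.reindex[OF B(2)]) (simp add: ax)
  finally have "distr lborel borel ((*v) Q)
      = distr (density (distr lborel borel T) (\<lambda>_. ennreal (\<Prod>i\<in>UNIV. \<bar>r i\<bar>))) borel ((*v) Q)" by simp
  then have "lborel = density (distr (distr lborel borel T) borel ((*v) Q)) (\<lambda>_. ennreal (\<Prod>i\<in>UNIV. \<bar>r i\<bar>))"
    using mQ by (simp add: iso[OF orth] density_distr)
  also have "distr lborel borel T = distr (distr lborel borel ((*v) (transpose Q))) borel T"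
    using orth by (simp add: iso orthogonal_matrix_transpose)
  also have "distr (distr (distr lborel borel ((*v) (transpose Q))) borel T) borel ((*v) Q) = distr lborel borel (spec r)"
  proof -
    have m: "(\<lambda>x. T (transpose Q *v x)) \<in> borel_measurable borel"
      using measurable_comp[OF mQ mT] by (simp add: comp_def)
    have "distr (distr lborel borel ((*v) (transpose Q))) borel T = distr lborel borel (\<lambda>x. T (transpose Q *v x))"
      by (subst distr_distr) (use mQ mT in \<open>auto simp: comp_def\<close>)
    also have "distr \<dots> borel ((*v) Q) = distr lborel borel (\<lambda>x. Q *v T (transpose Q *v x))"
      by (subst distr_distr) (use mQ m in \<open>auto simp: comp_def\<close>)
    also have "(\<lambda>x. Q *v T (transpose Q *v x)) = spec r"
      by (simp add: fun_eq_iff spec_def T coord_def)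
    finally show ?thesis .
  qed
  finally show ?thesis .
qed

lemma distr_density_spec:
  assumes r: "\<And>i. r i \<noteq> 0" and [measurable]: "f \<in> borel_measurable borel"
  shows "distr (density lborel f) borel (spec r)
    = density lborel (\<lambda>y. f (spec (\<lambda>i. 1 / r i) y) * ennreal (1 / (\<Prod>i\<in>UNIV. \<bar>r i\<bar>)))"
proof -
  let ?P = "\<Prod>i\<in>UNIV. \<bar>r i\<bar>"
  have P: "0 < ?P" using r by (intro prod_pos) auto
  have "density lborel (\<lambda>y. f (spec (\<lambda>i. 1 / r i) y) * ennreal (1 / ?P))
      = density (distr lborel borel (spec r)) (\<lambda>y. ennreal ?P * (f (spec (\<lambda>i. 1 / r i) y) * ennreal (1 / ?P)))"
    by (subst lborel_spec[OF r]) (simp add: density_density_eq)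
  also have "(\<lambda>y. ennreal ?P * (f (spec (\<lambda>i. 1 / r i) y) * ennreal (1 / ?P))) = (\<lambda>y. f (spec (\<lambda>i. 1 / r i) y))"
  proof
    fix y
    have "ennreal ?P * ennreal (1 / ?P) = ennreal (?P * (1 / ?P))"
      using P by (intro ennreal_mult[symmetric]) auto
    then have "ennreal ?P * ennreal (1 / ?P) = 1" using P r by simp
    then show "ennreal ?P * (f (spec (\<lambda>i. 1 / r i) y) * ennreal (1 / ?P)) = f (spec (\<lambda>i. 1 / r i) y)"
      by (metis mult.commute mult.left_commute mult_1)
  qed
  also have "density (distr lborel borel (spec r)) (\<lambda>y. f (spec (\<lambda>i. 1 / r i) y))
      = distr (density lborel (\<lambda>x. f (spec (\<lambda>i. 1 / r i) (spec r x)))) borel (spec r)"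
    by (subst density_distr) simp_all
  also have "(\<lambda>x. f (spec (\<lambda>i. 1 / r i) (spec r x))) = f"
    by (simp add: spec_spec r spec_one)
  finally show ?thesis ..
qed

end

lemma compact_coefficient_bound:
  fixes F :: "real \<Rightarrow> 'n::finite \<Rightarrow> real"
  assumes "\<And>i. continuous_on {0..1} (\<lambda>t. F t i)"
  shows "\<exists>m>0. \<forall>t\<in>{0..1}. \<forall>i. \<bar>F t i\<bar> \<le> m"
proof -
  have "\<exists>m. \<forall>t\<in>{0..1}. \<bar>F t i\<bar> \<le> m" for i
  proof -
    have "bounded ((\<lambda>t. F t i) ` {0..1})"
      using assms compact_continuous_image compact_imp_bounded by blast
    then show ?thesis by (auto simp: bounded_iff)
  qed
  then obtain m where m: "\<And>i t. t \<in> {0..1} \<Longrightarrow> \<bar>F t i\<bar> \<le> m i" by metis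
  have m0: "0 \<le> m i" for i using m[of 0 i] by (auto intro: order_trans[OF abs_ge_zero])
  have "m i \<le> sum m UNIV" for i by (rule member_le_sum) (use m0 in auto)
  then have "\<bar>F t i\<bar> \<le> sum m UNIV + 1" if "t \<in> {0..1}" for t i
    using m[OF that, of i] by (smt (verit))
  moreover have "0 < sum m UNIV + 1" using sum_nonneg[of UNIV m] m0 by (simp add: add_nonneg_pos)
  ultimately show ?thesis by blast
qed

section \<open>Regularity of the field\<close>

text \<open>The tail assumption in the common eigenbasis: \<open>a\<close> and \<open>c\<close> are
  the eigenvalues of \<open>A\<close> and \<open>C\<close>, \<open>g\<close> is the gradient of
  \<open>h\<close> and \<open>g'\<close> its Hessian as a linear map. The factors
  \<open>sqrt C\<close> and \<open>C\<close> in front of these derivatives have been divided out, at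
  the expense of the constant \<open>Kh\<close>.\<close>

locale gaussian_tail_model = orthonormal_frame Q for Q :: "real^'n^'n" +
  fixes a c :: "'n \<Rightarrow> real" and h :: "real^'n \<Rightarrow> real" and g :: "real^'n \<Rightarrow> real^'n"
    and g' :: "real^'n \<Rightarrow> real^'n \<Rightarrow> real^'n" and Kh :: real
  assumes a_pos: "0 < a i" and c_pos: "0 < c i"
    and deriv_h: "(h has_derivative (\<lambda>v. v \<bullet> g x)) (at x)"
    and deriv_g: "(g has_derivative g' x) (at x)"
    and cont_g': "continuous_on UNIV (\<lambda>(x, v). g' x v)"
    and Kh: "0 < Kh" and g_bound: "norm (g x) \<le> Kh" and g'_bound: "norm (g' x v) \<le> Kh * norm v"
begin

definition b where "b t i = t\<^sup>2 * a i + (1 - t\<^sup>2) * c i"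

text \<open>For \<open>h = 0\<close> data point and interpolant are jointly Gaussian; this is then
  the regression coefficient, covariance \<open>t * a i\<close> over variance
  \<open>b t i\<close>.\<close>

definition mean_coef where "mean_coef t i = t * a i / b t i"
text \<open>In the same Gaussian case, minus the conditional standard deviation of the data point;
  the sign is the one produced by the rotation \<open>rot\<close>.\<close>

definition dev_coef where "dev_coef t i = - sqrt (1 - t\<^sup>2) * sqrt (a i * c i / b t i)"
definition lin_coef where "lin_coef t i = t * (a i - c i) / b t i"
text \<open>A weighted harmonic mean of \<open>a i\<close> and \<open>c i\<close>: the inverse is
  \<open>(1 - t\<^sup>2) / a i + t\<^sup>2 / c i\<close>.\<close>

definition harm_coef where "harm_coef t i = a i * c i / b t i"

text \<open>The data point given that the interpolant equals \<open>y\<close>, in terms of an independent standard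
  Gaussian \<open>z\<close> and up to the weight \<open>exp \<circ> h\<close>.\<close>

definition posterior where "posterior t y z = spec (mean_coef t) y + spec (dev_coef t) z"

definition weight where "weight t y z = exp (h (posterior t y z))"
definition H where "H t y = (\<integral>z. weight t y z \<partial>std_gauss)"
definition N where "N t y = (\<integral>z. weight t y z *\<^sub>R g (posterior t y z) \<partial>std_gauss)"
definition H' where
  "H' t y v = (\<integral>z. weight t y z * (spec (mean_coef t) v \<bullet> g (posterior t y z)) \<partial>std_gauss)"
definition N' where
  "N' t y v = (\<integral>z. (weight t y z * (spec (mean_coef t) v \<bullet> g (posterior t y z))) *\<^sub>R g (posterior t y z)
     + weight t y z *\<^sub>R g' (posterior t y z) (spec (mean_coef t) v) \<partial>std_gauss)"
definition R where "R t y = N t y /\<^sub>R H t y"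
definition R' where "R' t y v = N' t y v /\<^sub>R H t y - (H' t y v / (H t y)\<^sup>2) *\<^sub>R N t y"
definition W where "W t y = spec (lin_coef t) y + spec (harm_coef t) (R t y)"
definition W' where "W' t y v = spec (lin_coef t) v + spec (harm_coef t) (R' t y v)"

lemma b_pos: "t \<in> {0..1} \<Longrightarrow> 0 < b t i"
proof -
  assume t: "t \<in> {0..1}"
  then have "t\<^sup>2 \<le> 1" by (simp add: power_le_one)
  then show ?thesis
    unfolding b_def using a_pos[of i] c_pos[of i] t
    by (cases "t = 0") (auto intro!: add_pos_nonneg)
qed

lemma b_nz: "t \<in> {0..1} \<Longrightarrow> b t i \<noteq> 0"
  using b_pos[of t i] by simp

lemma continuous_coefs:
  "continuous_on {0..1} (\<lambda>t. mean_coef t i)" "continuous_on {0..1} (\<lambda>t. dev_coef t i)"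
  "continuous_on {0..1} (\<lambda>t. lin_coef t i)" "continuous_on {0..1} (\<lambda>t. harm_coef t i)"
proof -
  have "continuous_on {0..1} (\<lambda>t. b t i)" unfolding b_def by (intro continuous_intros)
  note this[continuous_intros]
  show "continuous_on {0..1} (\<lambda>t. mean_coef t i)" "continuous_on {0..1} (\<lambda>t. dev_coef t i)"
    "continuous_on {0..1} (\<lambda>t. lin_coef t i)" "continuous_on {0..1} (\<lambda>t. harm_coef t i)"
    unfolding mean_coef_def dev_coef_def lin_coef_def harm_coef_def
    by (intro continuous_intros ballI b_nz; assumption)+
qed

lemmas continuous_coefs_fst [continuous_intros] =
  continuous_coefs[THEN continuous_on_compose2, OF continuous_on_fst[OF continuous_on_id]]

definition bound where
  "bound = (SOME m. 0 < m \<and> (\<forall>t\<in>{0..1}. \<forall>i. \<bar>mean_coef t i\<bar> \<le> m \<and> \<bar>dev_coef t i\<bar> \<le> m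
      \<and> \<bar>lin_coef t i\<bar> \<le> m \<and> \<bar>harm_coef t i\<bar> \<le> m))"

lemma bound_pos: "0 < bound"
  and coef_bounds: "t \<in> {0..1} \<Longrightarrow> \<bar>mean_coef t i\<bar> \<le> bound" "t \<in> {0..1} \<Longrightarrow> \<bar>dev_coef t i\<bar> \<le> bound"
    "t \<in> {0..1} \<Longrightarrow> \<bar>lin_coef t i\<bar> \<le> bound" "t \<in> {0..1} \<Longrightarrow> \<bar>harm_coef t i\<bar> \<le> bound"
proof -
  obtain m1 where m1: "0 < m1" "\<forall>t\<in>{0..1}. \<forall>i. \<bar>mean_coef t i\<bar> \<le> m1"
    using compact_coefficient_bound[where F = mean_coef, OF continuous_coefs(1)] by blast
  obtain m2 where m2: "0 < m2" "\<forall>t\<in>{0..1}. \<forall>i. \<bar>dev_coef t i\<bar> \<le> m2"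
    using compact_coefficient_bound[where F = dev_coef, OF continuous_coefs(2)] by blast
  obtain m3 where m3: "0 < m3" "\<forall>t\<in>{0..1}. \<forall>i. \<bar>lin_coef t i\<bar> \<le> m3"
    using compact_coefficient_bound[where F = lin_coef, OF continuous_coefs(3)] by blast
  obtain m4 where m4: "0 < m4" "\<forall>t\<in>{0..1}. \<forall>i. \<bar>harm_coef t i\<bar> \<le> m4"
    using compact_coefficient_bound[where F = harm_coef, OF continuous_coefs(4)] by blast
  have "\<exists>m. 0 < m \<and> (\<forall>t\<in>{0..1}. \<forall>i. \<bar>mean_coef t i\<bar> \<le> m \<and> \<bar>dev_coef t i\<bar> \<le> m
      \<and> \<bar>lin_coef t i\<bar> \<le> m \<and> \<bar>harm_coef t i\<bar> \<le> m)"
  proof (intro exI[of _ "m1 + m2 + m3 + m4"] conjI ballI allI)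
    fix t :: real and i assume "t \<in> {0..1}"
    then show "\<bar>mean_coef t i\<bar> \<le> m1 + m2 + m3 + m4" "\<bar>dev_coef t i\<bar> \<le> m1 + m2 + m3 + m4"
      "\<bar>lin_coef t i\<bar> \<le> m1 + m2 + m3 + m4" "\<bar>harm_coef t i\<bar> \<le> m1 + m2 + m3 + m4"
      using m1(2)[rule_format, of t i] m2(2)[rule_format, of t i] m3(2)[rule_format, of t i]
        m4(2)[rule_format, of t i] m1(1) m2(1) m3(1) m4(1) by linarith+
  qed (use m1(1) m2(1) m3(1) m4(1) in linarith)
  from someI_ex[OF this, folded bound_def]
  show "0 < bound" "t \<in> {0..1} \<Longrightarrow> \<bar>mean_coef t i\<bar> \<le> bound" "t \<in> {0..1} \<Longrightarrow> \<bar>dev_coef t i\<bar> \<le> bound"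
    "t \<in> {0..1} \<Longrightarrow> \<bar>lin_coef t i\<bar> \<le> bound" "t \<in> {0..1} \<Longrightarrow> \<bar>harm_coef t i\<bar> \<le> bound"
    by blast+
qed

lemma continuous_h: "continuous_on X h"
  using has_derivative_continuous[OF deriv_h] by (simp add: continuous_at_imp_continuous_on)

lemma continuous_g: "continuous_on X g"
  using has_derivative_continuous[OF deriv_g] by (simp add: continuous_at_imp_continuous_on)

lemmas continuous_h' [continuous_intros] = continuous_on_compose2[OF continuous_h[of UNIV] _ subset_UNIV]
lemmas continuous_g_comp [continuous_intros] = continuous_on_compose2[OF continuous_g[of UNIV] _ subset_UNIV]

lemma continuous_g'_comp [continuous_intros]:
  assumes "continuous_on X u" "continuous_on X v"
  shows "continuous_on X (\<lambda>p. g' (u p) (v p))"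
  using continuous_on_compose2[OF cont_g' continuous_on_Pair[OF assms] subset_UNIV] by simp

lemma h_growth: "\<bar>h x\<bar> \<le> \<bar>h 0\<bar> + Kh * norm x"
proof -
  have "norm (h x - h 0) \<le> Kh * norm (x - 0)"
  proof (rule differentiable_bound[OF convex_UNIV])
    show "onorm (\<lambda>v. v \<bullet> g y) \<le> Kh" for y
    proof (rule onorm_bound)
      show "norm (v \<bullet> g y) \<le> Kh * norm v" for v
        using Cauchy_Schwarz_ineq2[of v "g y"] mult_right_mono[OF g_bound[of y] norm_ge_zero[of v]]
        by (simp add: mult.commute)
    qed (use Kh in simp)
  qed (use deriv_h in auto)
  then show ?thesis by simp
qed

lemma posterior_bound: "t \<in> {0..1} \<Longrightarrow> norm (posterior t y z) \<le> bound * norm y + bound * norm z"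
  unfolding posterior_def
  by (rule norm_triangle_le) (intro add_mono norm_spec_le coef_bounds; simp)

text \<open>The part of the bound on the weight that depends on \<open>y\<close>; the part in
  \<open>z\<close> stays a fixed exponential, as the results on parameter integrals require.\<close>

definition env where "env y = exp (\<bar>h 0\<bar> + Kh * bound * norm y)"

lemma env_pos: "0 < env y" by (simp add: env_def)

lemma continuous_env [continuous_intros]: "continuous_on X u \<Longrightarrow> continuous_on X (\<lambda>p. env (u p))"
  unfolding env_def by (intro continuous_intros)

lemma weight_pos: "0 < weight t y z" by (simp add: weight_def)

lemma weight_bound: "t \<in> {0..1} \<Longrightarrow> weight t y z \<le> env y * exp (Kh * bound * norm z)"
proof -
  assume t: "t \<in> {0..1}"
  have "h (posterior t y z) \<le> \<bar>h 0\<bar> + Kh * norm (posterior t y z)"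
    using h_growth[of "posterior t y z"] by linarith
  also have "\<dots> \<le> \<bar>h 0\<bar> + Kh * (bound * norm y + bound * norm z)"
    using Kh posterior_bound[OF t] by (intro add_left_mono mult_left_mono) auto
  also have "\<dots> = \<bar>h 0\<bar> + Kh * bound * norm y + Kh * bound * norm z" by (simp add: algebra_simps)
  finally show ?thesis by (simp add: weight_def env_def flip: exp_add)
qed

lemma continuous_posterior [continuous_intros]:
  assumes "\<And>i. continuous_on X (\<lambda>p. mean_coef (\<tau> p) i)" "\<And>i. continuous_on X (\<lambda>p. dev_coef (\<tau> p) i)"
    "continuous_on X u" "continuous_on X w"
  shows "continuous_on X (\<lambda>p. posterior (\<tau> p) (u p) (w p))"
  unfolding posterior_def by (intro continuous_intros assms)

lemma measurable_model [measurable]: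
  "posterior t y \<in> borel_measurable borel" "weight t y \<in> borel_measurable borel"
  "g \<in> borel_measurable borel" "h \<in> borel_measurable borel"
  by (auto intro!: borel_measurable_continuous_onI continuous_intros continuous_g continuous_h
      simp: weight_def[abs_def] posterior_def[abs_def])

lemma measurable_g' [measurable]:
  "u \<in> borel_measurable borel \<Longrightarrow> (\<lambda>z. g' (u z) v) \<in> borel_measurable borel"
  by (rule measurable_compose[of u borel borel "\<lambda>x. g' x v"])
     (auto intro!: borel_measurable_continuous_onI continuous_intros)

lemma inner_bound:
  assumes "t \<in> {0..1}"
  shows "\<bar>spec (mean_coef t) v \<bullet> g x\<bar> \<le> Kh * bound * norm v"
proof -
  have "\<bar>spec (mean_coef t) v \<bullet> g x\<bar> \<le> (bound * norm v) * Kh"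
    by (rule order_trans[OF Cauchy_Schwarz_ineq2])
       (intro mult_mono norm_spec_le coef_bounds assms g_bound; use bound_pos in simp)
  then show ?thesis by (simp add: mult_ac)
qed

lemma g'_spec_bound:
  assumes "t \<in> {0..1}"
  shows "norm (g' x (spec (mean_coef t) v)) \<le> Kh * bound * norm v"
  using order_trans[OF g'_bound mult_left_mono[OF norm_spec_le[OF coef_bounds(1)[OF assms]]]] Kh
  by (simp add: mult.assoc)

definition Kw where "Kw = Kh * bound + Kh * bound * Kh"

lemma Kw_pos: "0 < Kw" using Kh bound_pos by (simp add: Kw_def add_pos_pos)

text \<open>Bounds by multiples of \<open>weight\<close> itself rather than of its exponential
  envelope: integration turns them into multiples of \<open>H\<close>, the denominator of
  \<open>R\<close>.\<close>

lemma integrand_bounds: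
  assumes t: "t \<in> {0..1}"
  shows "norm (weight t y z *\<^sub>R g (posterior t y z)) \<le> Kh * weight t y z"
    and "norm (weight t y z * (spec (mean_coef t) v \<bullet> g (posterior t y z))) \<le> Kh * bound * norm v * weight t y z"
    and "norm ((weight t y z * (spec (mean_coef t) v \<bullet> g (posterior t y z))) *\<^sub>R g (posterior t y z)
     + weight t y z *\<^sub>R g' (posterior t y z) (spec (mean_coef t) v)) \<le> Kw * norm v * weight t y z"
proof -
  let ?x = "posterior t y z" let ?w = "weight t y z"
  note w = less_imp_le[OF weight_pos[of t y z]]
  show "norm (?w *\<^sub>R g ?x) \<le> Kh * ?w"
    using mult_right_mono[OF g_bound[of ?x] w] w by (simp add: mult.commute)
  show 2: "norm (?w * (spec (mean_coef t) v \<bullet> g ?x)) \<le> Kh * bound * norm v * ?w"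
    using mult_right_mono[OF inner_bound[OF t, of v ?x] w] w by (simp add: abs_mult mult.commute)
  have "norm ((?w * (spec (mean_coef t) v \<bullet> g ?x)) *\<^sub>R g ?x) \<le> (Kh * bound * norm v * ?w) * Kh"
    unfolding norm_scaleR by (intro mult_mono g_bound) (use 2 w Kh bound_pos in auto)
  moreover have "norm (?w *\<^sub>R g' ?x (spec (mean_coef t) v)) \<le> ?w * (Kh * bound * norm v)"
    unfolding norm_scaleR using w g'_spec_bound[OF t] by (intro mult_mono) auto
  ultimately show "norm ((?w * (spec (mean_coef t) v \<bullet> g ?x)) *\<^sub>R g ?x + ?w *\<^sub>R g' ?x (spec (mean_coef t) v))
      \<le> Kw * norm v * ?w"
    by (intro norm_triangle_le) (simp add: Kw_def algebra_simps)
qed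

lemma integrable_weight: "t \<in> {0..1} \<Longrightarrow> integrable std_gauss (weight t y)"
  by (rule integrable_std_gauss_exp_bound[where K = "env y" and L = "Kh * bound"])
     (use weight_bound weight_pos in \<open>auto simp: less_imp_le\<close>)

lemma integrable_by_weight:
  fixes f :: "real^'n \<Rightarrow> 'x::{banach, second_countable_topology}"
  assumes "t \<in> {0..1}" "f \<in> borel_measurable borel" "\<And>z. norm (f z) \<le> k * weight t y z"
  shows "integrable std_gauss f"
  by (rule Bochner_Integration.integrable_bound[OF integrable_mult_right[OF integrable_weight[OF assms(1)], of k y]])
     (use assms in \<open>auto intro!: AE_I2 intro: order_trans[OF _ abs_ge_self]\<close>)

lemma norm_integral_le_H:
  fixes f :: "real^'n \<Rightarrow> 'x::{banach, second_countable_topology}"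
  assumes t: "t \<in> {0..1}" and f: "f \<in> borel_measurable borel" "\<And>z. norm (f z) \<le> k * weight t y z"
  shows "norm (\<integral>z. f z \<partial>std_gauss) \<le> k * H t y"
proof -
  have "norm (\<integral>z. f z \<partial>std_gauss) \<le> (\<integral>z. k * weight t y z \<partial>std_gauss)"
    by (rule order_trans[OF integral_norm_bound integral_mono])
       (use integrable_by_weight[OF t f] integrable_weight[OF t] f in auto)
  then show ?thesis by (simp add: H_def)
qed

lemma H_pos: "t \<in> {0..1} \<Longrightarrow> 0 < H t y"
proof -
  assume t: "t \<in> {0..1}"
  have "H t y \<noteq> 0"
  proof
    assume "H t y = 0"
    then have "AE z in std_gauss. weight t y z = 0"
      unfolding H_def using integrable_weight[OF t] weight_pos
      by (subst (asm) integral_nonneg_eq_0_iff_AE) (auto simp: less_imp_le)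
    then have "AE z in (std_gauss :: (real^'n) measure). False"
      by (rule AE_mp) (use weight_pos[of t y] in \<open>auto intro!: AE_I2 simp: less_le\<close>)
    then show False by simp
  qed
  moreover have "0 \<le> H t y"
    unfolding H_def using weight_pos by (intro integral_nonneg_AE AE_I2) (auto simp: less_imp_le)
  ultimately show ?thesis by simp
qed

lemma N_bound: "t \<in> {0..1} \<Longrightarrow> norm (N t y) \<le> Kh * H t y"
  unfolding N_def by (rule norm_integral_le_H) (use integrand_bounds in auto)

lemma H'_bound: "t \<in> {0..1} \<Longrightarrow> \<bar>H' t y v\<bar> \<le> Kh * bound * norm v * H t y"
  unfolding H'_def using norm_integral_le_H[where 'x = real, OF _ _ integrand_bounds(2)] by auto

lemma N'_bound: "t \<in> {0..1} \<Longrightarrow> norm (N' t y v) \<le> Kw * norm v * H t y"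
  unfolding N'_def by (rule norm_integral_le_H) (use integrand_bounds in auto)

lemma continuous_HN:
  "continuous_on ({0..1} \<times> UNIV) (\<lambda>(t, y). H t y)" "continuous_on ({0..1} \<times> UNIV) (\<lambda>(t, y). N t y)"
  "continuous_on ({0..1} \<times> UNIV \<times> UNIV) (\<lambda>(t, y, v). H' t y v)"
  "continuous_on ({0..1} \<times> UNIV \<times> UNIV) (\<lambda>(t, y, v). N' t y v)"
proof -
  have w: "k * weight t y z \<le> k * env y * exp (Kh * bound * norm z)" if "t \<in> {0..1}" "0 \<le> k" for t y z k
    using mult_left_mono[OF weight_bound[OF that(1)] that(2)] by (simp add: mult.assoc)
  \<comment> \<open>All four integrands share the dominating function
    \<open>exp (Kh * bound * norm z)\<close>; whatever depends on \<open>y\<close> and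
    \<open>v\<close> goes into the continuous envelope \<open>B\<close>.\<close>
  note rule = continuous_on_integral_dominated[OF _ _ _ _ integrable_exp_norm[of "Kh * bound"]]
  show "continuous_on ({0..1} \<times> UNIV) (\<lambda>(t, y). H t y)"
    unfolding H_def case_prod_unfold
    by (rule rule[where B = "\<lambda>p. env (snd p)"])
       (use weight_bound weight_pos in \<open>auto simp: weight_def less_imp_le intro!: continuous_intros\<close>)
  show "continuous_on ({0..1} \<times> UNIV) (\<lambda>(t, y). N t y)"
    unfolding N_def case_prod_unfold
    by (rule rule[where B = "\<lambda>p. Kh * env (snd p)"])
       (use Kh in \<open>auto simp: weight_def[abs_def] intro!: continuous_intros\<close>,
        use order_trans[OF integrand_bounds(1) w] Kh in \<open>auto simp: weight_def\<close>)
  show "continuous_on ({0..1} \<times> UNIV \<times> UNIV) (\<lambda>(t, y, v). H' t y v)"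
    unfolding H'_def case_prod_unfold
    by (rule rule[where B = "\<lambda>p. Kh * bound * norm (snd (snd p)) * env (fst (snd p))"])
       (use Kh in \<open>auto simp: weight_def[abs_def] intro!: continuous_intros\<close>,
        use order_trans[OF integrand_bounds(2) w] Kh bound_pos in \<open>auto simp: weight_def\<close>)
  show "continuous_on ({0..1} \<times> UNIV \<times> UNIV) (\<lambda>(t, y, v). N' t y v)"
    unfolding N'_def case_prod_unfold
    by (rule rule[where B = "\<lambda>p. Kw * norm (snd (snd p)) * env (fst (snd p))"])
       (use Kh in \<open>auto simp: weight_def[abs_def] intro!: continuous_intros\<close>,
        use order_trans[OF integrand_bounds(3) w] Kw_pos in \<open>auto simp: weight_def\<close>)
qed

end

text \<open>Difference quotients along short multiples of \<open>v\<close> are bounded by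
  \<open>L * norm v\<close> and converge to \<open>D v\<close>. In \<open>transport\<close> this
  bounds the gradient of a test function composed with the flow through Lipschitz constants
  alone.\<close>

lemma has_derivative_lipschitz_bound:
  fixes f :: "'a::real_normed_vector \<Rightarrow> 'b::real_normed_vector"
  assumes D: "(f has_derivative D) (at x)" and L: "\<And>y. norm (f y - f x) \<le> L * norm (y - x)"
  shows "norm (D v) \<le> L * norm v"
proof (cases "v = 0")
  case True
  then show ?thesis using linear_0[OF has_derivative_linear[OF D]] by simp
next
  case False
  show ?thesis
  proof (rule field_le_epsilon)
    fix e :: real assume "0 < e"
    then have e: "0 < e / norm v" using False by simp
    then obtain d where d: "d > 0" "\<And>y. norm (y - x) < d \<Longrightarrow> norm (f y - f x - D (y - x)) \<le> e / norm v * norm (y - x)"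
      using D unfolding has_derivative_at_alt by meson
    define s where "s = d / (2 * norm v)"
    have s: "0 < s" using d(1) False by (simp add: s_def)
    have sv: "norm (s *\<^sub>R v) = s * norm v" using s by simp
    have "s * norm v < d" using d(1) False by (simp add: s_def)
    then have "norm (f (x + s *\<^sub>R v) - f x - D (s *\<^sub>R v)) \<le> e / norm v * (s * norm v)"
      using d(2)[of "x + s *\<^sub>R v"] by (simp only: add_diff_cancel_left' sv)
    then have 1: "norm (f (x + s *\<^sub>R v) - f x - D (s *\<^sub>R v)) \<le> s * e"
      using False by (simp add: mult.commute)
    have "norm (D (s *\<^sub>R v)) \<le> norm (f (x + s *\<^sub>R v) - f x) + norm (f (x + s *\<^sub>R v) - f x - D (s *\<^sub>R v))"
      using norm_triangle_ineq4[of "f (x + s *\<^sub>R v) - f x" "f (x + s *\<^sub>R v) - f x - D (s *\<^sub>R v)"] by simp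
    also have "\<dots> \<le> L * (s * norm v) + s * e"
      using L[of "x + s *\<^sub>R v"] 1 by (intro add_mono) (simp_all only: add_diff_cancel_left' sv)
    also have "D (s *\<^sub>R v) = s *\<^sub>R D v" using linear_cmul[OF has_derivative_linear[OF D]] .
    finally have "s * norm (D v) \<le> s * (L * norm v + e)" using s by (simp add: algebra_simps)
    then show "norm (D v) \<le> L * norm v + e" using s by simp
  qed
qed

section \<open>Varying the starting time of the flow\<close>

context lipschitz_field
begin

text \<open>The difference of two trajectories has speed at most
  \<open>L * growth * norm (x - y)\<close>. Over a short time the flow map thus differs from the
  identity by a map whose Lipschitz constant is of order \<open>\<bar>t - s\<bar>\<close>.\<close>

lemma flow_displacement:
  assumes s: "s \<in> {0..1}" and t: "t \<in> {0..1}"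
  shows "norm ((flow V s x t - flow V s y t) - (x - y)) \<le> L * growth * norm (x - y) * \<bar>t - s\<bar>"
proof -
  define d where "d r = flow V s x r - flow V s y r" for r
  have "norm (d t - d s) \<le> L * growth * norm (x - y) * norm (t - s)"
  proof (rule differentiable_bound[of "{0..1}"])
    fix r :: real assume r: "r \<in> {0..1}"
    show "(d has_derivative (\<lambda>k. k *\<^sub>R (V r (flow V s x r) - V r (flow V s y r)))) (at r within {0..1})"
      unfolding d_def has_vector_derivative_def[symmetric]
      by (intro derivative_intros solutionD flow_solution s r)
    show "onorm (\<lambda>k. k *\<^sub>R (V r (flow V s x r) - V r (flow V s y r))) \<le> L * growth * norm (x - y)"
    proof (rule onorm_bound)
      fix k :: real
      have "norm (V r (flow V s x r) - V r (flow V s y r)) \<le> L * norm (flow V s x r - flow V s y r)"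
        by (rule lip[OF r])
      also have "\<dots> \<le> L * (growth * norm (x - y))"
        using L_pos by (intro mult_left_mono flow_lipschitz s r) auto
      finally have "norm (V r (flow V s x r) - V r (flow V s y r)) * \<bar>k\<bar> \<le> L * (growth * norm (x - y)) * \<bar>k\<bar>"
        by (rule mult_right_mono) simp
      then show "norm (k *\<^sub>R (V r (flow V s x r) - V r (flow V s y r))) \<le> L * growth * norm (x - y) * norm k"
        by (simp add: mult_ac)
    qed (use L_pos growth_pos in simp)
  qed (use s t in auto)
  then show ?thesis using s by (simp add: d_def)
qed

lemma flow_derivative_at:
  assumes "0 < t" "t < 1" "s \<in> {0..1}"
  shows "(flow V s x has_vector_derivative V t (flow V s x t)) (at t)"
  using solutionD[OF flow_solution[OF assms(3)], of t x] assms at_within_01[of t] by simp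

text \<open>Compare \<open>x\<close> with the trajectory \<open>\<phi>\<close> that meets it at time
  \<open>t\<close>. Flowing \<open>\<phi> s\<close> to time \<open>t\<close> always gives
  \<open>x t\<close>, so flowing \<open>x s\<close> gives \<open>x t + (x s - \<phi> s)\<close> up
  to an error of order \<open>norm (x s - \<phi> s) * \<bar>s - t\<bar>\<close>, which is negligible
  to first order. The derivative is therefore the mismatch between the speed of the curve and the
  field.\<close>

lemma flow_back_derivative:
  assumes t: "0 < t" "t < 1" and x: "(x has_vector_derivative x') (at t)"
  shows "((\<lambda>s. flow V s (x s) t) has_vector_derivative (x' - V t (x t))) (at t)"
proof -
  have t01: "t \<in> {0..1}" using t by simp
  define \<phi> where "\<phi> = flow V t (x t)"
  define d where "d s = x s - \<phi> s" for s
  define e where "e s = flow V s (x s) t - x t - d s" for s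
  have \<phi>t: "\<phi> t = x t" using t01 by (simp add: \<phi>_def)
  have dd: "(d has_vector_derivative (x' - V t (x t))) (at t)"
    unfolding d_def using x flow_derivative_at[OF t t01, of "x t"] \<phi>t
    by (auto intro!: derivative_eq_intros simp: \<phi>_def)
  have e_bound: "norm (e s) \<le> L * growth * norm (d s) * \<bar>s - t\<bar>" if s: "s \<in> {0..1}" for s
  proof -
    have "flow V s (\<phi> s) t = x t"
      using flow_flow[OF t01 s t01, of "x t"] t01 by (simp add: \<phi>_def)
    then show ?thesis
      using flow_displacement[OF s t01, of "x s" "\<phi> s"] by (simp add: e_def d_def abs_minus_commute algebra_simps)
  qed
  have e0: "e t = 0" using t01 by (simp add: e_def d_def \<phi>t)
  have d0: "(d \<longlongrightarrow> 0) (at t)"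
  proof -
    have "continuous (at t) d" using dd has_vector_derivative_continuous by blast
    then show ?thesis by (simp add: continuous_at d_def \<phi>t)
  qed
  have "(e has_vector_derivative 0) (at t)"
    unfolding has_vector_derivative_def has_derivative_at_within
  proof (intro conjI)
    have "((\<lambda>s. L * growth * norm (d s)) \<longlongrightarrow> 0) (at t)"
      by (rule tendsto_eq_intros d0 | simp)+
    moreover have "\<forall>\<^sub>F s in at t. norm (e s) / norm (s - t) \<le> L * growth * norm (d s)"
    proof -
      have "\<forall>\<^sub>F s in at t. s \<in> {0<..<1}"
        using t by (intro eventually_at_in_open') auto
      then show ?thesis
      proof (eventually_elim)
        case (elim s)
        then show ?case
          using e_bound[of s] L_pos growth_pos by (cases "s = t") (auto simp: divide_le_eq)
      qed
    qed
    ultimately have "((\<lambda>s. norm (e s) / norm (s - t)) \<longlongrightarrow> 0) (at t)"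
      by (intro Lim_null_comparison[of "\<lambda>s. norm (e s) / norm (s - t)"]) (auto elim: eventually_mono)
    then show "((\<lambda>s. (e s - e t - (s - t) *\<^sub>R 0) /\<^sub>R norm (s - t)) \<longlongrightarrow> 0) (at t)"
      by (subst tendsto_norm_zero_iff[symmetric]) (simp add: e0 divide_inverse mult.commute)
  qed simp
  from has_vector_derivative_add[OF this dd] show ?thesis
    by (simp add: e_def) (simp add: has_vector_derivative_diff_const)
qed

text \<open>The same comparison, with Lipschitz dependence in place of the displacement estimate. It
  asks only for continuity of \<open>x\<close> and so covers the end points, where the interpolant
  may fail to be differentiable.\<close>

lemma continuous_flow_start:
  assumes x: "continuous_on {0..1} x" and r: "r \<in> {0..1}"
  shows "continuous_on {0..1} (\<lambda>t. flow V t (x t) r)"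
  unfolding continuous_on_def
proof
  fix s :: real assume s: "s \<in> {0..1}"
  define \<phi> where "\<phi> = flow V s (x s)"
  have "continuous_on {0..1} \<phi>" unfolding \<phi>_def by (rule solution_continuous[OF flow_solution[OF s]])
  then have "continuous_on {0..1} (\<lambda>t. growth * norm (x t - \<phi> t))" by (intro continuous_intros x)
  then have lim: "((\<lambda>t. growth * norm (x t - \<phi> t)) \<longlongrightarrow> 0) (at s within {0..1})"
    using s unfolding continuous_on_def by (fastforce simp: \<phi>_def)
  have "\<forall>\<^sub>F t in at s within {0..1}. norm (flow V t (x t) r - flow V s (x s) r) \<le> growth * norm (x t - \<phi> t)"
    unfolding eventually_at_filter
  proof (intro always_eventually allI impI)
    fix t assume t: "t \<in> {0..1::real}"
    have "flow V s (x s) r = flow V t (\<phi> t) r" using flow_flow[OF s t r] by (simp add: \<phi>_def)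
    then show "norm (flow V t (x t) r - flow V s (x s) r) \<le> growth * norm (x t - \<phi> t)"
      using flow_lipschitz[OF t r] by simp
  qed
  from Lim_null_comparison[OF this lim]
  show "((\<lambda>t. flow V t (x t) r) \<longlongrightarrow> flow V s (x s) r) (at s within {0..1})"
    by (simp add: LIM_zero_iff)
qed

end

section \<open>Derivative and Lipschitz bound of the field\<close>

context gaussian_tail_model
begin

lemma deriv_posterior: "((\<lambda>y. posterior t y z) has_derivative spec (mean_coef t)) (at y)"
  unfolding posterior_def
  using has_derivative_add[OF bounded_linear_imp_has_derivative[OF bounded_linear_spec] has_derivative_const]
  by simp

lemma deriv_posterior_noise: "((\<lambda>z. posterior t y z) has_derivative spec (dev_coef t)) (at z)"
  unfolding posterior_def
  using has_derivative_add[OF has_derivative_const bounded_linear_imp_has_derivative[OF bounded_linear_spec]]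
  by simp

lemma deriv_weight:
  "((\<lambda>y. weight t y z) has_derivative (\<lambda>v. weight t y z * (spec (mean_coef t) v \<bullet> g (posterior t y z)))) (at y)"
  unfolding weight_def
  using has_derivative_exp[OF has_derivative_compose[OF deriv_posterior[of t z y] deriv_h]]
  by (simp add: mult.commute)

lemma deriv_weight_noise:
  "((\<lambda>z. weight t y z) has_derivative (\<lambda>v. weight t y z * (spec (dev_coef t) v \<bullet> g (posterior t y z)))) (at z)"
  unfolding weight_def
  using has_derivative_exp[OF has_derivative_compose[OF deriv_posterior_noise[of t y z] deriv_h]]
  by (simp add: mult.commute)

text \<open>One bound for all \<open>y\<close> in a unit ball: the uniformity demanded for
  differentiating under the integral.\<close>

lemma weight_bound_ball:
  assumes t: "t \<in> {0..1}" and y: "y \<in> ball y0 1" and k: "0 \<le> k"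
  shows "k * norm v * weight t y z \<le> k * exp (\<bar>h 0\<bar> + Kh * bound * (norm y0 + 1)) * exp (Kh * bound * norm z) * norm v"
proof -
  have "norm y \<le> norm y0 + 1"
    using y norm_triangle_ineq2[of y y0] by (simp add: dist_norm norm_minus_commute)
  then have "Kh * bound * norm y \<le> Kh * bound * (norm y0 + 1)"
    using Kh bound_pos by (intro mult_left_mono) auto
  then have "env y \<le> exp (\<bar>h 0\<bar> + Kh * bound * (norm y0 + 1))"
    by (simp add: env_def)
  then have "weight t y z \<le> exp (\<bar>h 0\<bar> + Kh * bound * (norm y0 + 1)) * exp (Kh * bound * norm z)"
    using weight_bound[OF t, of y z] mult_right_mono[of "env y" _ "exp (Kh * bound * norm z)"]
    by (meson exp_ge_zero order_trans)
  then show ?thesis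
    using k by (simp add: mult_left_mono mult_ac)
qed

lemma deriv_H: "t \<in> {0..1} \<Longrightarrow> (H t has_derivative H' t y) (at y)"
  and deriv_N: "t \<in> {0..1} \<Longrightarrow> (N t has_derivative N' t y) (at y)"
proof -
  assume t: "t \<in> {0..1}"
  let ?e = "exp (\<bar>h 0\<bar> + Kh * bound * (norm y + 1))"
  note rule = has_derivative_integral_dominated(2)[where r = 1, OF zero_less_one]
  show "(H t has_derivative H' t y) (at y)"
    unfolding H_def[abs_def] H'_def[abs_def]
  proof (rule rule[OF deriv_weight])
    show "norm (weight t y' z * (spec (mean_coef t) v \<bullet> g (posterior t y' z)))
        \<le> (Kh * bound * ?e * exp (Kh * bound * norm z)) * norm v" if "y' \<in> ball y 1" for y' z v
      using order_trans[OF integrand_bounds(2)[OF t] weight_bound_ball[OF t that]] Kh bound_pos by simp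
    show "integrable std_gauss (\<lambda>z::real^'n. Kh * bound * ?e * exp (Kh * bound * norm z))"
      by (intro integrable_mult_right integrable_exp_norm)
  qed (use integrable_weight[OF t] Kh bound_pos in auto)
  have "((\<lambda>y. weight t y z *\<^sub>R g (posterior t y z)) has_derivative
      (\<lambda>v. (weight t y z * (spec (mean_coef t) v \<bullet> g (posterior t y z))) *\<^sub>R g (posterior t y z)
     + weight t y z *\<^sub>R g' (posterior t y z) (spec (mean_coef t) v))) (at y)" for y z
    using has_derivative_scaleR[OF deriv_weight[of t z y] has_derivative_compose[OF deriv_posterior[of t z y] deriv_g]]
    by (simp add: add.commute)
  note d = this
  show "(N t has_derivative N' t y) (at y)"
    unfolding N_def[abs_def] N'_def[abs_def]
  proof (rule rule[OF d])
    show "norm ((weight t y' z * (spec (mean_coef t) v \<bullet> g (posterior t y' z))) *\<^sub>R g (posterior t y' z)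
     + weight t y' z *\<^sub>R g' (posterior t y' z) (spec (mean_coef t) v))
        \<le> (Kw * ?e * exp (Kh * bound * norm z)) * norm v" if "y' \<in> ball y 1" for y' z v
      using order_trans[OF integrand_bounds(3)[OF t] weight_bound_ball[OF t that]] Kw_pos by simp
    show "integrable std_gauss (\<lambda>z::real^'n. Kw * ?e * exp (Kh * bound * norm z))"
      by (intro integrable_mult_right integrable_exp_norm)
    show "integrable std_gauss (\<lambda>z. weight t y' z *\<^sub>R g (posterior t y' z))" for y'
      by (rule integrable_by_weight[OF t _ integrand_bounds(1)[OF t]]) measurable
  qed (use Kw_pos in auto)
qed

lemma deriv_R: "t \<in> {0..1} \<Longrightarrow> (R t has_derivative R' t y) (at y)"
proof -
  assume t: "t \<in> {0..1}"
  have nz: "H t y \<noteq> 0" using H_pos[OF t, of y] by simp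
  have "((\<lambda>y. inverse (H t y) *\<^sub>R N t y) has_derivative
      (\<lambda>v. inverse (H t y) *\<^sub>R N' t y v + (- (inverse (H t y) * H' t y v * inverse (H t y))) *\<^sub>R N t y)) (at y)"
    by (rule has_derivative_scaleR[OF Deriv.has_derivative_inverse[OF nz deriv_H[OF t]] deriv_N[OF t]])
  moreover have "R' t y = (\<lambda>v. inverse (H t y) *\<^sub>R N' t y v
      + (- (inverse (H t y) * H' t y v * inverse (H t y))) *\<^sub>R N t y)"
  proof
    fix v
    have "H' t y v / (H t y)\<^sup>2 = inverse (H t y) * H' t y v * inverse (H t y)"
      by (simp add: power2_eq_square divide_inverse)
    then show "R' t y v = inverse (H t y) *\<^sub>R N' t y v
      + (- (inverse (H t y) * H' t y v * inverse (H t y))) *\<^sub>R N t y"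
      by (simp only: R'_def scaleR_minus_left) simp
  qed
  ultimately show ?thesis by (simp only: R_def[abs_def])
qed

lemma deriv_W: "t \<in> {0..1} \<Longrightarrow> (W t has_derivative W' t y) (at y)"
  unfolding W_def[abs_def] W'_def[abs_def]
  by (rule has_derivative_add[OF bounded_linear_imp_has_derivative[OF bounded_linear_spec]
      bounded_linear.has_derivative[OF bounded_linear_spec deriv_R]])

lemma R_bound: "t \<in> {0..1} \<Longrightarrow> norm (R t y) \<le> Kh"
  using N_bound[of t y] H_pos[of t y] by (simp add: R_def field_simps)

text \<open>Under the probability law proportional to \<open>weight\<close>, \<open>R'\<close> is
  the mean of the Hessian term plus the covariance of
  \<open>spec (mean_coef t) v \<bullet> g\<close> with \<open>g\<close>. The two parts of the
  covariance are bounded separately, each by \<open>Kh * bound * Kh\<close>; one of these is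
  contained in \<open>Kw\<close>.\<close>

lemma R'_bound: "t \<in> {0..1} \<Longrightarrow> norm (R' t y v) \<le> (Kw + Kh * bound * Kh) * norm v"
proof -
  assume t: "t \<in> {0..1}"
  have H: "0 < H t y" by (rule H_pos[OF t])
  have 1: "norm (N' t y v /\<^sub>R H t y) \<le> Kw * norm v"
    using N'_bound[OF t, of y v] H by (simp add: field_simps)
  have "(H' t y v / (H t y)\<^sup>2) *\<^sub>R N t y = (H' t y v / H t y) *\<^sub>R R t y"
    using H by (simp add: R_def power2_eq_square divide_inverse mult_ac)
  moreover have "\<bar>H' t y v / H t y\<bar> \<le> Kh * bound * norm v"
    using H'_bound[OF t, of y v] H by (simp add: field_simps)
  ultimately have 2: "norm ((H' t y v / (H t y)\<^sup>2) *\<^sub>R N t y) \<le> (Kh * bound * norm v) * Kh"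
    using mult_mono[OF _ R_bound[OF t, of y], of "\<bar>H' t y v / H t y\<bar>" "Kh * bound * norm v"] Kh bound_pos
    by (simp only: norm_scaleR) simp
  show ?thesis
    unfolding R'_def by (rule order_trans[OF norm_triangle_ineq4]) (use 1 2 in \<open>simp add: algebra_simps\<close>)
qed

definition LW where "LW = bound + bound * (Kw + Kh * bound * Kh)"

lemma W'_bound: "t \<in> {0..1} \<Longrightarrow> norm (W' t y v) \<le> LW * norm v"
proof -
  assume t: "t \<in> {0..1}"
  have "norm (W' t y v) \<le> bound * norm v + bound * norm (R' t y v)"
    unfolding W'_def by (intro norm_triangle_le add_mono norm_spec_le coef_bounds t)
  also have "\<dots> \<le> bound * norm v + bound * ((Kw + Kh * bound * Kh) * norm v)"
    using bound_pos by (intro add_left_mono mult_left_mono R'_bound t) auto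
  finally show ?thesis by (simp add: LW_def algebra_simps)
qed

lemma W_bound: "t \<in> {0..1} \<Longrightarrow> norm (W t y) \<le> bound * norm y + bound * Kh"
proof -
  assume t: "t \<in> {0..1}"
  have "norm (W t y) \<le> bound * norm y + bound * norm (R t y)"
    unfolding W_def by (intro norm_triangle_le add_mono norm_spec_le coef_bounds t)
  then show ?thesis
    using mult_left_mono[OF R_bound[OF t, of y], of bound] bound_pos by linarith
qed

sublocale field: differentiable_field W LW W'
proof
  have HN: "continuous_on X (\<lambda>p. H (\<tau> p) (u p))" "continuous_on X (\<lambda>p. N (\<tau> p) (u p))"
    if "continuous_on X \<tau>" "continuous_on X u" "\<tau> ` X \<subseteq> {0..1}" for X :: "'p::topological_space set" and \<tau> u
    using continuous_on_compose2[OF continuous_HN(1) continuous_on_Pair[OF that(1,2)]]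
      continuous_on_compose2[OF continuous_HN(2) continuous_on_Pair[OF that(1,2)]] that(3) by auto
  have HN': "continuous_on X (\<lambda>p. H' (\<tau> p) (u p) (v p))" "continuous_on X (\<lambda>p. N' (\<tau> p) (u p) (v p))"
    if "continuous_on X \<tau>" "continuous_on X u" "continuous_on X v" "\<tau> ` X \<subseteq> {0..1}"
      for X :: "'p::topological_space set" and \<tau> u v
    using continuous_on_compose2[OF continuous_HN(3) continuous_on_Pair[OF that(1) continuous_on_Pair[OF that(2,3)]]]
      continuous_on_compose2[OF continuous_HN(4) continuous_on_Pair[OF that(1) continuous_on_Pair[OF that(2,3)]]] that(4)
    by auto
  have nz: "H t y \<noteq> 0" if "t \<in> {0..1}" for t y using H_pos[OF that, of y] by simp
  show "continuous_on ({0..1} \<times> UNIV) (\<lambda>(t, x). W t x)"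
    unfolding W_def R_def case_prod_unfold
    by (intro continuous_intros HN) (use nz in auto)
  show "continuous_on ({0..1} \<times> UNIV \<times> UNIV) (\<lambda>(t, x, w). W' t x w)"
    unfolding W'_def R'_def case_prod_unfold
    by (intro continuous_intros HN HN') (use nz in auto)
  show "0 < LW" using bound_pos Kw_pos Kh by (simp add: LW_def add_pos_pos)
qed (use deriv_W W'_bound in auto)

text \<open>Stein's identity for the weight in each direction \<open>e\<close>; differentiating in
  the noise brings out \<open>dev_coef\<close> and the gradient of \<open>h\<close>. It serves
  twice: for the value of the field at \<open>t = 0\<close> and for averaging the noise in
  \<open>velocity_mismatch_vanishes\<close>.\<close>

lemma stein_weight:
  assumes t: "t \<in> {0..1}"
  shows "integrable std_gauss (\<lambda>z. weight t y z *\<^sub>R z)"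
    and "(\<integral>z. weight t y z *\<^sub>R z \<partial>std_gauss) = spec (dev_coef t) (N t y)"
proof -
  \<comment> \<open>\<open>stein_identity\<close> asks for one constant for the function and its
    derivative: the summand 1 serves the weight, \<open>bound * Kh\<close> its derivative.\<close>
  let ?K = "env y * (1 + bound * Kh)" and ?L = "Kh * bound"
  have K: "env y \<le> ?K" using env_pos[of y] bound_pos Kh by (simp add: mult_le_cancel_left1)
  have b1: "\<bar>weight t y z\<bar> \<le> ?K * exp (?L * norm z)" for z
    using order_trans[OF weight_bound[OF t] mult_right_mono[OF K]] weight_pos[of t y z] by simp
  have b2: "\<bar>weight t y z * (spec (dev_coef t) v \<bullet> g (posterior t y z))\<bar> \<le> ?K * exp (?L * norm z) * norm v" for z v
  proof -
    have "\<bar>spec (dev_coef t) v \<bullet> g (posterior t y z)\<bar> \<le> (bound * norm v) * Kh"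
      by (rule order_trans[OF Cauchy_Schwarz_ineq2])
         (intro mult_mono norm_spec_le coef_bounds t g_bound; use bound_pos in simp)
    then have "\<bar>weight t y z * (spec (dev_coef t) v \<bullet> g (posterior t y z))\<bar>
        \<le> (env y * exp (?L * norm z)) * ((bound * norm v) * Kh)"
      unfolding abs_mult using weight_bound[OF t, of y z] weight_pos[of t y z] env_pos[of y]
      by (intro mult_mono) auto
    also have "\<dots> = env y * (bound * Kh) * exp (?L * norm z) * norm v" by (simp add: mult_ac)
    also have "\<dots> \<le> ?K * exp (?L * norm z) * norm v"
      using env_pos[of y] by (intro mult_right_mono mult_left_mono) auto
    finally show ?thesis .
  qed
  have L: "0 \<le> ?L" using Kh bound_pos by simp
  note S = stein_identity[OF deriv_weight_noise b1 b2 L]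
  show i: "integrable std_gauss (\<lambda>z. weight t y z *\<^sub>R z)"
  proof (rule integrable_std_gauss_exp_bound[where K = "env y" and L = "?L + 1"])
    fix z
    have "norm (weight t y z *\<^sub>R z) \<le> (env y * exp (?L * norm z)) * exp (norm z)"
      unfolding norm_scaleR using weight_bound[OF t, of y z] weight_pos[of t y z] env_pos[of y]
        exp_ge_add_one_self[of "norm z"]
      by (intro mult_mono) (auto intro: order_trans[of _ "1 + norm z"])
    then show "norm (weight t y z *\<^sub>R z) \<le> env y * exp ((?L + 1) * norm z)"
      by (simp add: ring_distribs exp_add mult_ac)
  qed measurable
  have gN: "integrable std_gauss (\<lambda>z. weight t y z *\<^sub>R g (posterior t y z))"
    by (rule integrable_by_weight[OF t _ integrand_bounds(1)[OF t]]) measurable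
  have "(\<integral>z. weight t y z *\<^sub>R z \<partial>std_gauss) \<bullet> e = spec (dev_coef t) (N t y) \<bullet> e" for e
  proof -
    have "(\<integral>z. weight t y z *\<^sub>R z \<partial>std_gauss) \<bullet> e = (\<integral>z. weight t y z * (z \<bullet> e) \<partial>std_gauss)"
      using integral_inner_left[of e std_gauss "\<lambda>z. weight t y z *\<^sub>R z"] i by simp
    also have "\<dots> = (\<integral>z. (weight t y z *\<^sub>R g (posterior t y z)) \<bullet> spec (dev_coef t) e \<partial>std_gauss)"
      using S(3)[of e] by (simp add: inner_commute)
    also have "\<dots> = N t y \<bullet> spec (dev_coef t) e"
      unfolding N_def by (rule integral_inner_left[OF gN])
    finally show ?thesis by (simp add: inner_spec)
  qed
  then show "(\<integral>z. weight t y z *\<^sub>R z \<partial>std_gauss) = spec (dev_coef t) (N t y)"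
    using vector_eq_rdot by blast
qed

end

section \<open>Transport along the flow\<close>

lemma measure_std_gauss_UNIV [simp]: "measure std_gauss (UNIV :: 'a::euclidean_space set) = 1"
  using std_gauss.prob_space[where 'a='a] by simp

context gaussian_tail_model
begin

abbreviation "root_a \<equiv> (\<lambda>i. sqrt (a i))"
abbreviation "root_c \<equiv> (\<lambda>i. sqrt (c i))"
abbreviation "root_b t \<equiv> (\<lambda>i. sqrt (b t i))"

text \<open>\<open>sqrt (b t i)\<close> is the hypotenuse over the legs
  \<open>t * sqrt (a i)\<close> and \<open>sqrt (1 - t\<^sup>2) * sqrt (c i)\<close>; every
  eigendirection has its own rotation angle.\<close>

definition cos_coef where "cos_coef t i = t * sqrt (a i) / sqrt (b t i)"
definition sin_coef where "sin_coef t i = sqrt (1 - t\<^sup>2) * sqrt (c i) / sqrt (b t i)"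

definition interp :: "real \<Rightarrow> (real^'n) \<times> (real^'n) \<Rightarrow> real^'n" where
  "interp t p = t *\<^sub>R spec root_a (fst p) + sqrt (1 - t\<^sup>2) *\<^sub>R spec root_c (snd p)"

text \<open>The time derivative of \<open>interp\<close>. Its noise part is singular at
  \<open>t = 1\<close>, so it is used inside the open interval.\<close>

definition interp' :: "real \<Rightarrow> (real^'n) \<times> (real^'n) \<Rightarrow> real^'n" where
  "interp' t p = spec root_a (fst p) - (t / sqrt (1 - t\<^sup>2)) *\<^sub>R spec root_c (snd p)"

text \<open>In the rotated coordinates the interpolant depends on the first component only.\<close>

definition rot :: "real \<Rightarrow> (real^'n) \<times> (real^'n) \<Rightarrow> (real^'n) \<times> (real^'n)" where
  "rot t p = (spec (cos_coef t) (fst p) - spec (sin_coef t) (snd p),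
    spec (sin_coef t) (fst p) + spec (cos_coef t) (snd p))"

definition data_weight :: "(real^'n) \<times> (real^'n) \<Rightarrow> real" where
  "data_weight p = exp (h (spec root_a (fst p)))"

lemma one_minus_sq: "t \<in> {0..1} \<Longrightarrow> 0 \<le> 1 - (t::real)\<^sup>2" "0 < t \<Longrightarrow> t < 1 \<Longrightarrow> 0 < 1 - (t::real)\<^sup>2"
  by (simp_all add: power_le_one power_less_one_iff)

lemma cos_sin: "t \<in> {0..1} \<Longrightarrow> (cos_coef t i)\<^sup>2 + (sin_coef t i)\<^sup>2 = 1"
proof -
  assume t: "t \<in> {0..1}"
  have "(cos_coef t i)\<^sup>2 + (sin_coef t i)\<^sup>2 = (t\<^sup>2 * a i + (1 - t\<^sup>2) * c i) / b t i"
    using b_pos[OF t, of i] a_pos[of i] c_pos[of i] one_minus_sq(1)[OF t]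
    by (simp add: cos_coef_def sin_coef_def power_mult_distrib power_divide add_divide_distrib)
  then show ?thesis using b_pos[OF t, of i] by (simp add: b_def)
qed

lemma linear_rot: "linear (rot t)"
  by (rule linearI) (simp_all add: rot_def spec_add spec_scaleR algebra_simps)

lemma norm_rot: "t \<in> {0..1} \<Longrightarrow> norm (rot t p) = norm p"
proof -
  assume t: "t \<in> {0..1}"
  have "(cos_coef t i * x - sin_coef t i * y)\<^sup>2 + (sin_coef t i * x + cos_coef t i * y)\<^sup>2 = x\<^sup>2 + y\<^sup>2" for i x y
  proof -
    have "(cos_coef t i * x - sin_coef t i * y)\<^sup>2 + (sin_coef t i * x + cos_coef t i * y)\<^sup>2
        = ((cos_coef t i)\<^sup>2 + (sin_coef t i)\<^sup>2) * (x\<^sup>2 + y\<^sup>2)"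
      by (simp add: power2_eq_square algebra_simps)
    then show ?thesis by (simp add: cos_sin[OF t])
  qed
  then have "(norm (fst (rot t p)))\<^sup>2 + (norm (snd (rot t p)))\<^sup>2 = (norm (fst p))\<^sup>2 + (norm (snd p))\<^sup>2"
    by (simp add: norm_coord rot_def flip: sum.distrib)
  then show ?thesis by (simp add: norm_prod_def)
qed

lemma distr_rot: "t \<in> {0..1} \<Longrightarrow> distr std_gauss borel (rot t) = std_gauss"
  by (rule distr_std_gauss_isometry[OF linear_rot norm_rot])

lemma measurable_rot [measurable]: "rot t \<in> borel_measurable borel"
  using linear_rot linear_continuous_on linear_conv_bounded_linear by (intro borel_measurable_continuous_onI) blast

text \<open>Here \<open>p\<close> is the rotated pair and \<open>rot t p\<close> the original one,
  so the left side is the data point and \<open>spec (root_b t) (fst p)\<close> the interpolant. The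
  minus sign in \<open>rot\<close> becomes the sign of \<open>dev_coef\<close>.\<close>

lemma rot_posterior:
  assumes t: "t \<in> {0..1}"
  shows "spec root_a (fst (rot t p)) = posterior t (spec (root_b t) (fst p)) (snd p)"
proof (rule coord_eqI)
  fix i
  have "sqrt (a i) * cos_coef t i = mean_coef t i * sqrt (b t i)"
    using b_pos[OF t, of i] a_pos[of i]
    by (simp add: cos_coef_def mean_coef_def field_simps flip: power2_eq_square)
  moreover have "sqrt (a i) * sin_coef t i = - dev_coef t i"
    by (simp add: sin_coef_def dev_coef_def real_sqrt_mult real_sqrt_divide)
  ultimately show "coord (spec root_a (fst (rot t p))) i = coord (posterior t (spec (root_b t) (fst p)) (snd p)) i"
    by (simp add: rot_def posterior_def right_diff_distrib flip: mult.assoc)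
qed

lemma rot_interp:
  assumes t: "t \<in> {0..1}"
  shows "interp t (rot t p) = spec (root_b t) (fst p)"
proof (rule coord_eqI)
  fix i
  have b: "0 < b t i" by (rule b_pos[OF t])
  have 1: "t * sqrt (a i) = sqrt (b t i) * cos_coef t i" "sqrt (1 - t\<^sup>2) * sqrt (c i) = sqrt (b t i) * sin_coef t i"
    using b by (simp_all add: cos_coef_def sin_coef_def)
  have "coord (interp t (rot t p)) i
      = (t * sqrt (a i)) * coord (fst (rot t p)) i + (sqrt (1 - t\<^sup>2) * sqrt (c i)) * coord (snd (rot t p)) i"
    by (simp add: interp_def)
  also have "\<dots> = sqrt (b t i) * (((cos_coef t i)\<^sup>2 + (sin_coef t i)\<^sup>2) * coord (fst p) i)"
    unfolding 1 by (simp add: rot_def power2_eq_square algebra_simps)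
  finally show "coord (interp t (rot t p)) i = coord (spec (root_b t) (fst p)) i"
    by (simp add: cos_sin[OF t])
qed

text \<open>Its product with \<open>dev_coef\<close> is minus \<open>harm_coef\<close>: the singular
  factor \<open>1 / sqrt (1 - t\<^sup>2)\<close> disappears as soon as Stein's identity is
  applied.\<close>

definition noise_coef where "noise_coef t i = sqrt (a i * c i / b t i) / sqrt (1 - t\<^sup>2)"

lemma rot_interp':
  assumes t: "0 < t" "t < 1"
  shows "interp' t (rot t p) = spec (lin_coef t) (spec (root_b t) (fst p)) - spec (noise_coef t) (snd p)"
proof (rule coord_eqI)
  fix i
  have t01: "t \<in> {0..1}" using t by simp
  define A B S x y T where "A = sqrt (a i)" and "B = sqrt (b t i)" and "S = sqrt (c i)"
    and "x = coord (fst p) i" and "y = coord (snd p) i" and "T = sqrt (1 - t\<^sup>2)"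
  have pos: "0 < A" "0 < B" "0 < S" "0 < T"
    using a_pos[of i] b_pos[OF t01, of i] c_pos[of i] one_minus_sq(2)[OF t] by (simp_all add: A_def B_def S_def T_def)
  have sq: "a i = A * A" "b t i = B * B" "c i = S * S" "1 - t\<^sup>2 = T * T"
    using a_pos[of i] b_pos[OF t01, of i] c_pos[of i] one_minus_sq(2)[OF t] by (simp_all add: A_def B_def S_def T_def)
  have T2: "T * T = 1 - t * t" using sq(4) by (simp add: power2_eq_square)
  have "coord (interp' t (rot t p)) i
      = A * (t * A / B * x - T * S / B * y) - (t / T) * (S * (T * S / B * x + t * A / B * y))"
    by (simp add: interp'_def rot_def cos_coef_def sin_coef_def A_def B_def S_def x_def y_def T_def)
  \<comment> \<open>\<open>T * T + t * t\<close> is 1, so both contributions to the coefficient of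
    \<open>y\<close> combine to \<open>A * S / B / T\<close>.\<close>
  also have "\<dots> = t * (A * A - S * S) / (B * B) * (B * x) - (T * T + t * t) * (A * S / B / T * y)"
    using pos by (simp add: field_simps)
  also have "\<dots> = coord (spec (lin_coef t) (spec (root_b t) (fst p)) - spec (noise_coef t) (snd p)) i"
    using pos by (simp add: lin_coef_def noise_coef_def x_def y_def real_sqrt_mult real_sqrt_divide T2 sq(1-3))
      (simp add: A_def B_def S_def T_def)
  finally show "coord (interp' t (rot t p)) i
      = coord (spec (lin_coef t) (spec (root_b t) (fst p)) - spec (noise_coef t) (snd p)) i" .
qed

lemma interp_derivative:
  assumes t: "0 < t" "t < 1"
  shows "((\<lambda>t. interp t p) has_vector_derivative interp' t p) (at t)"
proof -
  have "((\<lambda>t. sqrt (1 - t\<^sup>2)) has_real_derivative - t / sqrt (1 - t\<^sup>2)) (at t)"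
    using one_minus_sq(2)[OF t] by (auto intro!: derivative_eq_intros simp: field_simps)
  from has_vector_derivative_add[OF has_vector_derivative_scaleR[OF DERIV_ident has_vector_derivative_const]
      has_vector_derivative_scaleR[OF this has_vector_derivative_const]]
  show ?thesis
    unfolding interp_def interp'_def by simp
qed

lemma continuous_interp: "continuous_on X (\<lambda>t. interp t p)" "continuous_on Y (interp t)"
  unfolding interp_def by (intro continuous_intros)+

definition root_bound where "root_bound = (\<Sum>i\<in>UNIV. sqrt (a i)) + (\<Sum>i\<in>UNIV. sqrt (c i))"

lemma root_bound: "0 \<le> root_bound" "norm (spec root_a x) \<le> root_bound * norm x" "norm (spec root_c x) \<le> root_bound * norm x"
proof -
  have nn: "0 \<le> sqrt (a i)" "0 \<le> sqrt (c i)" for i using a_pos[of i] c_pos[of i] by simp_all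
  have "sqrt (a i) \<le> (\<Sum>i\<in>UNIV. sqrt (a i))" "sqrt (c i) \<le> (\<Sum>i\<in>UNIV. sqrt (c i))" for i
    using nn by (auto intro: member_le_sum)
  moreover have s: "0 \<le> (\<Sum>i\<in>UNIV. sqrt (a i))" "0 \<le> (\<Sum>i\<in>UNIV. sqrt (c i))"
    using nn by (auto intro: sum_nonneg)
  ultimately have "\<bar>sqrt (a i)\<bar> \<le> root_bound" "\<bar>sqrt (c i)\<bar> \<le> root_bound" for i
    unfolding root_bound_def using nn[of i] by (smt (verit))+
  then show "norm (spec root_a x) \<le> root_bound * norm x" "norm (spec root_c x) \<le> root_bound * norm x"
    by (auto intro: norm_spec_le)
  show "0 \<le> root_bound" using s by (simp add: root_bound_def)
qed

lemma norm_fst_snd: "norm (fst p) \<le> norm p" "norm (snd p) \<le> norm p"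
  by (metis norm_fst_le norm_snd_le prod.collapse)+

lemma root_bound_pair: "norm (spec root_a (fst p)) \<le> root_bound * norm p" "norm (spec root_c (snd p)) \<le> root_bound * norm p"
  by (rule order_trans[OF root_bound(2) mult_left_mono[OF norm_fst_snd(1) root_bound(1)]])
     (rule order_trans[OF root_bound(3) mult_left_mono[OF norm_fst_snd(2) root_bound(1)]])

lemma interp_bound: "t \<in> {0..1} \<Longrightarrow> norm (interp t p) \<le> 2 * root_bound * norm p"
proof -
  assume t: "t \<in> {0..1}"
  have "norm (t *\<^sub>R spec root_a (fst p)) \<le> 1 * (root_bound * norm p)"
    unfolding norm_scaleR using t by (intro mult_mono root_bound_pair) auto
  moreover have "norm (sqrt (1 - t\<^sup>2) *\<^sub>R spec root_c (snd p)) \<le> 1 * (root_bound * norm p)"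
    unfolding norm_scaleR using one_minus_sq(1)[OF t] by (intro mult_mono root_bound_pair) auto
  ultimately show ?thesis unfolding interp_def by (intro norm_triangle_le) simp
qed

lemma data_weight_pos: "0 < data_weight p" by (simp add: data_weight_def)

lemma data_weight_bound: "data_weight p \<le> exp \<bar>h 0\<bar> * exp (Kh * root_bound * norm p)"
proof -
  have "h (spec root_a (fst p)) \<le> \<bar>h 0\<bar> + Kh * norm (spec root_a (fst p))"
    using h_growth[of "spec root_a (fst p)"] by linarith
  also have "\<dots> \<le> \<bar>h 0\<bar> + Kh * (root_bound * norm p)"
    using Kh by (intro add_left_mono mult_left_mono root_bound_pair) auto
  finally show ?thesis by (simp add: data_weight_def mult.assoc flip: exp_add)
qed

lemma continuous_data_weight: "continuous_on X data_weight"
  unfolding data_weight_def by (intro continuous_intros)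

lemma data_weight_rot:
  "t \<in> {0..1} \<Longrightarrow> data_weight (rot t p) = weight t (spec (root_b t) (fst p)) (snd p)"
  by (simp add: data_weight_def weight_def rot_posterior)

text \<open>For fixed first component Stein's identity averages the noise part of the velocity of the
  interpolant to the harmonic part of the field.\<close>

lemma velocity_mismatch_vanishes:
  assumes t: "0 < t" "t < 1" and D: "\<And>x. linear (D x)"
    and int: "integrable std_gauss (\<lambda>p. data_weight p * D (interp t p) (interp' t p - W t (interp t p)))"
  shows "(\<integral>p. data_weight p * D (interp t p) (interp' t p - W t (interp t p)) \<partial>std_gauss) = (0::real)"
proof -
  have t01: "t \<in> {0..1}" using t by simp
  \<comment> \<open>In rotated coordinates the \<open>lin_coef\<close> parts of
    \<open>interp'\<close> and \<open>W\<close> cancel; the noise and the harmonic part are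
    left.\<close>
  define G where "G x z = weight t (spec (root_b t) x) z *
      D (spec (root_b t) x) (- spec (noise_coef t) z - spec (harm_coef t) (R t (spec (root_b t) x)))" for x z
  have G: "data_weight (rot t p) * D (interp t (rot t p)) (interp' t (rot t p) - W t (interp t (rot t p)))
      = G (fst p) (snd p)" for p
    by (simp add: G_def data_weight_rot[OF t01] rot_interp[OF t01] rot_interp'[OF t] W_def algebra_simps)
  have "integrable (distr std_gauss borel (rot t)) (\<lambda>p. data_weight p * D (interp t p) (interp' t p - W t (interp t p)))"
    using int by (simp add: distr_rot[OF t01])
  then have intG: "integrable (std_gauss :: ((real^'n) \<times> (real^'n)) measure) (\<lambda>p. G (fst p) (snd p))"
    using borel_measurable_integrable[OF int] by (subst (asm) integrable_distr_eq) (auto simp: G)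
  have "(\<integral>p. data_weight p * D (interp t p) (interp' t p - W t (interp t p)) \<partial>std_gauss)
      = (\<integral>p. data_weight p * D (interp t p) (interp' t p - W t (interp t p)) \<partial>distr std_gauss borel (rot t))"
    by (simp add: distr_rot[OF t01])
  also have "\<dots> = (\<integral>p. G (fst p) (snd p) \<partial>(std_gauss :: ((real^'n) \<times> (real^'n)) measure))"
    using borel_measurable_integrable[OF int] by (subst integral_distr) (auto simp: G)
  also have "\<dots> = (\<integral>x. \<integral>z. G x z \<partial>std_gauss \<partial>std_gauss)"
  proof -
    interpret pair_sigma_finite "std_gauss :: (real^'n) measure" "std_gauss :: (real^'n) measure" ..
    have "integrable (std_gauss \<Otimes>\<^sub>M std_gauss) (\<lambda>(x, z). G x z)"
      using intG by (simp add: std_gauss_pair case_prod_unfold)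
    from integral_fst[OF this] show ?thesis by (simp add: std_gauss_pair case_prod_unfold)
  qed
  also have "\<dots> = integral\<^sup>L (std_gauss :: (real^'n) measure) (\<lambda>x. 0)"
  proof (rule Bochner_Integration.integral_cong[OF refl])
    fix x :: "real^'n"
    define y where "y = spec (root_b t) x"
    have bl: "bounded_linear (D y)" using D linear_conv_bounded_linear by blast
    have "(\<integral>z. G x z \<partial>std_gauss) = (\<integral>z. D y (spec (\<lambda>i. - noise_coef t i) (weight t y z *\<^sub>R z)
        - weight t y z *\<^sub>R spec (harm_coef t) (R t y)) \<partial>std_gauss)"
    proof (rule Bochner_Integration.integral_cong[OF refl])
      fix z
      have "spec (\<lambda>i. - noise_coef t i) z = - spec (noise_coef t) z" by (rule coord_eqI) simp
      then have "spec (\<lambda>i. - noise_coef t i) (weight t y z *\<^sub>R z) - weight t y z *\<^sub>R spec (harm_coef t) (R t y)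
          = weight t y z *\<^sub>R (- spec (noise_coef t) z - spec (harm_coef t) (R t y))"
        by (simp add: spec_scaleR algebra_simps)
      then show "G x z = D y (spec (\<lambda>i. - noise_coef t i) (weight t y z *\<^sub>R z) - weight t y z *\<^sub>R spec (harm_coef t) (R t y))"
        by (simp add: G_def y_def linear_cmul[OF D])
    qed
    \<comment> \<open>The interpolant \<open>y\<close> depends on the first component only, so the
      linear map \<open>D y\<close> is constant for the inner integral and can be taken out.\<close>
    also have "\<dots> = D y (\<integral>z. spec (\<lambda>i. - noise_coef t i) (weight t y z *\<^sub>R z)
        - weight t y z *\<^sub>R spec (harm_coef t) (R t y) \<partial>std_gauss)"
      by (rule integral_bounded_linear[OF bl])
         (intro Bochner_Integration.integrable_diff integrable_bounded_linear[OF bounded_linear_spec] stein_weight(1)[OF t01]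
           integrable_scaleR_left integrable_weight[OF t01])
    also have "(\<integral>z. spec (\<lambda>i. - noise_coef t i) (weight t y z *\<^sub>R z)
        - weight t y z *\<^sub>R spec (harm_coef t) (R t y) \<partial>std_gauss)
        = spec (\<lambda>i. - noise_coef t i) (spec (dev_coef t) (N t y)) - H t y *\<^sub>R spec (harm_coef t) (R t y)"
      using stein_weight[OF t01, of y] integrable_weight[OF t01, of y]
      by (simp add: integral_bounded_linear[OF bounded_linear_spec] integrable_bounded_linear[OF bounded_linear_spec] H_def)
    also have "\<dots> = 0"
    proof (rule coord_eqI)
      fix i
      have "noise_coef t i * dev_coef t i = - harm_coef t i"
        using one_minus_sq(2)[OF t] a_pos[of i] c_pos[of i] b_pos[OF t01, of i]
        by (simp add: noise_coef_def dev_coef_def harm_coef_def)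
      then show "coord (spec (\<lambda>i. - noise_coef t i) (spec (dev_coef t) (N t y)) - H t y *\<^sub>R spec (harm_coef t) (R t y)) i = coord 0 i"
        using H_pos[OF t01, of y] by (simp add: R_def flip: mult.assoc)
    qed
    finally show "(\<integral>z. G x z \<partial>std_gauss) = 0" using linear_0[OF D] by simp
  qed
  finally show ?thesis by simp
qed

text \<open>The Lipschitz bound on \<open>f\<close> gives \<open>F t\<close> a gradient bounded
  uniformly in \<open>t\<close>, which makes the time derivative of \<open>E\<close> dominated by an
  exponential. The first factor on the right is the mass that \<open>data_weight\<close> leaves
  unnormalized.\<close>

lemma transport:
  assumes f: "\<And>x. f differentiable (at x)" "\<And>x. \<bar>f x\<bar> \<le> 1" "\<And>x y. \<bar>f x - f y\<bar> \<le> Lf * norm (x - y)"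
  shows "(\<integral>x. exp (h (spec root_a x)) * f (spec root_a x) \<partial>std_gauss)
    = (\<integral>x. exp (h (spec root_a x)) \<partial>std_gauss) * (\<integral>z. f (flow W 0 (spec root_c z) 1) \<partial>std_gauss)"
proof -
  define F where "F t x = f (flow W t x 1)" for t x
  define E where "E t p = data_weight p * F t (interp t p)" for t p
  define D where "D t x = frechet_derivative (F t) (at x)" for t x
  \<comment> \<open>The axis vector has norm 1, so the Lipschitz inequality between it and 0 shows
    that \<open>Lf\<close> is nonnegative.\<close>
  have Lf: "0 \<le> Lf" using order_trans[OF abs_ge_zero f(3)[of "axis undefined 1" 0]] by simp
  define LF where "LF = Lf * field.growth"
  have LF: "0 \<le> LF" using Lf field.growth_pos by (simp add: LF_def)
  have one: "(1::real) \<in> {0..1}" and zero: "(0::real) \<in> {0..1}" by simp_all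
  have F1: "\<bar>F t x\<bar> \<le> 1" for t x by (simp add: F_def f)
  have F_lip: "\<bar>F t x - F t y\<bar> \<le> LF * norm (x - y)" if "t \<in> {0..1}" for t x y
    unfolding F_def using order_trans[OF f(3) mult_left_mono[OF field.flow_lipschitz[OF that one] Lf]]
    by (simp add: LF_def mult.assoc)
  have dF: "(F t has_derivative D t x) (at x)" if t: "t \<in> {0..1}" for t x
    unfolding D_def frechet_derivative_works[symmetric] F_def
    using differentiable_chain_at[OF field.flow_differentiable[OF t one] f(1)] by (simp add: comp_def)
  have D_bound: "\<bar>D t x v\<bar> \<le> LF * norm v" if "t \<in> {0..1}" for t x v
    using has_derivative_lipschitz_bound[OF dF[OF that], where L = LF] F_lip[OF that] by auto
  have contF: "continuous_on X (F t)" if "t \<in> {0..1}" for X t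
    using has_derivative_continuous[OF dF[OF that]] by (simp add: continuous_at_imp_continuous_on)
  have mE: "E t \<in> borel_measurable borel" if "t \<in> {0..1}" for t
    unfolding E_def
    by (intro borel_measurable_continuous_onI continuous_intros continuous_data_weight
        continuous_on_compose2[OF contF[OF that, of UNIV] continuous_interp(2)]) auto
  have E_bound: "norm (E t p) \<le> exp \<bar>h 0\<bar> * exp (Kh * root_bound * norm p)" for t p
    using mult_mono[OF data_weight_bound F1[of t "interp t p"]] data_weight_pos[of p]
    by (simp add: E_def abs_mult)
  have intE: "integrable std_gauss (E t)" if "t \<in> {0..1}" for t
    by (rule integrable_std_gauss_exp_bound[OF _ E_bound]) (use mE[OF that] in simp)
  define u where "u t = (\<integral>p. E t p \<partial>std_gauss)" for t
  \<comment> \<open>Continuity matters at 0 and 1, where \<open>u\<close> is not differentiated; the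
    bound on \<open>E\<close> does not involve \<open>t\<close>.\<close>
  have contu: "continuous_on {0..1} u"
    unfolding u_def
  proof (rule continuous_on_integral_dominated[where B = "\<lambda>_. exp \<bar>h 0\<bar>", OF _ _ _ _ integrable_exp_norm[of "Kh * root_bound"]])
    fix p
    have "continuous_on {0..1} (\<lambda>t. flow W t (interp t p) 1)"
      by (rule field.continuous_flow_start[OF continuous_interp(1) one])
    moreover have "continuous_on UNIV f" using f(1) by (simp add: continuous_at_imp_continuous_on differentiable_imp_continuous_within)
    ultimately have "continuous_on {0..1} (\<lambda>t. F t (interp t p))"
      unfolding F_def using continuous_on_compose2[OF _ _ subset_UNIV] by blast
    then show "continuous_on {0..1} (\<lambda>t. E t p)" unfolding E_def by (intro continuous_intros)
  qed (use E_bound mE in auto)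
  have du: "(u has_real_derivative 0) (at t)" if t: "0 < t" "t < 1" for t
  proof -
    \<comment> \<open>Half the distance to the end points keeps \<open>s\<close> away from 1, where
      the speed of the interpolant is singular.\<close>
    define r where "r = min t (1 - t) / 2"
    have r: "0 < r" using t by (simp add: r_def)
    have ball: "0 < s" "s < 1" "s \<le> t + r" "t + r < 1" if "s \<in> ball t r" for s
    proof -
      have "r \<le> t / 2" "r \<le> (1 - t) / 2" by (auto simp: r_def)
      moreover have "t - s < r" "s - t < r" using that by (auto simp: dist_real_def abs_less_iff)
      ultimately show "0 < s" "s < 1" "s \<le> t + r" "t + r < 1" using t by (simp_all add: field_simps)
    qed
    define k where "k = 1 / sqrt (1 - (t + r)\<^sup>2)"
    have k: "s / sqrt (1 - s\<^sup>2) \<le> k" "0 \<le> s / sqrt (1 - s\<^sup>2)" if "s \<in> ball t r" for s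
    proof -
      note s = ball[OF that]
      have "s\<^sup>2 \<le> (t + r)\<^sup>2" using s by (intro power_mono) auto
      moreover have "0 < 1 - (t + r)\<^sup>2" using one_minus_sq(2)[of "t + r"] t r s by simp
      ultimately have "sqrt (1 - (t + r)\<^sup>2) \<le> sqrt (1 - s\<^sup>2)" "0 < sqrt (1 - (t + r)\<^sup>2)" by simp_all
      then show "s / sqrt (1 - s\<^sup>2) \<le> k" unfolding k_def using s by (intro frac_le) auto
      show "0 \<le> s / sqrt (1 - s\<^sup>2)" using s one_minus_sq(2)[OF s(1,2)] by simp
    qed
    define E' where "E' s p v = v * (data_weight p * D s (interp s p) (interp' s p - W s (interp s p)))" for s p v
    \<comment> \<open>The summands bound the growth of \<open>interp'\<close>, the growth of
      \<open>W\<close> along the interpolant, and the constant part of \<open>W\<close>.\<close>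
    define K where "K = root_bound * (1 + k) + 2 * bound * root_bound + bound * Kh"
    have k0: "0 \<le> k" using order_trans[OF k(2)[of t] k(1)[of t]] r by simp
    have K: "0 \<le> K" using root_bound(1) k0 bound_pos Kh by (simp add: K_def)
    have E'_bound: "norm (E' s p v)
        \<le> (LF * K * exp \<bar>h 0\<bar> * exp ((Kh * root_bound + 1) * norm p)) * norm v" if s: "s \<in> ball t r" for s p v
    proof -
      have s01: "s \<in> {0..1}" using ball[OF s] by simp
      have "norm (interp' s p) \<le> root_bound * norm p + k * (root_bound * norm p)"
        unfolding interp'_def
      proof (rule order_trans[OF norm_triangle_ineq4], intro add_mono root_bound_pair)
        show "norm ((s / sqrt (1 - s\<^sup>2)) *\<^sub>R spec root_c (snd p)) \<le> k * (root_bound * norm p)"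
          unfolding norm_scaleR using k[OF s] k0 by (intro mult_mono root_bound_pair) auto
      qed
      moreover have "norm (W s (interp s p)) \<le> bound * (2 * root_bound * norm p) + bound * Kh"
        using W_bound[OF s01, of "interp s p"] mult_left_mono[OF interp_bound[OF s01, of p], of bound] bound_pos by linarith
      ultimately have "norm (interp' s p - W s (interp s p))
          \<le> (root_bound * (1 + k) + 2 * bound * root_bound) * norm p + bound * Kh"
        using norm_triangle_ineq4[of "interp' s p" "W s (interp s p)"] by (simp add: algebra_simps)
      also have "\<dots> \<le> K * (1 + norm p)"
        using root_bound(1) k0 bound_pos Kh by (simp add: K_def algebra_simps)
      also have "\<dots> \<le> K * exp (norm p)" using K by (intro mult_left_mono) auto
      finally have "\<bar>D s (interp s p) (interp' s p - W s (interp s p))\<bar> \<le> LF * (K * exp (norm p))"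
        using D_bound[OF s01] LF by (meson mult_left_mono order_trans)
      then have "data_weight p * \<bar>D s (interp s p) (interp' s p - W s (interp s p))\<bar>
          \<le> (exp \<bar>h 0\<bar> * exp (Kh * root_bound * norm p)) * (LF * (K * exp (norm p)))"
        using data_weight_bound[of p] data_weight_pos[of p] by (intro mult_mono) auto
      also have "\<dots> = LF * K * exp \<bar>h 0\<bar> * exp ((Kh * root_bound + 1) * norm p)"
        by (simp add: ring_distribs exp_add mult_ac)
      finally show ?thesis
        using data_weight_pos[of p] by (simp add: E'_def abs_mult mult.commute[of "\<bar>v\<bar>"] mult_right_mono)
    qed
    have dE: "((\<lambda>s. E s p) has_derivative E' s p) (at s)" if s: "s \<in> ball t r" for s p
    proof -
      note s' = ball[OF s]
      have s01: "s \<in> {0..1}" using s' by simp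
      \<comment> \<open>With \<open>s\<close> fixed, \<open>F q\<close> at the interpolant equals
        \<open>F s\<close> at the interpolant carried by the flow from \<open>q\<close> to
        \<open>s\<close>. Only the inner curve moves with \<open>q\<close>, so the chain rule for
        the fixed function \<open>F s\<close> suffices.\<close>
      have "((\<lambda>q. flow W q (interp q p) s) has_vector_derivative (interp' s p - W s (interp s p))) (at s)"
        by (rule field.flow_back_derivative[OF s'(1,2) interp_derivative[OF s'(1,2)]])
      then have "((\<lambda>q. F s (flow W q (interp q p) s)) has_derivative
          (\<lambda>v. D s (interp s p) (v *\<^sub>R (interp' s p - W s (interp s p))))) (at s)"
        unfolding has_vector_derivative_def
        using has_derivative_compose[of "\<lambda>q. flow W q (interp q p) s" _ s UNIV "F s" "D s (interp s p)"] dF[OF s01] s01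
        by simp
      then have "((\<lambda>q. F q (interp q p)) has_derivative
          (\<lambda>v. D s (interp s p) (v *\<^sub>R (interp' s p - W s (interp s p))))) (at s)"
      proof (rule has_derivative_transform_within_open[OF _ open_greaterThanLessThan[of 0 1]])
        show "F s (flow W q (interp q p) s) = F q (interp q p)" if "q \<in> {0<..<1}" for q
          unfolding F_def using that s01 by (subst field.flow_flow) auto
      qed (use s' in auto)
      then have "((\<lambda>q. E q p) has_derivative (\<lambda>v. data_weight p * D s (interp s p) (v *\<^sub>R (interp' s p - W s (interp s p))))) (at s)"
        unfolding E_def by (rule has_derivative_mult_right)
      moreover have "(\<lambda>v. data_weight p * D s (interp s p) (v *\<^sub>R (interp' s p - W s (interp s p)))) = E' s p"
        using linear_cmul[OF has_derivative_linear[OF dF[OF s01]]] by (simp add: E'_def fun_eq_iff)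
      ultimately show ?thesis by simp
    qed
    have t01: "t \<in> {0..1}" using t by simp
    note der = has_derivative_integral_dominated[where f = E and f' = E' and ?y0.0 = t and M = std_gauss
      and g = "\<lambda>p. LF * K * exp \<bar>h 0\<bar> * exp ((Kh * root_bound + 1) * norm p)", OF r]
    have pos: "0 \<le> LF * K * exp \<bar>h 0\<bar> * exp ((Kh * root_bound + 1) * norm p)" for p :: "(real^'n) \<times> (real^'n)"
      using LF K by simp
    have gint: "integrable std_gauss (\<lambda>p::(real^'n) \<times> (real^'n). LF * K * exp \<bar>h 0\<bar> * exp ((Kh * root_bound + 1) * norm p))"
      by (intro integrable_mult_right integrable_exp_norm)
    have Eball: "integrable std_gauss (E s)" if "s \<in> ball t r" for s
      using intE ball[OF that] by simp
    have "integrable std_gauss (\<lambda>p. E' t p 1)"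
      by (rule der(1)[OF dE E'_bound gint pos Eball])
    then have "(\<integral>p. E' t p 1 \<partial>std_gauss) = 0"
      unfolding E'_def using has_derivative_linear[OF dF[OF t01]]
      by (simp add: velocity_mismatch_vanishes[OF t])
    then have "(\<integral>p. E' t p v \<partial>std_gauss) = 0" for v
      by (simp add: E'_def)
    moreover have "(u has_derivative (\<lambda>v. \<integral>p. E' t p v \<partial>std_gauss)) (at t)"
      unfolding u_def by (rule der(2)[OF dE E'_bound gint pos Eball])
    ultimately show ?thesis by (simp add: has_field_derivative_def lambda_zero)
  qed
  have "u 1 = u 0"
    by (rule DERIV_isconst_end[OF zero_less_one contu du])
  interpret P: pair_sigma_finite "std_gauss :: (real^'n) measure" "std_gauss :: (real^'n) measure" ..
  have iter: "u t = (\<integral>x. \<integral>z. E t (x, z) \<partial>std_gauss \<partial>std_gauss)" if "t \<in> {0..1}" for t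
    using P.integral_fst[of "\<lambda>x z. E t (x, z)"] intE[OF that]
    by (simp add: u_def std_gauss_pair case_prod_unfold)
  \<comment> \<open>At \<open>t = 1\<close> the noise has dropped out of the interpolant; at
    \<open>t = 0\<close> the data have, and the double integral becomes a product.\<close>
  have "u 1 = (\<integral>x. exp (h (spec root_a x)) * f (spec root_a x) \<partial>std_gauss)"
    unfolding iter[OF one] by (simp add: E_def F_def interp_def data_weight_def)
  moreover have "u 0 = (\<integral>x. exp (h (spec root_a x)) \<partial>std_gauss) * (\<integral>z. f (flow W 0 (spec root_c z) 1) \<partial>std_gauss)"
    unfolding iter[OF zero] by (simp add: E_def F_def interp_def data_weight_def)
  ultimately show ?thesis using \<open>u 1 = u 0\<close> by simp
qed

end

section \<open>Densities and scores of the interpolants\<close>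

text \<open>Equal densities agree almost everywhere, and the set where two continuous functions
  agree is closed; a closed set of full Lebesgue measure is the whole space. This evaluates the
  definite description in \<open>interpolant_density\<close>.\<close>

lemma continuous_density_unique:
  fixes p p' :: "'a::euclidean_space \<Rightarrow> real"
  assumes p: "continuous_on UNIV p" "\<And>x. 0 \<le> p x" and p': "continuous_on UNIV p'" "\<And>x. 0 \<le> p' x"
    and eq: "density lborel (\<lambda>x. ennreal (p x)) = density lborel (\<lambda>x. ennreal (p' x))"
  shows "p = p'"
proof -
  have [measurable]: "p \<in> borel_measurable borel" "p' \<in> borel_measurable borel"
    using p p' by (auto intro: borel_measurable_continuous_onI)
  have "AE x in lborel. ennreal (p x) = ennreal (p' x)"
    using eq by (intro sigma_finite_measure.density_unique[OF sigma_finite_lborel]) auto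
  then have "AE x in lborel. p x = p' x"
    by (rule AE_mp) (use p(2) p'(2) in \<open>auto intro!: AE_I2\<close>)
  then have "AE x in lebesgue. x \<in> {x. p x = p' x}" by (simp add: AE_completion)
  moreover have "closed {x. p x = p' x}"
    using p(1) p'(1) by (simp add: closed_Collect_eq)
  ultimately show ?thesis using mem_closed_if_AE_lebesgue by blast
qed

lemma distr_density_fst:
  fixes T :: "'a \<Rightarrow> 'c::topological_space"
  assumes "sigma_finite_measure N"
    and f [measurable]: "f \<in> borel_measurable (M \<Otimes>\<^sub>M N)" and T [measurable]: "T \<in> borel_measurable M"
  shows "distr (density (M \<Otimes>\<^sub>M N) f) borel (\<lambda>p. T (fst p))
    = distr (density M (\<lambda>x. \<integral>\<^sup>+y. f (x, y) \<partial>N)) borel T"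
proof (rule measure_eqI)
  interpret N: sigma_finite_measure N by fact
  have [measurable]: "(\<lambda>x. \<integral>\<^sup>+y. f (x, y) \<partial>N) \<in> borel_measurable M"
    by (rule N.borel_measurable_nn_integral_fst) measurable
  fix E :: "'c set" assume "E \<in> sets (distr (density (M \<Otimes>\<^sub>M N) f) borel (\<lambda>p. T (fst p)))"
  then have [measurable]: "E \<in> sets borel" by simp
  have m1: "(\<lambda>p. T (fst p)) \<in> borel_measurable (M \<Otimes>\<^sub>M N)" by measurable
  have "emeasure (distr (density (M \<Otimes>\<^sub>M N) f) borel (\<lambda>p. T (fst p))) E
      = (\<integral>\<^sup>+p. indicator E p \<partial>distr (density (M \<Otimes>\<^sub>M N) f) borel (\<lambda>p. T (fst p)))" by simp
  also have "\<dots> = (\<integral>\<^sup>+p. indicator E (T (fst p)) \<partial>density (M \<Otimes>\<^sub>M N) f)"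
    by (rule nn_integral_distr) (use m1 in simp_all)
  also have "\<dots> = (\<integral>\<^sup>+p. f p * indicator E (T (fst p)) \<partial>(M \<Otimes>\<^sub>M N))"
    by (rule nn_integral_density) measurable
  also have "\<dots> = (\<integral>\<^sup>+x. \<integral>\<^sup>+y. f (x, y) * indicator E (T x) \<partial>N \<partial>M)"
    by (subst N.nn_integral_fst[symmetric]) simp_all
  also have "\<dots> = (\<integral>\<^sup>+x. (\<integral>\<^sup>+y. f (x, y) \<partial>N) * indicator E (T x) \<partial>M)"
    by (intro nn_integral_cong nn_integral_multc) measurable
  also have "\<dots> = (\<integral>\<^sup>+x. indicator E x \<partial>distr (density M (\<lambda>x. \<integral>\<^sup>+y. f (x, y) \<partial>N)) borel T)"
    by (subst nn_integral_distr; simp add: nn_integral_density)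
  finally show "emeasure (distr (density (M \<Otimes>\<^sub>M N) f) borel (\<lambda>p. T (fst p))) E
      = emeasure (distr (density M (\<lambda>x. \<integral>\<^sup>+y. f (x, y) \<partial>N)) borel T) E" by simp
qed simp

text \<open>The additional \<open>sqrt n\<close> makes the sigmoids converge to the indicator of a closed half line,
  end point included.\<close>

definition sigmoid :: "nat \<Rightarrow> real \<Rightarrow> real" where
  "sigmoid n u = 1/2 + arctan (real n * u + sqrt (real n)) / pi"

lemma sigmoid_range: "0 \<le> sigmoid n u" "sigmoid n u \<le> 1"
  using arctan_bounded[of "real n * u + sqrt (real n)"] pi_gt_zero
  by (simp_all add: sigmoid_def field_simps)

lemma sigmoid_deriv: "(sigmoid n has_real_derivative real n / (1 + (real n * u + sqrt (real n))\<^sup>2) / pi) (at u)"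
proof -
  have "((\<lambda>u. real n * u + sqrt (real n)) has_real_derivative real n) (at u)"
    by (auto intro!: derivative_eq_intros)
  note d = DERIV_add[OF DERIV_const[of "1/2"] DERIV_cdivide[OF DERIV_chain2[OF DERIV_arctan this], of pi]]
  show ?thesis
    unfolding sigmoid_def[abs_def]
    by (rule DERIV_cong[OF d]) (simp only: add_0_left divide_inverse mult.commute[of _ "real n"])
qed

lemma sigmoid_lipschitz: "\<bar>sigmoid n u - sigmoid n v\<bar> \<le> real n * \<bar>u - v\<bar>"
proof -
  have "norm (sigmoid n u - sigmoid n v) \<le> real n * norm (u - v)"
  proof (rule field_differentiable_bound[OF convex_UNIV])
    fix z
    show "(sigmoid n has_field_derivative real n / (1 + (real n * z + sqrt (real n))\<^sup>2) / pi) (at z within UNIV)"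
      using sigmoid_deriv by simp
    have "1 * 1 \<le> (1 + (real n * z + sqrt (real n))\<^sup>2) * pi"
      using pi_gt3 by (intro mult_mono) auto
    then show "norm (real n / (1 + (real n * z + sqrt (real n))\<^sup>2) / pi) \<le> real n"
      by (simp add: divide_le_eq mult_le_cancel_left1 mult.assoc add_pos_nonneg)
  qed auto
  then show ?thesis by simp
qed

lemma sigmoid_limit: "(\<lambda>n. sigmoid n u) \<longlonglongrightarrow> (if 0 \<le> u then 1 else 0)"
proof (cases "0 \<le> u")
  case True
  have "filterlim (\<lambda>n. real n * u + sqrt (real n)) at_top sequentially"
  proof (rule filterlim_at_top_mono)
    show "filterlim (\<lambda>n. sqrt (real n)) at_top sequentially"
      by (rule filterlim_compose[OF sqrt_at_top filterlim_real_sequentially])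
  qed (use True in auto)
  then have "(\<lambda>n. arctan (real n * u + sqrt (real n))) \<longlonglongrightarrow> pi / 2"
    by (rule filterlim_compose[OF tendsto_arctan_at_top])
  then have "(\<lambda>n. sigmoid n u) \<longlonglongrightarrow> 1/2 + (pi / 2) / pi"
    unfolding sigmoid_def by (intro tendsto_intros) auto
  then show ?thesis using True by simp
next
  case False
  have "filterlim (\<lambda>n. real n * u + sqrt (real n)) at_bot sequentially"
    using False by (simp add: not_le) real_asymp
  then have "(\<lambda>n. arctan (real n * u + sqrt (real n))) \<longlonglongrightarrow> - (pi / 2)"
    by (rule filterlim_compose[OF tendsto_arctan_at_bot])
  then have "(\<lambda>n. sigmoid n u) \<longlonglongrightarrow> 1/2 + (- (pi / 2)) / pi"
    unfolding sigmoid_def by (intro tendsto_intros) auto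
  then show ?thesis using False by simp
qed

text \<open>Products of sigmoids converge boundedly to the indicators of the orthants
  \<open>{..w}\<close>, a generator of the Borel sets stable under intersection. The class of test
  functions is the one that \<open>transport\<close> handles.\<close>

lemma prob_eqI_differentiable:
  fixes M N :: "(real^'n) measure"
  assumes M: "prob_space M" "sets M = sets borel" and N: "prob_space N" "sets N = sets borel"
    and eq: "\<And>f L. (\<And>x. f differentiable (at x)) \<Longrightarrow> (\<And>x. \<bar>f x\<bar> \<le> 1) \<Longrightarrow>
      (\<And>x y. \<bar>f x - f y\<bar> \<le> L * norm (x - y)) \<Longrightarrow> (\<integral>x. f x \<partial>M) = (\<integral>x. (f x :: real) \<partial>N)"
  shows "M = N"
proof -
  interpret M: prob_space M by fact
  interpret N: prob_space N by fact
  have atMost: "emeasure M {..w} = emeasure N {..w}" for w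
  proof -
    define f where "f n x = (\<Prod>i\<in>UNIV. sigmoid n (w $ i - x $ i))" for n and x :: "real^'n"
    have range: "norm (sigmoid n u) \<le> 1" for n u using sigmoid_range[of n u] by simp
    have f1: "\<bar>f n x\<bar> \<le> 1" for n x
      unfolding f_def abs_prod using range by (intro prod_le_1) auto
    have df: "f n differentiable (at x)" for n x
    proof -
      have "((\<lambda>x. sigmoid n (w $ i - x $ i)) has_derivative
          (\<lambda>v. (real n / (1 + (real n * (w $ i - x $ i) + sqrt (real n))\<^sup>2) / pi) * (0 - v $ i))) (at x)" for i
        by (rule has_derivative_compose[OF _ sigmoid_deriv[unfolded has_field_derivative_def]])
          (intro has_derivative_diff has_derivative_const bounded_linear_imp_has_derivative bounded_linear_vec_nth)
      from has_derivative_prod[where I = UNIV, OF this] show ?thesis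
        unfolding f_def[abs_def] by (rule differentiableI)
    qed
    have lf: "\<bar>f n x - f n y\<bar> \<le> (real CARD('n) * real n) * norm (x - y)" for n x y
    proof -
      have "norm (f n x - f n y) \<le> (\<Sum>i\<in>UNIV. norm (sigmoid n (w $ i - x $ i) - sigmoid n (w $ i - y $ i)))"
        unfolding f_def by (rule norm_prod_diff) (use range in auto)
      also have "\<dots> \<le> (\<Sum>i\<in>(UNIV::'n set). real n * norm (x - y))"
      proof (rule sum_mono)
        fix i
        have "\<bar>(w $ i - x $ i) - (w $ i - y $ i)\<bar> \<le> norm (x - y)"
          using component_le_norm_cart[of "x - y" i] by (simp add: abs_minus_commute)
        then show "norm (sigmoid n (w $ i - x $ i) - sigmoid n (w $ i - y $ i)) \<le> real n * norm (x - y)"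
          using sigmoid_lipschitz[of n "w $ i - x $ i" "w $ i - y $ i"]
          by (simp only: real_norm_def) (meson mult_left_mono of_nat_0_le_iff order_trans)
      qed
      finally show ?thesis by simp
    qed
    have lim: "(\<lambda>n. f n x) \<longlonglongrightarrow> indicat_real {..w} x" for x
    proof -
      have "(\<lambda>n. f n x) \<longlonglongrightarrow> (\<Prod>i\<in>UNIV. if 0 \<le> w $ i - x $ i then 1 else 0)"
        unfolding f_def by (intro tendsto_prod sigmoid_limit)
      also have "(\<Prod>i\<in>UNIV. if 0 \<le> w $ i - x $ i then 1 else 0) = indicat_real {..w} x"
        by (auto simp: indicator_def less_eq_vec_def prod_zero_iff intro!: prod.neutral)
      finally show ?thesis .
    qed
    have mf: "f n \<in> borel_measurable borel" for n
      using df by (intro borel_measurable_continuous_onI) (simp add: continuous_at_imp_continuous_on differentiable_imp_continuous_within)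
    have "(\<lambda>n. \<integral>x. f n x \<partial>P) \<longlonglongrightarrow> measure P {..w}" if P: "prob_space P" "sets P = sets borel" for P
    proof -
      interpret P: prob_space P by fact
      have [measurable_cong]: "sets P = sets borel" by fact
      have "(\<lambda>n. \<integral>x. f n x \<partial>P) \<longlonglongrightarrow> (\<integral>x. indicat_real {..w} x \<partial>P)"
        by (rule integral_dominated_convergence[where w = "\<lambda>_. 1"]) (use lim f1 mf in auto)
      then show ?thesis using P(2) by simp
    qed
    from this[OF M] this[OF N] have "measure M {..w} = measure N {..w}"
      using eq[OF df f1 lf] LIMSEQ_unique by auto
    then show ?thesis by (simp add: M.emeasure_eq_measure N.emeasure_eq_measure)
  qed
  let ?E = "range (\<lambda>w. {..w :: real^'n})"
  show "M = N"
  proof (rule measure_eqI_generator_eq[of ?E UNIV M N "\<lambda>i. {.. (\<chi> _. real i)}"])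
    show "Int_stable ?E"
    proof (rule Int_stableI_image)
      fix w v :: "real^'n"
      have "{..w} \<inter> {..v} = {..inf w v}" by auto
      then show "\<exists>u\<in>UNIV. {..w} \<inter> {..v} = {..u}" by blast
    qed
    show "sets M = sigma_sets UNIV ?E" "sets N = sigma_sets UNIV ?E"
      using M(2) N(2) by (simp_all add: borel_eq_atMost)
    have "\<exists>i. x \<in> {.. (\<chi> _. real i) :: real^'n}" for x
    proof -
      obtain i where "norm x \<le> real i" using real_arch_simple by blast
      then have "x $ j \<le> real i" for j using component_le_norm_cart[of x j] by linarith
      then show ?thesis by (auto simp: less_eq_vec_def)
    qed
    then show "(\<Union>i. {.. (\<chi> _. real i) :: real^'n}) = UNIV" by blast
  qed (use atMost in \<open>auto simp: M.emeasure_eq_measure\<close>)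
qed

lemma gradient_eqI: "(f has_derivative (\<lambda>v. v \<bullet> D)) (at x) \<Longrightarrow> gradient f x = D"
  unfolding gradient_def gderiv_def
proof (rule the_equality)
  fix D' assume "(f has_derivative (\<lambda>v. v \<bullet> D)) (at x)" "(f has_derivative (\<lambda>v. v \<bullet> D')) (at x)"
  then have "(\<lambda>v. v \<bullet> D) = (\<lambda>v. v \<bullet> D')" by (rule has_derivative_unique)
  then show "D' = D" by (metis vector_eq_ldot)
qed

lemma gaussian_mat_1: "gaussian (mat 1) = (std_gauss :: (real^'n) measure)"
proof -
  interpret orthonormal_frame "mat 1 :: real^'n^'n"
    by standard (simp add: orthogonal_matrix_def transpose_mat)
  have "matrix_inv (mat 1) *v x = x" for x :: "real^'n"
    using matrix_inv_spec[of "mat 1" "\<lambda>_. 1" x] by (simp add: spec_one)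
  then show ?thesis
    by (simp add: gaussian_def std_gauss_def gauss_density_def det_I power2_norm_eq_inner)
qed

context gaussian_tail_model
begin

text \<open>The Lebesgue integral of the Gaussian factor of \<open>dens\<close>; it turns weights
  against \<open>std_gauss\<close> into Lebesgue densities.\<close>

definition \<kappa> where "\<kappa> = sqrt ((2 * pi) ^ CARD('n)) * (\<Prod>i\<in>UNIV. sqrt (a i))"

lemma \<kappa>_pos: "0 < \<kappa>"
  unfolding \<kappa>_def using a_pos by (intro mult_pos_pos prod_pos) auto

definition dens where "dens x = exp (- (x \<bullet> spec (\<lambda>i. 1 / a i) x) / 2) * exp (h x)"

lemma gauss_spec:
  assumes "\<And>i. (r i)\<^sup>2 = f i"
  shows "gauss_density (spec r y) = exp (- (y \<bullet> spec f y) / 2) / sqrt ((2 * pi) ^ CARD('n))"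
proof -
  have "(norm (spec r y))\<^sup>2 = y \<bullet> spec f y"
    using assms by (simp add: norm_coord inner_coord power_mult_distrib power2_eq_square[of "coord y _"] mult_ac)
  then show ?thesis by (simp add: gauss_density_def)
qed

text \<open>Any signs of the square roots are allowed: the positive root enters
  \<open>interp\<close>, the negative one is \<open>dev_coef\<close> at time 0.\<close>

lemma target_dens:
  assumes r: "\<And>i. (r i)\<^sup>2 = a i"
  shows "target dens = distr (density std_gauss (\<lambda>x. ennreal (\<kappa> * exp (h (spec r x))))) borel (spec r)"
proof -
  have r0: "r i \<noteq> 0" for i using r[of i] a_pos[of i] by auto
  have P: "(\<Prod>i\<in>UNIV. \<bar>r i\<bar>) = (\<Prod>i\<in>UNIV. sqrt (a i))"
    by (simp flip: r)
  have P0: "0 < (\<Prod>i\<in>UNIV. sqrt (a i))" using a_pos by (intro prod_pos) auto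
  have a0: "a i \<noteq> 0" for i using a_pos[of i] by simp
  have "distr (density std_gauss (\<lambda>x. ennreal (\<kappa> * exp (h (spec r x))))) borel (spec r)
      = distr (density lborel (\<lambda>x. ennreal (gauss_density x) * ennreal (\<kappa> * exp (h (spec r x))))) borel (spec r)"
    unfolding std_gauss_def by (subst density_density_eq) simp_all
  also have "\<dots> = density lborel (\<lambda>y. (ennreal (gauss_density (spec (\<lambda>i. 1 / r i) y))
      * ennreal (\<kappa> * exp (h (spec r (spec (\<lambda>i. 1 / r i) y))))) * ennreal (1 / (\<Prod>i\<in>UNIV. \<bar>r i\<bar>)))"
    by (rule distr_density_spec[OF r0]) measurable
  also have "\<dots> = density lborel (\<lambda>y. ennreal (dens y))"
  proof (rule arg_cong[where f = "density lborel"], rule ext)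
    fix y
    have "gauss_density (spec (\<lambda>i. 1 / r i) y) = exp (- (y \<bullet> spec (\<lambda>i. 1 / a i) y) / 2) / sqrt ((2 * pi) ^ CARD('n))"
      by (rule gauss_spec) (simp add: power_divide r)
    then have "gauss_density (spec (\<lambda>i. 1 / r i) y) * (\<kappa> * exp (h y)) * (1 / (\<Prod>i\<in>UNIV. \<bar>r i\<bar>)) = dens y"
      using P0 unfolding P \<kappa>_def dens_def by (simp add: a0)
    then show "ennreal (gauss_density (spec (\<lambda>i. 1 / r i) y))
      * ennreal (\<kappa> * exp (h (spec r (spec (\<lambda>i. 1 / r i) y)))) * ennreal (1 / (\<Prod>i\<in>UNIV. \<bar>r i\<bar>)) = ennreal (dens y)"
      using \<kappa>_pos P0 by (simp add: spec_spec r0 spec_one less_imp_le gauss_density_pos P flip: ennreal_mult)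
  qed
  finally show ?thesis by (simp add: target_def)
qed

lemma root_a_sq: "(sqrt (a i))\<^sup>2 = a i" using a_pos[of i] by simp

lemma measurable_data_weight [measurable]: "data_weight \<in> borel_measurable borel"
  by (intro borel_measurable_continuous_onI continuous_data_weight)

lemma measurable_interp [measurable]: "interp t \<in> borel_measurable borel"
  by (intro borel_measurable_continuous_onI continuous_interp)

definition interp_dens where
  "interp_dens t y = \<kappa> * gauss_density (spec (\<lambda>i. 1 / sqrt (b t i)) y) * H t y / (\<Prod>i\<in>UNIV. sqrt (b t i))"

lemma interp_dens_pos: "t \<in> {0..1} \<Longrightarrow> 0 < interp_dens t y"
  unfolding interp_dens_def using \<kappa>_pos gauss_density_pos H_pos b_pos
  by (intro divide_pos_pos mult_pos_pos prod_pos) auto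

lemma continuous_H: "t \<in> {0..1} \<Longrightarrow> continuous_on X (H t)"
  using has_derivative_continuous[OF deriv_H] by (simp add: continuous_at_imp_continuous_on)

lemma continuous_interp_dens: "t \<in> {0..1} \<Longrightarrow> continuous_on UNIV (interp_dens t)"
  unfolding interp_dens_def divide_inverse
  by (intro continuous_on_mult continuous_on_const continuous_H
      continuous_on_compose2[OF continuous_gauss_density[of UNIV] _ subset_UNIV] continuous_intros)

text \<open>Rotating the pair preserves its Gaussian law and makes the interpolant a function of the
  first component. Integrating out the second yields \<open>H\<close>, and rescaling by
  \<open>sqrt (b t i)\<close> the density. The end times need no separate case, as \<open>b\<close>
  is positive there.\<close>

lemma distr_interp:
  assumes t: "t \<in> {0..1}"
  shows "distr (density std_gauss (\<lambda>p. ennreal (\<kappa> * data_weight p))) borel (interp t)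
    = density lborel (\<lambda>y. ennreal (interp_dens t y))"
proof -
  define B where "B = (\<lambda>i. sqrt (b t i))"
  have B: "0 < B i" for i using b_pos[OF t, of i] by (simp add: B_def)
  have B0: "B i \<noteq> 0" for i using B[of i] by simp
  have [measurable]: "(\<lambda>p. weight t (spec B (fst p)) (snd p)) \<in> borel_measurable borel"
    unfolding weight_def posterior_def
    by (intro borel_measurable_continuous_onI continuous_intros)
  have [measurable]: "H t \<in> borel_measurable borel"
    by (intro borel_measurable_continuous_onI continuous_H t)
  have "distr (density std_gauss (\<lambda>p. ennreal (\<kappa> * data_weight p))) borel (interp t)
      = distr (density (distr std_gauss borel (rot t)) (\<lambda>p. ennreal (\<kappa> * data_weight p))) borel (interp t)"
    by (simp add: distr_rot[OF t])
  also have "\<dots> = distr (distr (density std_gauss (\<lambda>p. ennreal (\<kappa> * data_weight (rot t p)))) borel (rot t)) borel (interp t)"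
    by (subst density_distr) simp_all
  also have "\<dots> = distr (density std_gauss (\<lambda>p. ennreal (\<kappa> * data_weight (rot t p)))) borel (\<lambda>p. interp t (rot t p))"
    by (subst distr_distr) (simp_all add: comp_def)
  also have "\<dots> = distr (density (std_gauss \<Otimes>\<^sub>M std_gauss) (\<lambda>p. ennreal (\<kappa> * weight t (spec B (fst p)) (snd p)))) borel (\<lambda>p. spec B (fst p))"
    by (simp add: std_gauss_pair data_weight_rot[OF t] rot_interp[OF t] B_def)
  also have "\<dots> = distr (density std_gauss (\<lambda>x. \<integral>\<^sup>+z. ennreal (\<kappa> * weight t (spec B x) z) \<partial>std_gauss)) borel (spec B)"
    by (subst distr_density_fst[OF prob_space_imp_sigma_finite[OF prob_space_std_gauss]])
       (simp_all add: std_gauss_pair)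
  also have "(\<lambda>x. \<integral>\<^sup>+z. ennreal (\<kappa> * weight t (spec B x) z) \<partial>std_gauss) = (\<lambda>x. ennreal (\<kappa> * H t (spec B x)))"
    using \<kappa>_pos weight_pos integrable_weight[OF t]
    by (subst nn_integral_eq_integral) (auto simp: H_def less_imp_le)
  also have "density std_gauss (\<lambda>x. ennreal (\<kappa> * H t (spec B x)))
      = density lborel (\<lambda>x. ennreal (gauss_density x) * ennreal (\<kappa> * H t (spec B x)))"
    unfolding std_gauss_def by (subst density_density_eq) simp_all
  also have "distr \<dots> borel (spec B) = density lborel (\<lambda>y. (ennreal (gauss_density (spec (\<lambda>i. 1 / B i) y))
      * ennreal (\<kappa> * H t (spec B (spec (\<lambda>i. 1 / B i) y)))) * ennreal (1 / (\<Prod>i\<in>UNIV. \<bar>B i\<bar>)))"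
    by (rule distr_density_spec[OF B0]) measurable
  also have "\<dots> = density lborel (\<lambda>y. ennreal (interp_dens t y))"
  proof (rule arg_cong[where f = "density lborel"], rule ext)
    fix y
    have P0: "0 < (\<Prod>i\<in>UNIV. B i)" using B by (intro prod_pos) auto
    have "gauss_density (spec (\<lambda>i. 1 / B i) y) * (\<kappa> * H t y) * (1 / (\<Prod>i\<in>UNIV. B i)) = interp_dens t y"
      by (simp add: interp_dens_def B_def)
    moreover have "\<bar>B i\<bar> = B i" for i using B[of i] by simp
    ultimately show "ennreal (gauss_density (spec (\<lambda>i. 1 / B i) y)) * ennreal (\<kappa> * H t (spec B (spec (\<lambda>i. 1 / B i) y)))
        * ennreal (1 / (\<Prod>i\<in>UNIV. \<bar>B i\<bar>)) = ennreal (interp_dens t y)"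
      using \<kappa>_pos P0 H_pos[OF t, of y]
      by (simp add: spec_spec B0 spec_one less_imp_le gauss_density_pos flip: ennreal_mult)
  qed
  finally show ?thesis .
qed

text \<open>Passes from the independent pair of data and noise to a standard Gaussian pair weighted
  by \<open>data_weight\<close>, the form on which the rotation acts.\<close>

lemma interpolant_law_eq:
  assumes C: "\<And>x. C *v x = spec c x"
  shows "interpolant_law C dens t = distr (density std_gauss (\<lambda>p. ennreal (\<kappa> * data_weight p))) borel (interp t)"
proof -
  let ?w = "\<lambda>x. ennreal (\<kappa> * exp (h (spec root_a x)))"
  have sf: "sigma_finite_measure (std_gauss :: (real^'n) measure)"
    by (rule prob_space_imp_sigma_finite[OF prob_space_std_gauss])
  have "target dens \<Otimes>\<^sub>M gaussian (mat 1 :: real^'n^'n) = distr (density std_gauss ?w) borel (spec root_a) \<Otimes>\<^sub>M distr std_gauss borel (\<lambda>z. z)"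
    by (simp add: target_dens[OF root_a_sq] gaussian_mat_1 distr_id2)
  also have "\<dots> = distr (density std_gauss ?w \<Otimes>\<^sub>M std_gauss) (borel \<Otimes>\<^sub>M borel) (\<lambda>(x, z). (spec root_a x, z))"
    by (rule pair_measure_distr) (simp_all add: distr_id2 sf)
  also have "density std_gauss ?w \<Otimes>\<^sub>M std_gauss
      = density std_gauss ?w \<Otimes>\<^sub>M density (std_gauss :: (real^'n) measure) (\<lambda>_. 1)"
    by (simp add: density_1)
  also have "\<dots> = density (std_gauss \<Otimes>\<^sub>M std_gauss) (\<lambda>(x, z). ?w x * 1)"
    by (rule pair_measure_density) (simp_all add: density_1 sf)
  also have "\<dots> = density std_gauss (\<lambda>p. ennreal (\<kappa> * data_weight p))"
    by (simp add: std_gauss_pair case_prod_unfold data_weight_def)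
  finally have pair: "target dens \<Otimes>\<^sub>M gaussian (mat 1 :: real^'n^'n)
      = distr (density std_gauss (\<lambda>p. ennreal (\<kappa> * data_weight p))) (borel \<Otimes>\<^sub>M borel) (\<lambda>(x, z). (spec root_a x, z))" .
  have m: "(\<lambda>(x, z). (spec root_a x, z)) \<in> (borel :: ((real^'n) \<times> (real^'n)) measure) \<rightarrow>\<^sub>M borel \<Otimes>\<^sub>M borel"
    unfolding borel_prod case_prod_unfold by (intro borel_measurable_continuous_onI continuous_intros)
  have m': "(\<lambda>(x, z). t *\<^sub>R x + sqrt (1 - t\<^sup>2) *\<^sub>R spec root_c z) \<in> borel \<Otimes>\<^sub>M borel \<rightarrow>\<^sub>M (borel :: (real^'n) measure)"
    unfolding borel_prod case_prod_unfold by (intro borel_measurable_continuous_onI continuous_intros)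
  show ?thesis
    unfolding interpolant_law_def pair mat_sqrt_spec[OF C c_pos]
    by (subst distr_distr) (use m m' in \<open>auto simp: comp_def case_prod_unfold interp_def[abs_def]\<close>)
qed

lemma interpolant_density_eq:
  assumes C: "\<And>x. C *v x = spec c x" and t: "t \<in> {0..1}"
  shows "interpolant_density C dens t = interp_dens t"
  unfolding interpolant_density_def interpolant_law_eq[OF C] distr_interp[OF t]
proof (rule the_equality)
  fix p :: "real^'n \<Rightarrow> real"
  assume "continuous_on UNIV p \<and> (\<forall>x. 0 \<le> p x) \<and>
    density lborel (\<lambda>y. ennreal (interp_dens t y)) = density lborel (\<lambda>x. ennreal (p x))"
  then show "p = interp_dens t"
    using continuous_density_unique[of p "interp_dens t"] continuous_interp_dens[OF t] interp_dens_pos[OF t]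
    by (auto simp: less_imp_le)
qed (use continuous_interp_dens[OF t] interp_dens_pos[OF t] in \<open>auto simp: less_imp_le\<close>)

lemma H'_inner: "t \<in> {0..1} \<Longrightarrow> H' t y v = v \<bullet> spec (mean_coef t) (N t y)"
proof -
  assume t: "t \<in> {0..1}"
  have gN: "integrable std_gauss (\<lambda>z. weight t y z *\<^sub>R g (posterior t y z))"
    by (rule integrable_by_weight[OF t _ integrand_bounds(1)[OF t]]) measurable
  have "H' t y v = (\<integral>z. spec (mean_coef t) v \<bullet> (weight t y z *\<^sub>R g (posterior t y z)) \<partial>std_gauss)"
    by (simp add: H'_def)
  also have "\<dots> = spec (mean_coef t) v \<bullet> N t y"
    unfolding N_def by (rule integral_inner_right[OF gN])
  finally show ?thesis by (simp add: inner_spec)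
qed

text \<open>The logarithm of the density is a constant, a quadratic form and
  \<open>ln (H t y)\<close>. Since \<open>y\<close> enters the data point through
  \<open>mean_coef\<close> alone, the last term has gradient
  \<open>spec (mean_coef t) (R t y)\<close>.\<close>

lemma score_eq:
  assumes C: "\<And>x. C *v x = spec c x" and t: "t \<in> {0..1}"
  shows "score C dens t x = spec c (spec (mean_coef t) (R t x) - spec (\<lambda>i. 1 / b t i) x)"
proof -
  define k where "k = ln (\<kappa> / sqrt ((2 * pi) ^ CARD('n)) / (\<Prod>i\<in>UNIV. sqrt (b t i)))"
  have P: "0 < (\<Prod>i\<in>UNIV. sqrt (b t i))" using b_pos[OF t] by (intro prod_pos) auto
  have ln: "ln (interp_dens t y) = k - (y \<bullet> spec (\<lambda>i. 1 / b t i) y) / 2 + ln (H t y)" for y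
  proof -
    have "gauss_density (spec (\<lambda>i. 1 / sqrt (b t i)) y) = exp (- (y \<bullet> spec (\<lambda>i. 1 / b t i) y) / 2) / sqrt ((2 * pi) ^ CARD('n))"
      by (rule gauss_spec) (use b_pos[OF t] in \<open>simp add: power_divide less_imp_le\<close>)
    then have "interp_dens t y = (\<kappa> / sqrt ((2 * pi) ^ CARD('n)) / (\<Prod>i\<in>UNIV. sqrt (b t i)))
        * exp (- (y \<bullet> spec (\<lambda>i. 1 / b t i) y) / 2) * H t y"
      by (simp add: interp_dens_def)
    moreover have "0 < \<kappa> / sqrt ((2 * pi) ^ CARD('n)) / (\<Prod>i\<in>UNIV. sqrt (b t i))"
      using \<kappa>_pos P by simp
    ultimately show ?thesis
      using H_pos[OF t, of y] by (simp only: ln_mult_pos mult_pos_pos exp_gt_zero ln_exp k_def)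
  qed
  have "((\<lambda>y. y \<bullet> spec (\<lambda>i. 1 / b t i) y) has_derivative
      (\<lambda>v. x \<bullet> spec (\<lambda>i. 1 / b t i) v + v \<bullet> spec (\<lambda>i. 1 / b t i) x)) (at x)"
    by (intro has_derivative_inner has_derivative_ident bounded_linear_imp_has_derivative bounded_linear_spec)
  moreover have "((\<lambda>y. ln (H t y)) has_derivative (\<lambda>v. H' t x v * inverse (H t x))) (at x)"
    using has_derivative_ln[OF H_pos[OF t] deriv_H[OF t, of x]] by (simp add: divide_inverse)
  ultimately have "((\<lambda>y. k - (y \<bullet> spec (\<lambda>i. 1 / b t i) y) / 2 + ln (H t y)) has_derivative
      (\<lambda>v. 0 - (x \<bullet> spec (\<lambda>i. 1 / b t i) v + v \<bullet> spec (\<lambda>i. 1 / b t i) x) / 2 + H' t x v * inverse (H t x))) (at x)"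
    by (intro has_derivative_add has_derivative_diff has_derivative_const
        bounded_linear.has_derivative[OF bounded_linear_divide])
  moreover have "(\<lambda>v. 0 - (x \<bullet> spec (\<lambda>i. 1 / b t i) v + v \<bullet> spec (\<lambda>i. 1 / b t i) x) / 2 + H' t x v * inverse (H t x))
      = (\<lambda>v. v \<bullet> (spec (mean_coef t) (R t x) - spec (\<lambda>i. 1 / b t i) x))"
  proof
    fix v
    have "x \<bullet> spec (\<lambda>i. 1 / b t i) v = v \<bullet> spec (\<lambda>i. 1 / b t i) x"
      by (metis inner_commute inner_spec)
    then show "0 - (x \<bullet> spec (\<lambda>i. 1 / b t i) v + v \<bullet> spec (\<lambda>i. 1 / b t i) x) / 2 + H' t x v * inverse (H t x)
      = v \<bullet> (spec (mean_coef t) (R t x) - spec (\<lambda>i. 1 / b t i) x)"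
      by (simp add: H'_inner[OF t] R_def spec_scaleR inner_diff_right)
  qed
  ultimately have "gradient (\<lambda>y. ln (interp_dens t y)) x = spec (mean_coef t) (R t x) - spec (\<lambda>i. 1 / b t i) x"
    unfolding ln by (intro gradient_eqI) simp
  then show ?thesis by (simp add: score_def interpolant_density_eq[OF C t] C)
qed

text \<open>The division by \<open>t\<close> is harmless because \<open>b t i - c i\<close> equals
  \<open>t\<^sup>2 * (a i - c i)\<close> and because \<open>mean_coef\<close> carries a factor
  \<open>t\<close>.\<close>

lemma velocity_formula:
  assumes C: "\<And>x. C *v x = spec c x" and t: "0 < t" "t \<le> 1"
  shows "(1 / t) *\<^sub>R (x + score C dens t x) = W t x"
proof (rule coord_eqI)
  fix i
  have t01: "t \<in> {0..1}" using t by simp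
  define r where "r = coord (R t x) i"
  have b: "b t i \<noteq> 0" by (rule b_nz[OF t01])
  have "coord ((1 / t) *\<^sub>R (x + score C dens t x)) i
      = (coord x i + c i * (t * a i / b t i * r - 1 / b t i * coord x i)) / t"
    by (simp add: score_eq[OF C t01] mean_coef_def r_def)
  also have "\<dots> = ((b t i - c i) / t) / b t i * coord x i + a i * c i / b t i * r"
    using b t by (simp add: field_simps)
  also have "(b t i - c i) / t = t * (a i - c i)"
    using t by (simp add: b_def field_simps power2_eq_square)
  finally show "coord ((1 / t) *\<^sub>R (x + score C dens t x)) i = coord (W t x) i"
    by (simp add: W_def lin_coef_def harm_coef_def r_def)
qed

lemma continuous_W_time: "continuous_on {0..1} (\<lambda>t. W t x)"
  by (intro field.continuous_along continuous_intros) auto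

lemma velocity_limit:
  assumes C: "\<And>x. C *v x = spec c x"
  shows "((\<lambda>t. (1 / t) *\<^sub>R (x + score C dens t x)) \<longlongrightarrow> W 0 x) (at_right 0)"
proof -
  have "((\<lambda>t. W t x) \<longlongrightarrow> W 0 x) (at_right 0)"
    using continuous_W_time[of x] unfolding continuous_on_def
    by (metis atLeastAtMost_iff at_within_Icc_at_right order_refl zero_le_one zero_less_one)
  moreover have "\<forall>\<^sub>F t in at_right 0. W t x = (1 / t) *\<^sub>R (x + score C dens t x)"
    unfolding eventually_at_right_field using velocity_formula[OF C] by (intro exI[of _ 1]) auto
  ultimately show ?thesis by (rule Lim_transform_eventually)
qed

lemma velocity_eq:
  assumes C: "\<And>x. C *v x = spec c x" and t: "t \<in> {0..1}"
  shows "velocity C dens t x = W t x"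
proof (cases "t = 0")
  case True
  then show ?thesis
    using tendsto_Lim[OF trivial_limit_at_right_real velocity_limit[OF C, of x]] by (simp add: velocity_def)
next
  case False
  then show ?thesis using velocity_formula[OF C, of t x] t by (simp add: velocity_def)
qed

lemma normalization:
  assumes p: "prob_space (target dens)" and r: "\<And>i. (r i)\<^sup>2 = a i"
  shows "integrable std_gauss (\<lambda>x. exp (h (spec r x)))" "\<kappa> * (\<integral>x. exp (h (spec r x)) \<partial>std_gauss) = 1"
proof -
  have m: "(\<lambda>x. ennreal (\<kappa> * exp (h (spec r x)))) \<in> borel_measurable std_gauss" by measurable
  have "emeasure (target dens) (space (target dens)) = 1" using p by (simp add: prob_space.emeasure_space_1)
  then have nn: "(\<integral>\<^sup>+x. ennreal (\<kappa> * exp (h (spec r x))) \<partial>std_gauss) = 1"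
    using m by (simp add: target_dens[OF r] emeasure_distr emeasure_density)
  then have i: "integrable std_gauss (\<lambda>x. \<kappa> * exp (h (spec r x)))"
    using \<kappa>_pos by (intro integrableI_nonneg) auto
  then show "integrable std_gauss (\<lambda>x. exp (h (spec r x)))" using \<kappa>_pos by simp
  have "ennreal (\<integral>x. \<kappa> * exp (h (spec r x)) \<partial>std_gauss) = 1"
    using nn_integral_eq_integral[OF i] \<kappa>_pos nn by simp
  then show "\<kappa> * (\<integral>x. exp (h (spec r x)) \<partial>std_gauss) = 1" by simp
qed

lemma integral_target:
  fixes f :: "real^'n \<Rightarrow> 'x::{banach, second_countable_topology}"
  assumes r: "\<And>i. (r i)\<^sup>2 = a i" and f: "f \<in> borel_measurable borel"
  shows "(\<integral>y. f y \<partial>target dens) = \<kappa> *\<^sub>R (\<integral>x. exp (h (spec r x)) *\<^sub>R f (spec r x) \<partial>std_gauss)"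
  unfolding target_dens[OF r] using \<kappa>_pos f
  by (subst integral_distr) (auto simp: integral_density simp flip: scaleR_scaleR)

text \<open>At \<open>t = 0\<close> the coefficient \<open>harm_coef\<close> is \<open>a\<close>:
  the factor \<open>C\<close> of the score has cancelled against the inverse of \<open>b\<close>,
  which is \<open>c\<close> there. The limit is therefore the mean itself, without a factor
  \<open>sqrt C\<close>. One square root of \<open>a\<close> is consumed by Stein's identity, which
  trades the gradient of \<open>h\<close> for \<open>z\<close>; the other maps \<open>z\<close> to
  the data point.\<close>

lemma W_zero:
  assumes p: "prob_space (target dens)"
  shows "W 0 x = (\<integral>y. y \<partial>target dens)"
proof -
  define r where "r = (\<lambda>i. - sqrt (a i))"
  have r: "(r i)\<^sup>2 = a i" for i using a_pos[of i] by (simp add: r_def)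
  have zero: "(0::real) \<in> {0..1}" by simp
  have coefs: "mean_coef 0 = (\<lambda>i. 0)" "dev_coef 0 = r" "lin_coef 0 = (\<lambda>i. 0)" "harm_coef 0 = a"
    using c_pos by (auto simp: mean_coef_def dev_coef_def lin_coef_def harm_coef_def b_def r_def fun_eq_iff
        less_imp_neq[symmetric])
  have z: "spec (\<lambda>i. 0) y = 0" for y by (rule coord_eqI) simp
  have w: "weight 0 x z = exp (h (spec r z))" for z by (simp add: weight_def posterior_def coefs z)
  have H: "\<kappa> * H 0 x = 1" using normalization(2)[OF p r] by (simp add: H_def w)
  have "spec a (N 0 x) = spec r (spec r (N 0 x))" by (simp add: spec_spec r flip: power2_eq_square)
  also have "\<dots> = spec r (\<integral>z. weight 0 x z *\<^sub>R z \<partial>std_gauss)"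
    using stein_weight(2)[OF zero, of x] by (simp add: coefs)
  also have "\<dots> = (\<integral>z. exp (h (spec r z)) *\<^sub>R spec r z \<partial>std_gauss)"
    using integral_bounded_linear[OF bounded_linear_spec stein_weight(1)[OF zero, of x], of r]
    by (simp add: w spec_scaleR)
  finally have "\<kappa> *\<^sub>R spec a (N 0 x) = (\<integral>y. y \<partial>target dens)"
    using integral_target[OF r, of "\<lambda>y. y"] by simp
  moreover have "inverse (H 0 x) = \<kappa>" using H by (metis inverse_unique mult.commute)
  ultimately show ?thesis by (simp add: W_def coefs z R_def spec_scaleR)
qed

lemma gaussian_C:
  assumes C: "\<And>x. C *v x = spec c x"
  shows "gaussian C = distr std_gauss borel (spec root_c)"
proof -
  have c0: "sqrt (c i) \<noteq> 0" for i using c_pos[of i] by simp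
  have c1: "c i \<noteq> 0" for i using c_pos[of i] by simp
  have P: "(\<Prod>i\<in>UNIV. \<bar>sqrt (c i)\<bar>) = sqrt (\<Prod>i\<in>UNIV. c i)"
    using c_pos by (intro real_sqrt_unique[symmetric]) (auto simp: less_imp_le prod_nonneg prod_power_distrib)
  have P0: "0 < (\<Prod>i\<in>UNIV. c i)" using c_pos by (intro prod_pos) auto
  have "distr std_gauss borel (spec root_c)
      = density lborel (\<lambda>y. ennreal (gauss_density (spec (\<lambda>i. 1 / sqrt (c i)) y)) * ennreal (1 / sqrt (\<Prod>i\<in>UNIV. c i)))"
    unfolding std_gauss_def by (subst distr_density_spec[OF c0]) (simp_all add: P)
  also have "\<dots> = gaussian C"
    unfolding gaussian_def
  proof (rule arg_cong[where f = "density lborel"], rule ext)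
    fix y
    have "gauss_density (spec (\<lambda>i. 1 / sqrt (c i)) y) = exp (- (y \<bullet> spec (\<lambda>i. 1 / c i) y) / 2) / sqrt ((2 * pi) ^ CARD('n))"
      by (rule gauss_spec) (use c_pos in \<open>simp add: power_divide less_imp_le\<close>)
    then show "ennreal (gauss_density (spec (\<lambda>i. 1 / sqrt (c i)) y)) * ennreal (1 / sqrt (\<Prod>i\<in>UNIV. c i))
        = ennreal (exp (- (y \<bullet> (matrix_inv C *v y)) / 2) / sqrt ((2 * pi) ^ CARD('n) * det C))"
      using P0 by (simp add: matrix_inv_spec[OF C c1] det_spec[OF C] real_sqrt_mult flip: ennreal_mult)
  qed
  finally show ?thesis ..
qed

lemma follmer_flow:
  assumes C: "\<And>x. C *v x = spec c x" and p: "prob_space (target dens)"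
  shows "(\<forall>x. ((\<lambda>t. velocity C dens t x) \<longlongrightarrow> (\<integral>y. y \<partial>target dens)) (at_right 0)
              \<and> velocity C dens 0 x = (\<integral>y. y \<partial>target dens))
         \<and> (\<exists>\<Phi>. unique_flow (velocity C dens) \<Phi>
              \<and> distr (gaussian C) borel (\<Phi> 1) = target dens)"
proof (intro conjI allI exI)
  fix x
  have "\<forall>\<^sub>F t in at_right 0. (1 / t) *\<^sub>R (x + score C dens t x) = velocity C dens t x"
    unfolding eventually_at_right_field by (intro exI[of _ 1]) (auto simp: velocity_def)
  from Lim_transform_eventually[OF velocity_limit[OF C] this]
  show "((\<lambda>t. velocity C dens t x) \<longlongrightarrow> (\<integral>y. y \<partial>target dens)) (at_right 0)"
    by (simp add: W_zero[OF p])
  show "velocity C dens 0 x = (\<integral>y. y \<partial>target dens)"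
    by (simp add: velocity_eq[OF C] W_zero[OF p])
next
  define \<Phi> where "\<Phi> t x = flow W 0 x t" for t x
  have zero: "(0::real) \<in> {0..1}" and one: "(1::real) \<in> {0..1}" by simp_all
  \<comment> \<open>Only times in the unit interval matter for a solution, and there
    \<open>velocity\<close> agrees with \<open>W\<close>.\<close>
  have ivp: "solves_ivp (velocity C dens) x y \<longleftrightarrow> solution W y \<and> y 0 = x" for x y
    by (auto simp: solves_ivp_def solution_def velocity_eq[OF C])
  have mPhi: "\<Phi> t \<in> borel_measurable borel" if "t \<in> {0..1}" for t
    unfolding \<Phi>_def using field.continuous_flow[OF zero that] by (rule borel_measurable_continuous_onI)
  show "unique_flow (velocity C dens) \<Phi>"
    unfolding unique_flow_def ivp
  proof (intro conjI ballI allI impI)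
    show "\<Phi> t \<in> borel_measurable borel" if "t \<in> {0..1}" for t by (rule mPhi[OF that])
    show "solution W (\<lambda>t. \<Phi> t x)" "\<Phi> 0 x = x" for x
      using field.flow_solution[OF zero, of x] by (simp_all add: \<Phi>_def)
    show "y t = \<Phi> t x" if "solution W y \<and> y 0 = x" "t \<in> {0..1}" for x y t
      using field.solution_unique[OF _ field.flow_solution[OF zero, of x] zero that(2), of y] that(1)
      by (simp add: \<Phi>_def)
  qed
  have meas: "(\<lambda>z. \<Phi> 1 (spec root_c z)) \<in> borel_measurable borel"
    using measurable_compose[OF measurable_spec mPhi[OF one]] by simp
  have distr: "distr (gaussian C) borel (\<Phi> 1) = distr std_gauss borel (\<lambda>z. \<Phi> 1 (spec root_c z))"
    unfolding gaussian_C[OF C] using mPhi[OF one] by (subst distr_distr) (auto simp: comp_def)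
  show "distr (gaussian C) borel (\<Phi> 1) = target dens"
    unfolding distr
  proof (rule prob_eqI_differentiable)
    show "prob_space (distr std_gauss borel (\<lambda>z. \<Phi> 1 (spec root_c z)))"
      using meas by (intro std_gauss.prob_space_distr) auto
    fix f :: "real^'n \<Rightarrow> real" and L
    assume f: "\<And>x. f differentiable (at x)" "\<And>x. \<bar>f x\<bar> \<le> 1" "\<And>x y. \<bar>f x - f y\<bar> \<le> L * norm (x - y)"
    have mf: "f \<in> borel_measurable borel"
      using f(1) by (intro borel_measurable_continuous_onI)
        (simp add: continuous_at_imp_continuous_on differentiable_imp_continuous_within)
    have "(\<integral>x. f x \<partial>distr std_gauss borel (\<lambda>z. \<Phi> 1 (spec root_c z))) = (\<integral>z. f (\<Phi> 1 (spec root_c z)) \<partial>std_gauss)"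
      using meas mf by (intro integral_distr) auto
    also have "\<dots> = \<kappa> * (\<integral>x. exp (h (spec root_a x)) \<partial>std_gauss) * (\<integral>z. f (\<Phi> 1 (spec root_c z)) \<partial>std_gauss)"
      using normalization(2)[OF p root_a_sq] by simp
    also have "\<dots> = (\<integral>y. f y \<partial>target dens)"
      using transport[OF f] by (simp add: integral_target[OF root_a_sq mf] \<Phi>_def)
    finally show "(\<integral>x. f x \<partial>distr std_gauss borel (\<lambda>z. \<Phi> 1 (spec root_c z))) = (\<integral>y. f y \<partial>target dens)" .
  qed (use p in \<open>auto simp: target_def\<close>)
qed

end

section \<open>Derivatives of the potential\<close>

text \<open>\<open>gradient\<close> is a definite description; the vector with components
  \<open>f' b\<close> represents the derivative and is what it denotes.\<close>

lemma has_derivative_gradient: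
  fixes f :: "real^'n \<Rightarrow> real"
  assumes "f differentiable (at x)"
  shows "(f has_derivative (\<lambda>v. v \<bullet> gradient f x)) (at x)"
proof -
  obtain f' where f': "(f has_derivative f') (at x)" using assms by (auto simp: differentiable_def)
  define D where "D = (\<Sum>b\<in>Basis. f' b *\<^sub>R b)"
  have "f' v = v \<bullet> D" for v
  proof -
    have "f' v = f' (\<Sum>b\<in>Basis. (v \<bullet> b) *\<^sub>R b)" by (simp add: euclidean_representation)
    also have "\<dots> = (\<Sum>b\<in>Basis. (v \<bullet> b) * f' b)"
      using has_derivative_linear[OF f'] by (simp add: linear_sum linear_cmul)
    finally show ?thesis by (simp add: D_def inner_sum_right mult.commute)
  qed
  then have "(f has_derivative (\<lambda>v. v \<bullet> D)) (at x)" using f' by (metis ext)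
  then show ?thesis using gradient_eqI by metis
qed

lemma continuous_on_matrix_vector:
  fixes M :: "'p::topological_space \<Rightarrow> real^'n^'m"
  assumes "continuous_on X M" "continuous_on X u"
  shows "continuous_on X (\<lambda>p. M p *v u p)"
  unfolding matrix_vector_mult_def
  by (intro continuous_on_vec_lambda continuous_on_sum continuous_on_mult continuous_on_component assms)

context orthonormal_frame
begin

lemma spec_of_diagonal:
  assumes "diagonal_mat (transpose Q ** A ** Q)"
  shows "A *v x = spec (\<lambda>i. (transpose Q ** A ** Q) $ i $ i) x"
proof -
  have "(\<chi> i j. if i = j then (transpose Q ** A ** Q) $ i $ i else 0) = transpose Q ** A ** Q"
    using assms by (auto simp: diagonal_mat_def vec_eq_iff)
  then show ?thesis
    by (simp add: spec_matrix matrix_vector_mul_assoc[symmetric] Q_cancel)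
qed

lemma spec_pos:
  assumes "sym_pos_def A" and A: "\<And>x. A *v x = spec f x"
  shows "0 < f i"
proof -
  define e where "e = Q *v axis i 1"
  have co: "coord e j = (if j = i then 1 else 0)" for j
    by (simp add: e_def coord_def Q_cancel axis_def)
  have "e \<noteq> 0" using co[of i] by auto
  then have "0 < e \<bullet> (A *v e)" using assms(1) by (simp add: sym_pos_def_def)
  also have "e \<bullet> (A *v e) = f i"
    by (simp add: A inner_coord co if_distrib cong: if_cong)
  finally show ?thesis .
qed

text \<open>Serves to remove \<open>sqrt C\<close> and \<open>C\<close> from the tail bounds on the
  derivatives of \<open>h\<close>.\<close>

lemma ex_inverse_bound:
  assumes f: "\<And>i. 0 < f i"
  shows "\<exists>m>0. \<forall>x. norm x \<le> m * norm (spec f x)"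
proof -
  obtain m where m: "0 < m" "\<And>i. \<bar>1 / f i\<bar> \<le> m"
    using compact_coefficient_bound[where F = "\<lambda>_ i. 1 / f i"] by (metis atLeastAtMost_iff continuous_on_const order_refl zero_le_one)
  have "norm x \<le> m * norm (spec f x)" for x
  proof -
    have nz: "f i \<noteq> 0" for i using f[of i] by simp
    have "norm (spec (\<lambda>i. 1 / f i) (spec f x)) \<le> m * norm (spec f x)" by (rule norm_spec_le[OF m(2)])
    then show ?thesis by (simp add: spec_spec nz spec_one)
  qed
  then show ?thesis using m(1) by blast
qed

end

theorem lemma3p10:
  fixes K :: real and C A :: "real^'n^'n" and h p0 :: "real^'n \<Rightarrow> real"
  assumes "sym_pos_def C"
    and "prob_space (target p0)"
    and "C2_function p0"
    and "integrable (target p0) (\<lambda>x. norm x ^ 3)"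
    and "gaussian_tail K C A h p0"
  shows "(\<forall>x. ((\<lambda>t. velocity C p0 t x) \<longlongrightarrow> (\<integral>y. y \<partial>target p0)) (at_right 0)
              \<and> velocity C p0 0 x = (\<integral>y. y \<partial>target p0))
         \<and> (\<exists>\<Phi>. unique_flow (velocity C p0) \<Phi>
              \<and> distr (gaussian C) borel (\<Phi> 1) = target p0)"
proof -
  have p0: "p0 x = exp (- ((weighted_norm A x)\<^sup>2 / 2)) * exp (h x)"
    and A: "sym_pos_def A"
    and grad_bound: "norm (mat_sqrt C *v gradient h x) \<le> K"
    and hess_bound: "mat_norm (C ** hessian h x) \<le> K" for x
    using assms(5) by (auto simp: gaussian_tail_def)
  obtain Q where Q: "orthogonal_matrix Q" "diagonal_mat (transpose Q ** A ** Q)" "diagonal_mat (transpose Q ** C ** Q)"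
    using assms(5) by (auto simp: gaussian_tail_def simultaneously_diagonalizable_def)
  interpret orthonormal_frame Q by standard (rule Q(1))
  obtain a where a: "\<And>x. A *v x = spec a x" using spec_of_diagonal[OF Q(2)] by blast
  obtain c where c: "\<And>x. C *v x = spec c x" using spec_of_diagonal[OF Q(3)] by blast
  have a_pos: "0 < a i" and c_pos: "0 < c i" for i
    using spec_pos[OF A a] spec_pos[OF assms(1) c] by auto
  have wn: "(weighted_norm A x)\<^sup>2 = x \<bullet> spec (\<lambda>i. 1 / a i) x" for x
  proof -
    have nz: "sqrt (a i) \<noteq> 0" for i using a_pos[of i] by simp
    have "weighted_norm A x = norm (spec (\<lambda>i. 1 / sqrt (a i)) x)"
      unfolding weighted_norm_def by (subst matrix_inv_spec[OF mat_sqrt_spec[OF a a_pos] nz]) simp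
    then show ?thesis
      using a_pos by (simp add: norm_coord inner_coord power_mult_distrib power_divide less_imp_le
          power2_eq_square[of "coord x _"])
  qed
  have p0_pos: "0 < p0 x" for x by (simp add: p0)
  \<comment> \<open>The differentiability of \<open>h\<close> is inherited from \<open>p0\<close>,
    by taking logarithms in the tail formula.\<close>
  have h_eq: "h x = ln (p0 x) + (x \<bullet> spec (\<lambda>i. 1 / a i) x) / 2" for x
    by (simp add: p0 ln_mult_pos wn)
  have dp0: "(p0 has_derivative (\<lambda>v. v \<bullet> gradient p0 x)) (at x)"
    and dgp0: "(gradient p0 has_derivative (\<lambda>v. hessian p0 x *v v)) (at x)"
    and chp0: "continuous_on UNIV (hessian p0)" for x
    using assms(3) has_derivative_gradient[of p0 x] jacobian_works[of "gradient p0" "at x"]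
    by (auto simp: C2_function_def hessian_def)
  \<comment> \<open>The derivatives of \<open>h\<close> read off from \<open>h_eq\<close>. The tail
    bounds on \<open>gradient h\<close> and \<open>hessian h\<close> become statements about
    \<open>g\<close> and \<open>g'\<close> only once these are shown to be the actual
    derivatives.\<close>
  define g where "g x = inverse (p0 x) *\<^sub>R gradient p0 x + spec (\<lambda>i. 1 / a i) x" for x
  define g' where "g' x v = (inverse (p0 x) *\<^sub>R (hessian p0 x *v v)
      + (- (inverse (p0 x) * (v \<bullet> gradient p0 x) * inverse (p0 x))) *\<^sub>R gradient p0 x) + spec (\<lambda>i. 1 / a i) v" for x v
  have dh: "(h has_derivative (\<lambda>v. v \<bullet> g x)) (at x)" for x
  proof -
    have "((\<lambda>x. ln (p0 x)) has_derivative (\<lambda>v. (v \<bullet> gradient p0 x) * inverse (p0 x))) (at x)"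
      using has_derivative_ln[OF p0_pos dp0, of x] by (simp add: divide_inverse)
    moreover have "((\<lambda>y. y \<bullet> spec (\<lambda>i. 1 / a i) y) has_derivative
        (\<lambda>v. x \<bullet> spec (\<lambda>i. 1 / a i) v + v \<bullet> spec (\<lambda>i. 1 / a i) x)) (at x)"
      by (intro has_derivative_inner has_derivative_ident bounded_linear_imp_has_derivative bounded_linear_spec)
    ultimately have "((\<lambda>x. ln (p0 x) + (x \<bullet> spec (\<lambda>i. 1 / a i) x) / 2) has_derivative
        (\<lambda>v. (v \<bullet> gradient p0 x) * inverse (p0 x)
          + (x \<bullet> spec (\<lambda>i. 1 / a i) v + v \<bullet> spec (\<lambda>i. 1 / a i) x) / 2)) (at x)"
      by (intro has_derivative_add bounded_linear.has_derivative[OF bounded_linear_divide])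
    moreover have "x \<bullet> spec (\<lambda>i. 1 / a i) v = v \<bullet> spec (\<lambda>i. 1 / a i) x" for v
      by (metis inner_commute inner_spec)
    ultimately show ?thesis
      by (simp add: h_eq[abs_def] g_def inner_add_right mult.commute)
  qed
  have gradient_h: "gradient h = g" using gradient_eqI[OF dh] by (simp add: fun_eq_iff)
  have dg: "(g has_derivative g' x) (at x)" for x
  proof -
    have nz: "p0 x \<noteq> 0" using p0_pos[of x] by simp
    show ?thesis
      unfolding g_def[abs_def] g'_def[abs_def]
      by (rule has_derivative_add[OF has_derivative_scaleR[OF Deriv.has_derivative_inverse[OF nz dp0] dgp0]
          bounded_linear_imp_has_derivative[OF bounded_linear_spec]])
  qed
  have cp0: "continuous_on UNIV p0" and cgp0: "continuous_on UNIV (gradient p0)"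
    using has_derivative_continuous[OF dp0] has_derivative_continuous[OF dgp0]
    by (simp_all add: continuous_at_imp_continuous_on)
  have cg': "continuous_on UNIV (\<lambda>(x, v). g' x v)"
  proof -
    have f: "continuous_on UNIV (\<lambda>p::(real^'n) \<times> (real^'n). fst p)" and s: "continuous_on UNIV (\<lambda>p::(real^'n) \<times> (real^'n). snd p)"
      by (intro continuous_intros)+
    note c = continuous_on_compose2[OF cp0 f subset_UNIV] continuous_on_compose2[OF cgp0 f subset_UNIV]
      continuous_on_compose2[OF chp0 f subset_UNIV]
    show ?thesis
      unfolding g'_def case_prod_unfold
      by (intro continuous_intros c continuous_on_matrix_vector) (use p0_pos in \<open>auto simp: less_imp_neq[symmetric]\<close>)
  qed
  have hess: "g' x v = hessian h x *v v" for x v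
  proof -
    have "g differentiable (at x)" using dg by (rule differentiableI)
    then have "(g has_derivative (\<lambda>v. hessian h x *v v)) (at x)"
      unfolding hessian_def gradient_h by (simp add: jacobian_works)
    then show ?thesis using has_derivative_unique[OF dg] by (metis)
  qed
  have K: "0 \<le> K" using order_trans[OF norm_ge_zero grad_bound] .
  obtain m1 where m1: "0 < m1" "\<And>x. norm x \<le> m1 * norm (spec (\<lambda>i. sqrt (c i)) x)"
    using ex_inverse_bound[of "\<lambda>i. sqrt (c i)"] c_pos by auto
  obtain m2 where m2: "0 < m2" "\<And>x. norm x \<le> m2 * norm (spec c x)"
    using ex_inverse_bound[of c] c_pos by auto
  \<comment> \<open>The summand 1 makes \<open>Kh\<close> positive even when \<open>K\<close> is
    0.\<close>
  define Kh where "Kh = m1 * K + m2 * K + 1"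
  have Kh: "m1 * K \<le> Kh" "m2 * K \<le> Kh" "0 < Kh"
    using K m1(1) m2(1) by (simp_all add: Kh_def add_nonneg_pos)
  have g_bound: "norm (g x) \<le> Kh" for x
  proof -
    have "norm (spec (\<lambda>i. sqrt (c i)) (g x)) \<le> K"
      using grad_bound[of x] by (simp add: mat_sqrt_spec[OF c c_pos] gradient_h)
    then have "norm (g x) \<le> m1 * K" using m1 by (meson less_imp_le mult_left_mono order_trans)
    then show ?thesis using Kh by linarith
  qed
  have g'_bound: "norm (g' x v) \<le> Kh * norm v" for x v
  proof -
    have "norm ((C ** hessian h x) *v v) \<le> mat_norm (C ** hessian h x) * norm v"
      unfolding mat_norm_def by (rule onorm[OF matrix_vector_mul_bounded_linear])
    also have "\<dots> \<le> K * norm v" by (intro mult_right_mono hess_bound) simp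
    finally have "norm (spec c (g' x v)) \<le> K * norm v"
      by (simp add: hess c flip: matrix_vector_mul_assoc)
    then have "norm (g' x v) \<le> m2 * (K * norm v)" using m2 by (meson less_imp_le mult_left_mono order_trans)
    also have "\<dots> \<le> Kh * norm v" using Kh(2) by (simp add: mult_right_mono flip: mult.assoc)
    finally show ?thesis .
  qed
  interpret gaussian_tail_model Q a c h g g' Kh
    by standard (use a_pos c_pos dh dg cg' Kh g_bound g'_bound in auto)
  have "p0 = dens" by (simp add: fun_eq_iff p0 dens_def wn)
  then show ?thesis using follmer_flow[OF c] assms(2) by simp
qed

end
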